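(* The class of Whitehead groups is first-order definable in a diagrammatic way in the category $Ab$ of abelian groups (over ZFC). That is, there is a diagrammatic first-order formula $\varphi(X)$ in the language of categories, with one free object variable, such that ZFC proves: for every abelian group $A$, $\varphi(A)$ holds in the category $Ab$ if and only if $A$ is a Whitehead group.
   Context: An abelian group $A$ is a Whitehead group if every extension of $A$ by $\mathbb{Z}$ splits, i.e. for each short exact sequence $0\to\mathbb{Z}\to E\to A\to0$ of abelian groups there is a homomorphism $A\to E$ that is a right inverse (section) of $E\to A$; equivalently $\mathrm{Ext}(A,\mathbb{Z})=0$. $Ab$ is the category of abelian groups and homomorphisms. The first-order language of categories speaks about objects, morphisms, and composition. Diagrammatic (in the sense of Freyd) means expressible by a finite formula in a language of diagrams using the quantifiers $\forall,\exists$: variables range over objects and over morphisms with declared source and target, atomic formulas are equalities between parallel morphisms (commutativity of diagrams, with composites and identities allowed), formulas are closed under Boolean connectives and quantifiers over objects and over morphisms with given source and target, and equality between objects is not used. *)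

theory Defs
  imports Main
begin

section \<open>First-order logic of set theory\<close>

text \<open>Formulas of the language with membership and equality, with de Bruijn indices. There are no
  function symbols, so the only terms are variables and substitution is renaming.\<close>

datatype fm =
    FMem nat nat
  | FEq nat nat
  | FBot
  | FImp fm fm
  | FAll fm

primrec lift :: "(nat \<Rightarrow> nat) \<Rightarrow> nat \<Rightarrow> nat" where
  "lift r 0 = 0"
| "lift r (Suc i) = Suc (r i)"

primrec ren :: "(nat \<Rightarrow> nat) \<Rightarrow> fm \<Rightarrow> fm" where
  "ren r (FMem x y) = FMem (r x) (r y)"
| "ren r (FEq x y) = FEq (r x) (r y)"
| "ren r FBot = FBot"
| "ren r (FImp p q) = FImp (ren r p) (ren r q)"
| "ren r (FAll p) = FAll (ren (lift r) p)"

definition inst :: "nat \<Rightarrow> fm \<Rightarrow> fm" where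
  "inst t = ren (case_nat t (\<lambda>i. i))"

text \<open>Natural deduction for classical first-order logic with equality. Rule \<open>AllI\<close> shifts the
  context \<open>\<Gamma>\<close> but not the theory \<open>T\<close>: free variables of an axiom in \<open>T\<close> are thus implicitly
  universally quantified, whereas those of \<open>\<Gamma>\<close> are parameters.\<close>

inductive derives :: "fm set \<Rightarrow> fm list \<Rightarrow> fm \<Rightarrow> bool" for T :: "fm set" where
  Axiom: "p \<in> T \<Longrightarrow> derives T \<Gamma> p"
| Assume: "p \<in> set \<Gamma> \<Longrightarrow> derives T \<Gamma> p"
| ImpI: "derives T (p # \<Gamma>) q \<Longrightarrow> derives T \<Gamma> (FImp p q)"
| ImpE: "derives T \<Gamma> (FImp p q) \<Longrightarrow> derives T \<Gamma> p \<Longrightarrow> derives T \<Gamma> q"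
| Classical: "derives T (FImp p FBot # \<Gamma>) FBot \<Longrightarrow> derives T \<Gamma> p"
| AllI: "derives T (map (ren Suc) \<Gamma>) p \<Longrightarrow> derives T \<Gamma> (FAll p)"
| AllE: "derives T \<Gamma> (FAll p) \<Longrightarrow> derives T \<Gamma> (inst t p)"
| Refl: "derives T \<Gamma> (FEq t t)"
| Subst: "derives T \<Gamma> (FEq s t) \<Longrightarrow> derives T \<Gamma> (inst s p) \<Longrightarrow> derives T \<Gamma> (inst t p)"


section \<open>Writing formulas with named binders\<close>

text \<open>A \<open>form\<close> maps the number \<open>d\<close> of enclosing quantifiers to a de Bruijn formula. Inside a
  \<open>form\<close>, a bound variable is referred to by its level, that is, the number of quantifiers outside
  its own binder. Level \<open>x\<close> at depth \<open>d\<close> is the index \<open>d - Suc x\<close>. Levels do not change under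
  further quantifiers, so HOL binders can be used for the object-level quantifiers. Applying a
  closed \<open>form\<close> to \<open>0\<close> yields the formula it denotes.\<close>

type_synonym form = "nat \<Rightarrow> fm"

definition mem :: "nat \<Rightarrow> nat \<Rightarrow> form" (infix "\<^bold>\<in>" 50) where
  "(x \<^bold>\<in> y) = (\<lambda>d. FMem (d - Suc x) (d - Suc y))"

definition eql :: "nat \<Rightarrow> nat \<Rightarrow> form" (infix "\<^bold>=" 50) where
  "(x \<^bold>= y) = (\<lambda>d. FEq (d - Suc x) (d - Suc y))"

definition imp :: "form \<Rightarrow> form \<Rightarrow> form" (infixr "\<^bold>\<longrightarrow>" 25) where
  "(F \<^bold>\<longrightarrow> G) = (\<lambda>d. FImp (F d) (G d))"

definition neg :: "form \<Rightarrow> form" ("\<^bold>\<not> _" [40] 40) where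
  "(\<^bold>\<not> F) = (\<lambda>d. FImp (F d) FBot)"

definition disj :: "form \<Rightarrow> form \<Rightarrow> form" (infixr "\<^bold>\<or>" 30) where
  "(F \<^bold>\<or> G) = (\<^bold>\<not> F \<^bold>\<longrightarrow> G)"

definition conj :: "form \<Rightarrow> form \<Rightarrow> form" (infixr "\<^bold>\<and>" 35) where
  "(F \<^bold>\<and> G) = (\<^bold>\<not> (F \<^bold>\<longrightarrow> \<^bold>\<not> G))"

definition iff :: "form \<Rightarrow> form \<Rightarrow> form" (infixr "\<^bold>\<longleftrightarrow>" 25) where
  "(F \<^bold>\<longleftrightarrow> G) = ((F \<^bold>\<longrightarrow> G) \<^bold>\<and> (G \<^bold>\<longrightarrow> F))"

definition all :: "(nat \<Rightarrow> form) \<Rightarrow> form" (binder "\<^bold>\<forall>" 10) where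
  "all F = (\<lambda>d. FAll (F d (Suc d)))"

definition ex :: "(nat \<Rightarrow> form) \<Rightarrow> form" (binder "\<^bold>\<exists>" 10) where
  "(\<^bold>\<exists>x. F x) = (\<^bold>\<not> (\<^bold>\<forall>x. \<^bold>\<not> F x))"

text \<open>\<open>schema p xs\<close> is the formula \<open>p\<close> with its first \<open>length xs\<close> free variables instantiated by the
  levels \<open>xs\<close>; its remaining free variables are parameters, left free in the whole axiom.\<close>

definition schema :: "fm \<Rightarrow> nat list \<Rightarrow> form" where
  "schema p xs =
    (\<lambda>d. ren (\<lambda>i. if i < length xs then d - Suc (xs ! i) else i - length xs + d) p)"


section \<open>ZFC\<close>

definition is_empty :: "nat \<Rightarrow> form" where
  "is_empty x = (\<^bold>\<forall>z. \<^bold>\<not> z \<^bold>\<in> x)"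

definition is_upair :: "nat \<Rightarrow> nat \<Rightarrow> nat \<Rightarrow> form" where
  "is_upair a b u = (\<^bold>\<forall>z. z \<^bold>\<in> u \<^bold>\<longleftrightarrow> z \<^bold>= a \<^bold>\<or> z \<^bold>= b)"

definition is_succ :: "nat \<Rightarrow> nat \<Rightarrow> form" where
  "is_succ n m = (\<^bold>\<forall>z. z \<^bold>\<in> m \<^bold>\<longleftrightarrow> z \<^bold>\<in> n \<^bold>\<or> z \<^bold>= n)"

definition is_inductive :: "nat \<Rightarrow> form" where
  "is_inductive w =
    ((\<^bold>\<exists>z. is_empty z \<^bold>\<and> z \<^bold>\<in> w) \<^bold>\<and> (\<^bold>\<forall>n. n \<^bold>\<in> w \<^bold>\<longrightarrow> (\<^bold>\<exists>m. is_succ n m \<^bold>\<and> m \<^bold>\<in> w)))"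

definition extensionality :: form where
  "extensionality = (\<^bold>\<forall>x. \<^bold>\<forall>y. (\<^bold>\<forall>z. z \<^bold>\<in> x \<^bold>\<longleftrightarrow> z \<^bold>\<in> y) \<^bold>\<longrightarrow> x \<^bold>= y)"

definition foundation :: form where
  "foundation =
    (\<^bold>\<forall>x. (\<^bold>\<exists>y. y \<^bold>\<in> x) \<^bold>\<longrightarrow> (\<^bold>\<exists>y. y \<^bold>\<in> x \<^bold>\<and> \<^bold>\<not> (\<^bold>\<exists>z. z \<^bold>\<in> x \<^bold>\<and> z \<^bold>\<in> y)))"

definition pairing :: form where
  "pairing = (\<^bold>\<forall>x. \<^bold>\<forall>y. \<^bold>\<exists>u. is_upair x y u)"

definition union :: form where
  "union = (\<^bold>\<forall>x. \<^bold>\<exists>u. \<^bold>\<forall>z. z \<^bold>\<in> u \<^bold>\<longleftrightarrow> (\<^bold>\<exists>y. y \<^bold>\<in> x \<^bold>\<and> z \<^bold>\<in> y))"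

definition powerset :: form where
  "powerset = (\<^bold>\<forall>x. \<^bold>\<exists>u. \<^bold>\<forall>y. y \<^bold>\<in> u \<^bold>\<longleftrightarrow> (\<^bold>\<forall>z. z \<^bold>\<in> y \<^bold>\<longrightarrow> z \<^bold>\<in> x))"

definition infinity :: form where
  "infinity = (\<^bold>\<exists>w. is_inductive w)"

definition separation :: "fm \<Rightarrow> form" where
  "separation p = (\<^bold>\<forall>a. \<^bold>\<exists>b. \<^bold>\<forall>x. x \<^bold>\<in> b \<^bold>\<longleftrightarrow> x \<^bold>\<in> a \<^bold>\<and> schema p [x, a])"

definition replacement :: "fm \<Rightarrow> form" where
  "replacement p =
    (\<^bold>\<forall>a. (\<^bold>\<forall>x. x \<^bold>\<in> a \<^bold>\<longrightarrow> (\<^bold>\<forall>y. \<^bold>\<forall>y'. schema p [x, y, a] \<^bold>\<and> schema p [x, y', a] \<^bold>\<longrightarrow> y \<^bold>= y')) \<^bold>\<longrightarrow>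
      (\<^bold>\<exists>b. \<^bold>\<forall>y. y \<^bold>\<in> b \<^bold>\<longleftrightarrow> (\<^bold>\<exists>x. x \<^bold>\<in> a \<^bold>\<and> schema p [x, y, a])))"

definition choice :: form where
  "choice =
    (\<^bold>\<forall>a. (\<^bold>\<forall>x. x \<^bold>\<in> a \<^bold>\<longrightarrow> (\<^bold>\<exists>z. z \<^bold>\<in> x)) \<^bold>\<and>
        (\<^bold>\<forall>x. \<^bold>\<forall>y. x \<^bold>\<in> a \<^bold>\<and> y \<^bold>\<in> a \<^bold>\<and> (\<^bold>\<exists>z. z \<^bold>\<in> x \<^bold>\<and> z \<^bold>\<in> y) \<^bold>\<longrightarrow> x \<^bold>= y) \<^bold>\<longrightarrow>
      (\<^bold>\<exists>c. \<^bold>\<forall>x. x \<^bold>\<in> a \<^bold>\<longrightarrow>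
        (\<^bold>\<exists>z. z \<^bold>\<in> x \<^bold>\<and> z \<^bold>\<in> c \<^bold>\<and> (\<^bold>\<forall>z'. z' \<^bold>\<in> x \<^bold>\<and> z' \<^bold>\<in> c \<^bold>\<longrightarrow> z' \<^bold>= z))))"

definition ZFC :: "fm set" where
  "ZFC =
    {extensionality 0, foundation 0, pairing 0, union 0, powerset 0, infinity 0, choice 0}
    \<union> {separation p 0 | p. True} \<union> {replacement p 0 | p. True}"

definition ZFC_proves :: "form \<Rightarrow> bool" where
  "ZFC_proves F \<longleftrightarrow> derives ZFC [] (F 0)"


section \<open>Abelian groups in the language of set theory\<close>

text \<open>Kuratowski pairs; functions are sets of pairs. \<open>app f x y\<close> means \<open>f(x) = y\<close>, and
  \<open>app2 f x y z\<close> means \<open>f(x, y) = z\<close>.\<close>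

definition is_pair :: "nat \<Rightarrow> nat \<Rightarrow> nat \<Rightarrow> form" where
  "is_pair a b p = (\<^bold>\<exists>u. \<^bold>\<exists>v. is_upair a a u \<^bold>\<and> is_upair a b v \<^bold>\<and> is_upair u v p)"

definition is_prod :: "nat \<Rightarrow> nat \<Rightarrow> nat \<Rightarrow> form" where
  "is_prod A B P = (\<^bold>\<forall>p. p \<^bold>\<in> P \<^bold>\<longleftrightarrow> (\<^bold>\<exists>x. \<^bold>\<exists>y. x \<^bold>\<in> A \<^bold>\<and> y \<^bold>\<in> B \<^bold>\<and> is_pair x y p))"

definition app :: "nat \<Rightarrow> nat \<Rightarrow> nat \<Rightarrow> form" where
  "app f x y = (\<^bold>\<exists>p. is_pair x y p \<^bold>\<and> p \<^bold>\<in> f)"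

definition app2 :: "nat \<Rightarrow> nat \<Rightarrow> nat \<Rightarrow> nat \<Rightarrow> form" where
  "app2 f x y z = (\<^bold>\<exists>p. is_pair x y p \<^bold>\<and> app f p z)"

definition is_fun :: "nat \<Rightarrow> nat \<Rightarrow> nat \<Rightarrow> form" where
  "is_fun f A B =
    ((\<^bold>\<forall>p. p \<^bold>\<in> f \<^bold>\<longrightarrow> (\<^bold>\<exists>x. \<^bold>\<exists>y. x \<^bold>\<in> A \<^bold>\<and> y \<^bold>\<in> B \<^bold>\<and> is_pair x y p)) \<^bold>\<and>
     (\<^bold>\<forall>x. x \<^bold>\<in> A \<^bold>\<longrightarrow> (\<^bold>\<exists>y. app f x y \<^bold>\<and> (\<^bold>\<forall>y'. app f x y' \<^bold>\<longrightarrow> y' \<^bold>= y))))"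

definition is_binop :: "nat \<Rightarrow> nat \<Rightarrow> form" where
  "is_binop s C = (\<^bold>\<exists>D. is_prod C C D \<^bold>\<and> is_fun s D C)"

text \<open>An abelian group is a pair \<open>(C, s)\<close> of a set and a binary operation on it.\<close>

definition is_abgroup :: "nat \<Rightarrow> form" where
  "is_abgroup A =
    (\<^bold>\<exists>C. \<^bold>\<exists>s. is_pair C s A \<^bold>\<and> is_binop s C \<^bold>\<and>
      (\<^bold>\<forall>x. \<^bold>\<forall>y. \<^bold>\<forall>z. \<^bold>\<forall>u. \<^bold>\<forall>v. \<^bold>\<forall>w.
        app2 s x y u \<^bold>\<and> app2 s u z w \<^bold>\<and> app2 s y z v \<^bold>\<longrightarrow> app2 s x v w) \<^bold>\<and>
      (\<^bold>\<forall>x. \<^bold>\<forall>y. \<^bold>\<forall>u. app2 s x y u \<^bold>\<longrightarrow> app2 s y x u) \<^bold>\<and>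
      (\<^bold>\<exists>e. e \<^bold>\<in> C \<^bold>\<and> (\<^bold>\<forall>x. x \<^bold>\<in> C \<^bold>\<longrightarrow> app2 s e x x \<^bold>\<and> (\<^bold>\<exists>y. y \<^bold>\<in> C \<^bold>\<and> app2 s x y e))))"

definition is_hom :: "nat \<Rightarrow> nat \<Rightarrow> nat \<Rightarrow> form" where
  "is_hom f A B =
    (\<^bold>\<exists>C. \<^bold>\<exists>s. \<^bold>\<exists>D. \<^bold>\<exists>t. is_pair C s A \<^bold>\<and> is_pair D t B \<^bold>\<and> is_fun f C D \<^bold>\<and>
      (\<^bold>\<forall>x. \<^bold>\<forall>y. \<^bold>\<forall>z. \<^bold>\<forall>x'. \<^bold>\<forall>y'. \<^bold>\<forall>z'.
        app2 s x y z \<^bold>\<and> app f x x' \<^bold>\<and> app f y y' \<^bold>\<and> app2 t x' y' z' \<^bold>\<longrightarrow> app f z z'))"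

definition is_id :: "nat \<Rightarrow> nat \<Rightarrow> form" where
  "is_id A f =
    (\<^bold>\<exists>C. \<^bold>\<exists>s. is_pair C s A \<^bold>\<and> (\<^bold>\<forall>p. p \<^bold>\<in> f \<^bold>\<longleftrightarrow> (\<^bold>\<exists>x. x \<^bold>\<in> C \<^bold>\<and> is_pair x x p)))"

text \<open>\<open>is_comp g f h\<close> means \<open>h = g \<circ> f\<close>.\<close>

definition is_comp :: "nat \<Rightarrow> nat \<Rightarrow> nat \<Rightarrow> form" where
  "is_comp g f h =
    (\<^bold>\<forall>p. p \<^bold>\<in> h \<^bold>\<longleftrightarrow> (\<^bold>\<exists>x. \<^bold>\<exists>y. \<^bold>\<exists>z. app f x y \<^bold>\<and> app g y z \<^bold>\<and> is_pair x z p))"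

definition is_zero :: "nat \<Rightarrow> nat \<Rightarrow> form" where
  "is_zero A e =
    (\<^bold>\<exists>C. \<^bold>\<exists>s. is_pair C s A \<^bold>\<and> e \<^bold>\<in> C \<^bold>\<and> (\<^bold>\<forall>x. x \<^bold>\<in> C \<^bold>\<longrightarrow> app2 s e x x))"

definition is_inj :: "nat \<Rightarrow> form" where
  "is_inj f = (\<^bold>\<forall>x. \<^bold>\<forall>x'. \<^bold>\<forall>y. app f x y \<^bold>\<and> app f x' y \<^bold>\<longrightarrow> x \<^bold>= x')"

definition is_surj :: "nat \<Rightarrow> nat \<Rightarrow> form" where
  "is_surj f B =
    (\<^bold>\<exists>D. \<^bold>\<exists>t. is_pair D t B \<^bold>\<and> (\<^bold>\<forall>y. y \<^bold>\<in> D \<^bold>\<longrightarrow> (\<^bold>\<exists>x. app f x y)))"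

text \<open>The group of integers, as the quotient of \<open>\<omega> \<times> \<omega>\<close> in which the class of \<open>(a, b)\<close> stands for
  \<open>a - b\<close>.\<close>

definition is_omega :: "nat \<Rightarrow> form" where
  "is_omega w =
    (is_inductive w \<^bold>\<and> (\<^bold>\<forall>v. is_inductive v \<^bold>\<longrightarrow> (\<^bold>\<forall>n. n \<^bold>\<in> w \<^bold>\<longrightarrow> n \<^bold>\<in> v)))"

definition is_nat_add :: "nat \<Rightarrow> nat \<Rightarrow> form" where
  "is_nat_add w s =
    (is_binop s w \<^bold>\<and>
     (\<^bold>\<forall>m. \<^bold>\<forall>z. m \<^bold>\<in> w \<^bold>\<and> is_empty z \<^bold>\<longrightarrow> app2 s m z m) \<^bold>\<and>
     (\<^bold>\<forall>m. \<^bold>\<forall>n. \<^bold>\<forall>k. \<^bold>\<forall>n'. \<^bold>\<forall>k'.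
        app2 s m n k \<^bold>\<and> is_succ n n' \<^bold>\<and> is_succ k k' \<^bold>\<longrightarrow> app2 s m n' k'))"

definition is_int_class :: "nat \<Rightarrow> nat \<Rightarrow> nat \<Rightarrow> nat \<Rightarrow> form" where
  "is_int_class s a b q =
    (\<^bold>\<forall>p. p \<^bold>\<in> q \<^bold>\<longleftrightarrow> (\<^bold>\<exists>c. \<^bold>\<exists>d. is_pair c d p \<^bold>\<and> (\<^bold>\<exists>k. app2 s a d k \<^bold>\<and> app2 s c b k)))"

definition is_int :: "nat \<Rightarrow> form" where
  "is_int Z =
    (\<^bold>\<exists>w. \<^bold>\<exists>s. \<^bold>\<exists>C. \<^bold>\<exists>t. is_omega w \<^bold>\<and> is_nat_add w s \<^bold>\<and> is_pair C t Z \<^bold>\<and>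
      (\<^bold>\<forall>q. q \<^bold>\<in> C \<^bold>\<longleftrightarrow> (\<^bold>\<exists>a. \<^bold>\<exists>b. a \<^bold>\<in> w \<^bold>\<and> b \<^bold>\<in> w \<^bold>\<and> is_int_class s a b q)) \<^bold>\<and>
      is_binop t C \<^bold>\<and>
      (\<^bold>\<forall>a. \<^bold>\<forall>b. \<^bold>\<forall>c. \<^bold>\<forall>d. \<^bold>\<forall>i. \<^bold>\<forall>j. \<^bold>\<forall>q. \<^bold>\<forall>r. \<^bold>\<forall>x.
        app2 s a c i \<^bold>\<and> app2 s b d j \<^bold>\<and>
        is_int_class s a b q \<^bold>\<and> is_int_class s c d r \<^bold>\<and> is_int_class s i j x \<^bold>\<longrightarrow>
        app2 t q r x))"

definition is_short_exact :: "nat \<Rightarrow> nat \<Rightarrow> nat \<Rightarrow> nat \<Rightarrow> nat \<Rightarrow> form" where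
  "is_short_exact Z f E g A =
    (is_hom f Z E \<^bold>\<and> is_hom g E A \<^bold>\<and> is_inj f \<^bold>\<and> is_surj g A \<^bold>\<and>
     (\<^bold>\<exists>e. is_zero A e \<^bold>\<and> (\<^bold>\<forall>y. (\<^bold>\<exists>x. app f x y) \<^bold>\<longleftrightarrow> app g y e)))"

definition is_whitehead :: "nat \<Rightarrow> form" where
  "is_whitehead A =
    (is_abgroup A \<^bold>\<and>
     (\<^bold>\<forall>Z. \<^bold>\<forall>E. \<^bold>\<forall>f. \<^bold>\<forall>g. is_int Z \<^bold>\<and> is_abgroup E \<^bold>\<and> is_short_exact Z f E g A \<^bold>\<longrightarrow>
        (\<^bold>\<exists>h. is_hom h A E \<^bold>\<and> (\<^bold>\<exists>i. is_id A i \<^bold>\<and> is_comp g h i))))"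


section \<open>Diagrammatic formulas\<close>

text \<open>Object variables and morphism variables are two separate sorts, both named by natural numbers.
  \<open>MComp t u\<close> is \<open>t\<close> after \<open>u\<close>. In \<open>DAllMor k i j \<phi>\<close> and \<open>DExMor k i j \<phi>\<close> the morphism variable \<open>k\<close>
  ranges over the morphisms from object \<open>i\<close> to object \<open>j\<close>.\<close>

datatype mterm =
    MVar nat
  | MId nat
  | MComp mterm mterm

datatype dform =
    DEq mterm mterm
  | DNeg dform
  | DConj dform dform
  | DDisj dform dform
  | DAllOb nat dform
  | DExOb nat dform
  | DAllMor nat nat nat dform
  | DExMor nat nat nat dform

text \<open>Typing relative to a set \<open>V\<close> of declared object variables and a declaration \<open>D\<close> of source and
  target for morphism variables.\<close>

inductive arrow :: "nat set \<Rightarrow> (nat \<rightharpoonup> nat \<times> nat) \<Rightarrow> mterm \<Rightarrow> nat \<Rightarrow> nat \<Rightarrow> bool"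
  for V :: "nat set" and D :: "nat \<rightharpoonup> nat \<times> nat" where
  "D k = Some (i, j) \<Longrightarrow> arrow V D (MVar k) i j"
| "i \<in> V \<Longrightarrow> arrow V D (MId i) i i"
| "arrow V D u i j \<Longrightarrow> arrow V D t j k \<Longrightarrow> arrow V D (MComp t u) i k"

text \<open>Object variables in scope must not be rebound, since morphism variables in scope may be declared
  with them as source or target. Equations are admitted between parallel terms only, and there is no
  equality of objects.\<close>

primrec diagrammatic :: "nat set \<Rightarrow> (nat \<rightharpoonup> nat \<times> nat) \<Rightarrow> dform \<Rightarrow> bool" where
  "diagrammatic V D (DEq t u) \<longleftrightarrow> (\<exists>i j. arrow V D t i j \<and> arrow V D u i j)"
| "diagrammatic V D (DNeg \<phi>) \<longleftrightarrow> diagrammatic V D \<phi>"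
| "diagrammatic V D (DConj \<phi> \<psi>) \<longleftrightarrow> diagrammatic V D \<phi> \<and> diagrammatic V D \<psi>"
| "diagrammatic V D (DDisj \<phi> \<psi>) \<longleftrightarrow> diagrammatic V D \<phi> \<and> diagrammatic V D \<psi>"
| "diagrammatic V D (DAllOb i \<phi>) \<longleftrightarrow> i \<notin> V \<and> diagrammatic (insert i V) D \<phi>"
| "diagrammatic V D (DExOb i \<phi>) \<longleftrightarrow> i \<notin> V \<and> diagrammatic (insert i V) D \<phi>"
| "diagrammatic V D (DAllMor k i j \<phi>) \<longleftrightarrow> i \<in> V \<and> j \<in> V \<and> diagrammatic V (D(k \<mapsto> (i, j))) \<phi>"
| "diagrammatic V D (DExMor k i j \<phi>) \<longleftrightarrow> i \<in> V \<and> j \<in> V \<and> diagrammatic V (D(k \<mapsto> (i, j))) \<phi>"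

text \<open>Interpretation in the category of abelian groups, as formulas of set theory. The assignments
  \<open>ob\<close> and \<open>mor\<close> send variables of the diagrammatic language to variables (levels) of set theory.
  \<open>denotes ob mor t h\<close> says that \<open>h\<close> is the value of the term \<open>t\<close>.\<close>

primrec denotes :: "(nat \<Rightarrow> nat) \<Rightarrow> (nat \<Rightarrow> nat) \<Rightarrow> mterm \<Rightarrow> nat \<Rightarrow> form" where
  "denotes ob mor (MVar k) h = (h \<^bold>= mor k)"
| "denotes ob mor (MId i) h = is_id (ob i) h"
| "denotes ob mor (MComp t u) h =
    (\<^bold>\<exists>g. \<^bold>\<exists>f. denotes ob mor t g \<^bold>\<and> denotes ob mor u f \<^bold>\<and> is_comp g f h)"

primrec holds_in_Ab :: "(nat \<Rightarrow> nat) \<Rightarrow> (nat \<Rightarrow> nat) \<Rightarrow> dform \<Rightarrow> form" where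
  "holds_in_Ab ob mor (DEq t u) = (\<^bold>\<exists>h. denotes ob mor t h \<^bold>\<and> denotes ob mor u h)"
| "holds_in_Ab ob mor (DNeg \<phi>) = (\<^bold>\<not> holds_in_Ab ob mor \<phi>)"
| "holds_in_Ab ob mor (DConj \<phi> \<psi>) = (holds_in_Ab ob mor \<phi> \<^bold>\<and> holds_in_Ab ob mor \<psi>)"
| "holds_in_Ab ob mor (DDisj \<phi> \<psi>) = (holds_in_Ab ob mor \<phi> \<^bold>\<or> holds_in_Ab ob mor \<psi>)"
| "holds_in_Ab ob mor (DAllOb i \<phi>) = (\<^bold>\<forall>X. is_abgroup X \<^bold>\<longrightarrow> holds_in_Ab (ob(i := X)) mor \<phi>)"
| "holds_in_Ab ob mor (DExOb i \<phi>) = (\<^bold>\<exists>X. is_abgroup X \<^bold>\<and> holds_in_Ab (ob(i := X)) mor \<phi>)"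
| "holds_in_Ab ob mor (DAllMor k i j \<phi>) =
    (\<^bold>\<forall>f. is_hom f (ob i) (ob j) \<^bold>\<longrightarrow> holds_in_Ab ob (mor(k := f)) \<phi>)"
| "holds_in_Ab ob mor (DExMor k i j \<phi>) =
    (\<^bold>\<exists>f. is_hom f (ob i) (ob j) \<^bold>\<and> holds_in_Ab ob (mor(k := f)) \<phi>)"

text \<open>\<open>\<phi>(A)\<close> for a formula whose only free variable is the object variable \<open>0\<close>. The values assigned
  to all other variables are immaterial.\<close>

definition Ab_satisfies :: "dform \<Rightarrow> nat \<Rightarrow> form" where
  "Ab_satisfies \<phi> A = holds_in_Ab (\<lambda>_. A) (\<lambda>_. A) \<phi>"

end

theory Submission
  imports Defs "HOL-Library.Countable_Set" "HOL-Algebra.Group"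
begin

text \<open>Since Whitehead groups are defined by extensions by the integers, it suffices to define the group
  of integers diagrammatically. It is, up to isomorphism, the nonzero object that is a retract of
  every generator of the category: a generator has a nonzero homomorphism to the integers, and
  dividing it by the least positive element of its image makes it a retraction; conversely, the
  idempotent endomorphisms of the integers are \<open>0\<close> and \<open>1\<close>. As elements of \<open>Y\<close> correspond to
  homomorphisms from the integers to \<open>Y\<close>, short exactness is diagrammatic as well.

  Provability in ZFC is reduced by the completeness theorem to truth in all models, so that the
  argument is carried out inside an arbitrary model, where sets can be formed by definable
  properties only.\<close>

section \<open>Derivations\<close>

text \<open>What shapes most of the development is that a model may be nonstandard: its
  \<open>omega\<close> can have elements that correspond to no natural number of HOL. The integers
  over which \<open>is_whitehead\<close> speaks are those of the model, so addition, multiples and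
  division with remainder have to be developed there, and every induction, recursion or function
  needs a definable property or operation. The predicate \<open>definable\<close> with the rules
  \<open>dfn\<close> reduces that obligation to syntax-directed bookkeeping. Facts such as
  cancellation are insensitive to the distinction and are borrowed from HOL-Algebra.

  A diagrammatic formula determines an object up to isomorphism only, whereas \<open>is_int\<close>
  describes one particular set. The two meet because an extension by a free object on one generator
  becomes an extension by the integers when its inclusion is precomposed with an isomorphism; the
  middle term and the projection stay the same, hence so does the question of splitting.\<close>

lemma lift_eq_case_nat: "lift r = case_nat 0 (\<lambda>i. Suc (r i))"
  by (rule ext) (simp split: nat.split)

lemma lift_comp: "lift r \<circ> lift s = lift (r \<circ> s)"
  by (rule ext) (simp add: lift_eq_case_nat split: nat.split)

lemma ren_ren: "ren r (ren s p) = ren (r \<circ> s) p"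
  by (induction p arbitrary: r s) (simp_all add: lift_comp)

lemma ren_id [simp]: "ren (\<lambda>i. i) p = p"
proof -
  have "lift (\<lambda>i. i) = (\<lambda>i. i)"
    by (rule ext) (simp add: lift_eq_case_nat split: nat.split)
  then show ?thesis
    by (induction p) simp_all
qed

text \<open>An exclusive bound on the free de Bruijn indices. It tells how many quantifiers close a
  formula and from which index on a variable is fresh.\<close>

primrec bnd :: "fm \<Rightarrow> nat" where
  "bnd (FMem x y) = max (Suc x) (Suc y)"
| "bnd (FEq x y) = max (Suc x) (Suc y)"
| "bnd FBot = 0"
| "bnd (FImp p q) = max (bnd p) (bnd q)"
| "bnd (FAll p) = bnd p - 1"

lemma ren_cong: "(\<And>i. i < bnd p \<Longrightarrow> r i = s i) \<Longrightarrow> ren r p = ren s p"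
proof (induction p arbitrary: r s)
  case (FAll p)
  have "lift r i = lift s i" if "i < bnd p" for i
    using that FAll.prems by (cases i) auto
  then show ?case
    using FAll.IH[of "lift r" "lift s"] by simp
next
  case (FImp p q)
  have "ren r p = ren s p" "ren r q = ren s q"
    by (rule FImp.IH, rule FImp.prems, simp)+
  then show ?case
    by simp
qed simp_all

lemma ren_inst: "ren r (inst t p) = inst (r t) (ren (lift r) p)"
  unfolding inst_def ren_ren
  by (rule arg_cong[where f = "\<lambda>r. ren r p"], rule ext) (simp split: nat.split)

lemma inst_ren_lift: "inst t (ren (lift v) p) = ren (case_nat t v) p"
  unfolding inst_def ren_ren
  by (rule arg_cong[where f = "\<lambda>r. ren r p"], rule ext) (simp add: lift_eq_case_nat split: nat.split)

lemma funpow_lift: "(lift ^^ m) r i = (if i < m then i else r (i - m) + m)"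
proof (induction m arbitrary: i)
  case (Suc m)
  show ?case
    using Suc by (cases i) auto
qed simp

lemma ren_funpow_FAll: "ren r ((FAll ^^ m) p) = (FAll ^^ m) (ren ((lift ^^ m) r) p)"
  by (induction m arbitrary: r) (simp_all add: funpow_swap1[of lift])

section \<open>Weakening, renaming and fresh variables in derivations\<close>

lemma derives_mono: "derives T \<Gamma> p \<Longrightarrow> set \<Gamma> \<subseteq> set \<Delta> \<Longrightarrow> derives T \<Delta> p"
proof (induction arbitrary: \<Delta> rule: derives.induct)
  case (ImpI p \<Gamma> q)
  show ?case
    by (rule derives.ImpI, rule ImpI.IH) (use ImpI.prems in auto)
next
  case (Classical p \<Gamma>)
  show ?case
    by (rule derives.Classical, rule Classical.IH) (use Classical.prems in auto)
next
  case (AllI \<Gamma> p)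
  show ?case
    by (rule derives.AllI, rule AllI.IH) (use AllI.prems in auto)
next
  case (Subst \<Gamma> s t p)
  show ?case
    by (rule derives.Subst[OF Subst.IH]) (rule Subst.prems)+
next
  case (ImpE \<Gamma> p q)
  show ?case
    by (rule derives.ImpE[OF ImpE.IH]) (rule ImpE.prems)+
next
  case (AllE \<Gamma> p t)
  show ?case
    by (rule derives.AllE[OF AllE.IH]) (rule AllE.prems)
qed (auto intro: Axiom Assume Refl)

lemma derives_funpow_FAll: "p \<in> T \<Longrightarrow> derives T \<Gamma> ((FAll ^^ n) p)"
  by (induction n arbitrary: \<Gamma>) (auto intro: Axiom AllI)

lemma derives_funpow_FAllD:
  "derives T \<Gamma> ((FAll ^^ n) p) \<Longrightarrow> derives T \<Gamma> (ren (\<lambda>i. if i < n then r i else i - n) p)"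
proof (induction n arbitrary: p)
  case (Suc n)
  \<comment> \<open>The outermost quantifier binds index \<open>n\<close> below the other
    \<open>n\<close> quantifiers, hence it receives the value \<open>r n\<close>.\<close>
  have "derives T \<Gamma> (inst (r n) ((FAll ^^ n) p))"
    using Suc.prems by (intro derives.AllE) simp
  then have "derives T \<Gamma> ((FAll ^^ n) (ren ((lift ^^ n) (case_nat (r n) (\<lambda>i. i))) p))"
    by (simp add: inst_def ren_funpow_FAll)
  moreover have "(\<lambda>i. if i < n then r i else i - n) \<circ> (lift ^^ n) (case_nat (r n) (\<lambda>i. i)) =
      (\<lambda>i. if i < Suc n then r i else i - Suc n)" (is "?l = ?r")
  proof
    fix i
    consider "i < n" | "i = n" | k where "i = Suc n + k"
      by (metis less_SucE not_less le_Suc_ex)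
    then show "?l i = ?r i"
    proof cases
      case 1
      then show ?thesis by (simp add: funpow_lift)
    next
      case 2
      then show ?thesis by (simp add: funpow_lift)
    next
      case 3
      then have "(lift ^^ n) (case_nat (r n) (\<lambda>i. i)) i = k + n"
        by (simp add: funpow_lift Suc_diff_le)
      then show ?thesis
        using 3 by simp
    qed
  qed
  ultimately show ?case
    using Suc.IH[OF \<open>derives T \<Gamma> ((FAll ^^ n) _)\<close>] by (simp only: ren_ren)
qed simp

text \<open>\<open>AllI\<close> does not shift the theory, so an axiom can be closed by as many
  quantifiers as its free variables require and then be instantiated by any renaming.\<close>

lemma derives_ren_axiom:
  assumes "p \<in> T"
  shows "derives T \<Gamma> (ren r p)"
proof -
  have "ren (\<lambda>i. if i < bnd p then r i else i - bnd p) p = ren r p"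
    by (rule ren_cong) simp
  then show ?thesis
    using derives_funpow_FAllD[OF derives_funpow_FAll[OF assms, of \<Gamma> "bnd p"], of r] by simp
qed

lemma derives_ren: "derives T \<Gamma> p \<Longrightarrow> derives T (map (ren r) \<Gamma>) (ren r p)"
proof (induction arbitrary: r rule: derives.induct)
  case (Axiom p \<Gamma>)
  then show ?case
    by (rule derives_ren_axiom)
next
  case (ImpE \<Gamma> p q)
  show ?case
    by (rule derives.ImpE[of T _ "ren r p"]) (use ImpE.IH[of r] in simp_all)
next
  case (Classical p \<Gamma>)
  show ?case
    by (rule derives.Classical) (use Classical.IH in simp)
next
  case (AllI \<Gamma> p)
  have "map (ren (lift r)) (map (ren Suc) \<Gamma>) = map (ren Suc) (map (ren r) \<Gamma>)"
    by (simp add: ren_ren comp_def)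
  then have "derives T (map (ren Suc) (map (ren r) \<Gamma>)) (ren (lift r) p)"
    using AllI.IH[of "lift r"] by (simp only:)
  then show ?case
    by (simp add: derives.AllI)
next
  case (AllE \<Gamma> p t)
  show ?case
    unfolding ren_inst by (rule derives.AllE) (use AllE.IH in simp)
next
  case (Subst \<Gamma> s t p)
  show ?case
    unfolding ren_inst
    by (rule derives.Subst[of _ _ "r s"]) (use Subst.IH[of r] in \<open>simp_all add: ren_inst\<close>)
qed (auto intro: Assume ImpI Refl)

text \<open>A fresh variable is as good as a bound one: renaming it to index 0 puts the derivation
  into the shape that \<open>AllI\<close> expects.\<close>

lemma derives_FAll_fresh:
  assumes "derives T \<Gamma> (inst x q)" and "\<And>p. p \<in> set \<Gamma> \<Longrightarrow> bnd p \<le> x" and "bnd (FAll q) \<le> x"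
  shows "derives T \<Gamma> (FAll q)"
proof -
  \<comment> \<open>On formulas that do not contain \<open>x\<close> this is the shift
    \<open>Suc\<close>; on the instance of \<open>q\<close> at \<open>x\<close> it undoes the
    instantiation.\<close>
  let ?r = "\<lambda>i. if i = x then 0 else Suc i"
  have "ren ?r (inst x q) = ren (\<lambda>i. i) q"
    unfolding inst_def ren_ren
    using assms(3) by (intro ren_cong) (auto split: nat.split)
  moreover have "map (ren ?r) \<Gamma> = map (ren Suc) \<Gamma>"
    using assms(2) by (fastforce intro: ren_cong)
  ultimately have "derives T (map (ren Suc) \<Gamma>) q"
    using derives_ren[OF assms(1), of ?r] by (simp only: ren_id)
  then show ?thesis
    by (rule derives.AllI)
qed

lemma derives_cut: "derives T \<Gamma> p \<Longrightarrow> derives T (p # \<Gamma>) q \<Longrightarrow> derives T \<Gamma> q"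
  using ImpI ImpE by blast

lemma derives_FBotE: "derives T \<Gamma> FBot \<Longrightarrow> derives T \<Gamma> p"
  by (rule Classical) (auto elim: derives_mono)

section \<open>The completeness theorem\<close>

instance fm :: countable
  by countable_datatype

text \<open>\<open>Q\<close> interprets equality, since the structure built from a maximal consistent set has to be
  divided by provable equality afterwards.\<close>

primrec sat :: "('u \<Rightarrow> 'u \<Rightarrow> bool) \<Rightarrow> ('u \<Rightarrow> 'u \<Rightarrow> bool) \<Rightarrow> (nat \<Rightarrow> 'u) \<Rightarrow> fm \<Rightarrow> bool" where
  "sat Q E v (FMem x y) \<longleftrightarrow> E (v x) (v y)"
| "sat Q E v (FEq x y) \<longleftrightarrow> Q (v x) (v y)"
| "sat Q E v FBot \<longleftrightarrow> False"
| "sat Q E v (FImp p q) \<longleftrightarrow> (sat Q E v p \<longrightarrow> sat Q E v q)"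
| "sat Q E v (FAll p) \<longleftrightarrow> (\<forall>x. sat Q E (case_nat x v) p)"

lemma sat_ren: "sat Q E v (ren r p) \<longleftrightarrow> sat Q E (v \<circ> r) p"
proof (induction p arbitrary: v r)
  case (FAll p)
  have "case_nat x v \<circ> lift r = case_nat x (v \<circ> r)" for x
    by (rule ext) (simp add: lift_eq_case_nat split: nat.split)
  then show ?case
    using FAll by (simp del: o_apply)
qed simp_all

section \<open>Henkin's construction of a maximal consistent set\<close>

definition consistent :: "fm set \<Rightarrow> fm list \<Rightarrow> bool" where
  "consistent T \<Gamma> \<longleftrightarrow> \<not> derives T \<Gamma> FBot"

definition fresh :: "fm list \<Rightarrow> nat" where
  "fresh \<Gamma> = Max (insert 0 (bnd ` set \<Gamma>))"

text \<open>Variables serve as Henkin constants. Every stage is a finite list, so a variable fresh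
  for it always exists and the language is not extended. The list is empty unless \<open>p\<close>
  is a negated universal formula.\<close>

definition witness :: "fm list \<Rightarrow> fm \<Rightarrow> fm list" where
  "witness \<Gamma> p = (if \<exists>q. p = FImp (FAll q) FBot
    then [FImp (inst (fresh (p # \<Gamma>)) (SOME q. p = FImp (FAll q) FBot)) FBot] else [])"

text \<open>A formula that is inconsistent with its stage is skipped without adding its negation:
  the stage derives the negation, and the limit is closed under derivability.\<close>

definition henkin_step :: "fm set \<Rightarrow> fm list \<Rightarrow> fm \<Rightarrow> fm list" where
  "henkin_step T \<Gamma> p = (if consistent T (p # \<Gamma>) then witness \<Gamma> p @ p # \<Gamma> else \<Gamma>)"

primrec henkin_seq :: "fm set \<Rightarrow> fm list \<Rightarrow> nat \<Rightarrow> fm list" where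
  "henkin_seq T \<Gamma> 0 = \<Gamma>"
| "henkin_seq T \<Gamma> (Suc n) = henkin_step T (henkin_seq T \<Gamma> n) (from_nat n)"

definition henkin :: "fm set \<Rightarrow> fm list \<Rightarrow> fm set" where
  "henkin T \<Gamma> = (\<Union>n. set (henkin_seq T \<Gamma> n))"

lemma fresh: "p \<in> set \<Gamma> \<Longrightarrow> bnd p \<le> fresh \<Gamma>"
  unfolding fresh_def by (rule Max_ge) auto

lemma witness_FAll: "witness \<Gamma> (FImp (FAll q) FBot) =
    [FImp (inst (fresh (FImp (FAll q) FBot # \<Gamma>)) q) FBot]"
  by (simp add: witness_def)

text \<open>If the negated instance were contradictory, the instance itself would be derivable; as
  its variable is fresh, so would the universal formula that \<open>p\<close> denies.\<close>

lemma consistent_witness: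
  assumes "consistent T (p # \<Gamma>)"
  shows "consistent T (witness \<Gamma> p @ p # \<Gamma>)"
proof (cases "\<exists>q. p = FImp (FAll q) FBot")
  case True
  then obtain q where p: "p = FImp (FAll q) FBot"
    by blast
  show ?thesis
    unfolding consistent_def
  proof
    assume *: "derives T (witness \<Gamma> p @ p # \<Gamma>) FBot"
    let ?x = "fresh (p # \<Gamma>)"
    have "derives T (p # \<Gamma>) (inst ?x q)"
      using * unfolding p witness_FAll by (simp add: Classical)
    moreover have "bnd (FAll q) \<le> ?x"
      using fresh[of p "p # \<Gamma>"] by (simp add: p)
    ultimately have "derives T (p # \<Gamma>) (FAll q)"
      using fresh[of _ "p # \<Gamma>"] by (intro derives_FAll_fresh) auto
    moreover have "derives T (p # \<Gamma>) (FImp (FAll q) FBot)"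
      by (rule Assume) (simp add: p)
    ultimately have "derives T (p # \<Gamma>) FBot"
      by (rule ImpE[rotated])
    then show False
      using assms by (simp add: consistent_def)
  qed
next
  case False
  then show ?thesis
    using assms by (simp add: witness_def)
qed

lemma consistent_henkin_seq: "consistent T \<Gamma> \<Longrightarrow> consistent T (henkin_seq T \<Gamma> n)"
  by (induction n) (simp_all add: henkin_step_def consistent_witness)

lemma henkin_seq_mono: "m \<le> n \<Longrightarrow> set (henkin_seq T \<Gamma> m) \<subseteq> set (henkin_seq T \<Gamma> n)"
  by (induction rule: dec_induct) (auto simp: henkin_step_def)

locale henkin_set =
  fixes T :: "fm set" and \<Gamma>\<^sub>0 :: "fm list" and S :: "fm set"
  assumes con: "consistent T \<Gamma>\<^sub>0"
  defines "S \<equiv> henkin T \<Gamma>\<^sub>0"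
begin

text \<open>The stages increase, so finitely many hypotheses already occur together in one of them.
  This carries consistency from the stages over to \<open>S\<close>.\<close>

lemma finite_subset:
  "set \<Gamma> \<subseteq> S \<Longrightarrow> \<exists>n. set \<Gamma> \<subseteq> set (henkin_seq T \<Gamma>\<^sub>0 n)"
proof (induction \<Gamma>)
  case (Cons p \<Gamma>)
  then obtain n where n: "set \<Gamma> \<subseteq> set (henkin_seq T \<Gamma>\<^sub>0 n)"
    by auto
  from Cons.prems obtain m where "p \<in> set (henkin_seq T \<Gamma>\<^sub>0 m)"
    by (auto simp: S_def henkin_def)
  then have "set (p # \<Gamma>) \<subseteq> set (henkin_seq T \<Gamma>\<^sub>0 (max m n))"
    using n henkin_seq_mono[of m "max m n" T \<Gamma>\<^sub>0] henkin_seq_mono[of n "max m n" T \<Gamma>\<^sub>0] by auto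
  then show ?case ..
qed simp

lemma not_derives_FBot: "set \<Gamma> \<subseteq> S \<Longrightarrow> \<not> derives T \<Gamma> FBot"
  using finite_subset derives_mono consistent_henkin_seq[OF con] unfolding consistent_def by blast

lemma step_subset: "set (henkin_step T (henkin_seq T \<Gamma>\<^sub>0 (to_nat p)) p) \<subseteq> S"
  unfolding S_def henkin_def
  using UN_upper[of "Suc (to_nat p)" UNIV "\<lambda>n. set (henkin_seq T \<Gamma>\<^sub>0 n)"] by simp

lemma stage_subset: "set (henkin_seq T \<Gamma>\<^sub>0 n) \<subseteq> S"
  by (auto simp: S_def henkin_def)

text \<open>If \<open>p\<close> had been rejected, its stage would refute it; joined with
  \<open>\<Gamma>\<close>, which derives \<open>p\<close>, the stage would give a contradictory
  finite part of \<open>S\<close>.\<close>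

lemma derives_closed:
  assumes "derives T \<Gamma> p" and "set \<Gamma> \<subseteq> S"
  shows "p \<in> S"
proof (cases "consistent T (p # henkin_seq T \<Gamma>\<^sub>0 (to_nat p))")
  case True
  then show ?thesis
    using step_subset[of p] by (auto simp: henkin_step_def)
next
  case False
  let ?\<Delta> = "henkin_seq T \<Gamma>\<^sub>0 (to_nat p)"
  have "derives T (\<Gamma> @ ?\<Delta>) p"
    using assms(1) by (rule derives_mono) auto
  moreover have "derives T (p # \<Gamma> @ ?\<Delta>) FBot"
    using False unfolding consistent_def by (auto elim: derives_mono)
  ultimately have "derives T (\<Gamma> @ ?\<Delta>) FBot"
    by (rule derives_cut)
  then show ?thesis
    using not_derives_FBot[of "\<Gamma> @ ?\<Delta>"] assms(2) stage_subset by simp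
qed

lemma FBot_notin: "FBot \<notin> S"
  using not_derives_FBot[of "[FBot]"] Assume[of FBot "[FBot]" T] by auto

lemma FImp_in: "FImp p q \<in> S \<longleftrightarrow> (p \<in> S \<longrightarrow> q \<in> S)"
proof
  assume *: "FImp p q \<in> S"
  show "p \<in> S \<longrightarrow> q \<in> S"
  proof
    assume "p \<in> S"
    have "derives T [FImp p q, p] q"
      by (rule ImpE[of T _ p]) (auto intro: Assume)
    then show "q \<in> S"
      by (rule derives_closed) (use * \<open>p \<in> S\<close> in auto)
  qed
next
  assume *: "p \<in> S \<longrightarrow> q \<in> S"
  show "FImp p q \<in> S"
  proof (cases "p \<in> S")
    case True
    have "derives T [q] (FImp p q)"
      by (rule ImpI) (auto intro: Assume)
    then show ?thesis
      by (rule derives_closed) (use * True in auto)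
  next
    case False
    let ?\<Delta> = "henkin_seq T \<Gamma>\<^sub>0 (to_nat p)"
    have "derives T (p # ?\<Delta>) FBot"
      using False step_subset[of p] by (auto simp: henkin_step_def consistent_def split: if_splits)
    then have "derives T ?\<Delta> (FImp p q)"
      by (rule ImpI[OF derives_FBotE])
    then show ?thesis
      by (rule derives_closed) (rule stage_subset)
  qed
qed

text \<open>From right to left, the witness that entered \<open>S\<close> together with the negation
  of \<open>FAll q\<close> would deny one of the instances.\<close>

lemma FAll_in: "FAll q \<in> S \<longleftrightarrow> (\<forall>x. inst x q \<in> S)"
proof
  assume *: "FAll q \<in> S"
  have "derives T [FAll q] (inst x q)" for x
    by (rule AllE) (auto intro: Assume)
  then show "\<forall>x. inst x q \<in> S"
    using * derives_closed by fastforce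
next
  assume *: "\<forall>x. inst x q \<in> S"
  show "FAll q \<in> S"
  proof (rule ccontr)
    assume "FAll q \<notin> S"
    let ?p = "FImp (FAll q) FBot"
    let ?\<Delta> = "henkin_seq T \<Gamma>\<^sub>0 (to_nat ?p)"
    have p: "?p \<in> S"
      using \<open>FAll q \<notin> S\<close> by (simp add: FImp_in)
    have "consistent T (?p # ?\<Delta>)"
      unfolding consistent_def using p stage_subset by (intro not_derives_FBot) auto
    then have "FImp (inst (fresh (?p # ?\<Delta>)) q) FBot \<in> S"
      using step_subset[of ?p] by (simp add: henkin_step_def witness_FAll)
    then show False
      using * FBot_notin by (simp add: FImp_in)
  qed
qed

abbreviation (input) "eqS x y \<equiv> FEq x y \<in> S"
abbreviation (input) "memS x y \<equiv> FMem x y \<in> S"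

text \<open>The truth lemma for the structure whose points are the variables themselves. An
  assignment is then a map from \<open>nat\<close> to \<open>nat\<close>, that is, a renaming, and
  truth becomes membership of the renamed formula.\<close>

lemma sat_iff_in: "sat (\<lambda>x y. eqS x y) (\<lambda>x y. memS x y) v p \<longleftrightarrow> ren v p \<in> S"
  by (induction p arbitrary: v) (simp_all add: FBot_notin FImp_in FAll_in inst_ren_lift)

lemma eqS_refl: "eqS x x"
  by (rule derives_closed[of "[]"]) (auto intro: Refl)

lemma eqS_subst: "eqS s t \<Longrightarrow> inst s p \<in> S \<Longrightarrow> inst t p \<in> S"
  by (rule derives_closed[of "[FEq s t, inst s p]"]) (auto intro!: Subst[of T _ s t p] intro: Assume)

text \<open>Index 0 marks the place of substitution and \<open>Suc\<close> protects the parameter: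
  the template \<open>FEq 0 (Suc x)\<close> becomes \<open>FEq x x\<close> at \<open>x\<close> and
  \<open>FEq y x\<close> at \<open>y\<close>. The templates of the next two lemmas work
  alike.\<close>

lemma eqS_sym: "eqS x y \<Longrightarrow> eqS y x"
  using eqS_subst[of x y "FEq 0 (Suc x)"] eqS_refl by (simp add: inst_def)

lemma eqS_trans: "eqS x y \<Longrightarrow> eqS y z \<Longrightarrow> eqS x z"
  using eqS_subst[of y z "FEq (Suc x) 0"] by (simp add: inst_def)

lemma memS_cong: "eqS x x' \<Longrightarrow> eqS y y' \<Longrightarrow> memS x y \<Longrightarrow> memS x' y'"
  using eqS_subst[of x x' "FMem 0 (Suc y)"] eqS_subst[of y y' "FMem (Suc x') 0"]
  by (simp add: inst_def)

end

section \<open>Structures with a congruence for equality, and their quotients\<close>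

definition congruence :: "('u \<Rightarrow> 'u \<Rightarrow> bool) \<Rightarrow> ('u \<Rightarrow> 'u \<Rightarrow> bool) \<Rightarrow> bool" where
  "congruence Q E \<longleftrightarrow> equivp Q \<and> (\<forall>x x' y y'. Q x x' \<longrightarrow> Q y y' \<longrightarrow> E x y \<longrightarrow> E x' y')"

lemma congruence_model_exists:
  assumes "\<not> derives T [] q"
  obtains Q E :: "nat \<Rightarrow> nat \<Rightarrow> bool" and v
  where "congruence Q E" and "\<And>p v. p \<in> T \<Longrightarrow> sat Q E v p" and "\<not> sat Q E v q"
proof -
  let ?\<Gamma> = "[FImp q FBot]"
  have "consistent T ?\<Gamma>"
    using assms Classical unfolding consistent_def by blast
  then interpret henkin_set T ?\<Gamma> "henkin T ?\<Gamma>"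
    by unfold_locales
  let ?S = "henkin T ?\<Gamma>"
  let ?Q = "\<lambda>x y. FEq x y \<in> ?S" and ?E = "\<lambda>x y. FMem x y \<in> ?S"
  have "congruence ?Q ?E"
    unfolding congruence_def
    by (auto intro!: equivpI reflpI sympI transpI intro: eqS_refl eqS_sym eqS_trans memS_cong)
  moreover have "sat ?Q ?E v p" if "p \<in> T" for p v
    unfolding sat_iff_in by (rule derives_closed[of "[]"]) (auto intro: derives_ren_axiom that)
  moreover have "\<not> sat ?Q ?E (\<lambda>i. i) q"
  proof -
    have "FImp q FBot \<in> ?S"
      using stage_subset[of 0] by simp
    then show ?thesis
      unfolding sat_iff_in by (simp add: FImp_in FBot_notin)
  qed
  ultimately show thesis
    using that by blast
qed

lemma sat_quotient:
  assumes "surj h" and "\<And>x y. h x = h y \<longleftrightarrow> Q x y" and "\<And>x y. E' (h x) (h y) \<longleftrightarrow> E x y"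
  shows "sat (=) E' (h \<circ> v) p \<longleftrightarrow> sat Q E v p"
proof (induction p arbitrary: v)
  case (FAll p)
  have "case_nat (h x) (h \<circ> v) = h \<circ> case_nat x v" for x
    by (rule ext) (simp split: nat.split)
  then have "(\<forall>x. sat (=) E' (case_nat (h x) (h \<circ> v)) p) \<longleftrightarrow> (\<forall>x. sat Q E (case_nat x v) p)"
    using FAll by (simp del: o_apply)
  then show ?case
    using \<open>surj h\<close> by (metis sat.simps(5) surjD)
qed (simp_all add: assms)

text \<open>Infinitely many classes let the universe of the quotient be the whole type \<open>nat\<close>.\<close>

theorem completeness_infinite:
  fixes T :: "fm set"
  assumes inf: "\<And>Q E :: nat \<Rightarrow> nat \<Rightarrow> bool. congruence Q E \<Longrightarrow> (\<And>p v. p \<in> T \<Longrightarrow> sat Q E v p) \<Longrightarrow>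
      infinite (range Q)"
    and valid: "\<And>E v. (\<And>p v. p \<in> T \<Longrightarrow> sat (=) E v p) \<Longrightarrow> sat (=) (E :: nat \<Rightarrow> nat \<Rightarrow> bool) v q"
  shows "derives T [] q"
proof (rule ccontr)
  assume "\<not> derives T [] q"
  then obtain Q E :: "nat \<Rightarrow> nat \<Rightarrow> bool" and v
    where cong: "congruence Q E" and T: "\<And>p v. p \<in> T \<Longrightarrow> sat Q E v p" and q: "\<not> sat Q E v q"
    using congruence_model_exists by blast
  \<comment> \<open>The predicate \<open>Q x\<close> is the class of \<open>x\<close>, so
    enumerating the range of \<open>Q\<close> numbers the classes without gaps.\<close>
  define h where "h = to_nat_on (range Q) \<circ> Q"
  have bij: "bij_betw (to_nat_on (range Q)) (range Q) UNIV"
  proof (rule to_nat_on_infinite)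
    show "infinite (range Q)"
      using cong T by (rule inf)
  qed simp
  have surj: "surj h"
    unfolding h_def using bij by (simp only: bij_betw_def image_comp[symmetric])
  have h: "h x = h y \<longleftrightarrow> Q x y" for x y
  proof -
    have "h x = h y \<longleftrightarrow> Q x = Q y"
      unfolding h_def using bij by (simp add: bij_betw_def inj_on_def)
    also have "\<dots> \<longleftrightarrow> Q x y"
      using cong by (simp add: congruence_def equivp_def)
    finally show ?thesis .
  qed
  define E' where "E' a b \<longleftrightarrow> (\<exists>x y. h x = a \<and> h y = b \<and> E x y)" for a b
  have E': "E' (h x) (h y) \<longleftrightarrow> E x y" for x y
    using cong equivp_reflp[of Q] unfolding E'_def h congruence_def by blast
  note quot = sat_quotient[of h Q E' E, OF surj h E']
  have "sat (=) E' w p" if "p \<in> T" for p w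
  proof -
    have "w = h \<circ> (inv_into UNIV h \<circ> w)"
      using surj by (simp add: fun_eq_iff surj_f_inv_f)
    then show ?thesis
      using quot[of "inv_into UNIV h \<circ> w" p] T[OF that] by simp
  qed
  then have "sat (=) E' (h \<circ> v) q"
    by (rule valid)
  then show False
    using q quot by simp
qed

section \<open>Truth of named formulas\<close>

text \<open>\<open>\<rho>\<close> assigns values to levels; \<open>w\<close> assigns values to the free variables beyond the \<open>d\<close> enclosing
  quantifiers, which occur as parameters of the axiom schemes.\<close>

definition hold ::
  "('u \<Rightarrow> 'u \<Rightarrow> bool) \<Rightarrow> ('u \<Rightarrow> 'u \<Rightarrow> bool) \<Rightarrow> (nat \<Rightarrow> 'u) \<Rightarrow> nat \<Rightarrow> (nat \<Rightarrow> 'u) \<Rightarrow> form \<Rightarrow> bool"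
  where "hold Q E w d \<rho> F \<longleftrightarrow> sat Q E (\<lambda>i. if i < d then \<rho> (d - Suc i) else w (i - d)) (F d)"

named_theorems hold

lemma hold_mem [hold]: "x < d \<Longrightarrow> y < d \<Longrightarrow> hold Q E w d \<rho> (x \<^bold>\<in> y) \<longleftrightarrow> E (\<rho> x) (\<rho> y)"
  by (simp add: hold_def mem_def)

lemma hold_eql [hold]: "x < d \<Longrightarrow> y < d \<Longrightarrow> hold Q E w d \<rho> (x \<^bold>= y) \<longleftrightarrow> Q (\<rho> x) (\<rho> y)"
  by (simp add: hold_def eql_def)

lemma hold_connectives [hold]:
  "hold Q E w d \<rho> (F \<^bold>\<longrightarrow> G) \<longleftrightarrow> (hold Q E w d \<rho> F \<longrightarrow> hold Q E w d \<rho> G)"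
  "hold Q E w d \<rho> (\<^bold>\<not> F) \<longleftrightarrow> \<not> hold Q E w d \<rho> F"
  "hold Q E w d \<rho> (F \<^bold>\<or> G) \<longleftrightarrow> hold Q E w d \<rho> F \<or> hold Q E w d \<rho> G"
  "hold Q E w d \<rho> (F \<^bold>\<and> G) \<longleftrightarrow> hold Q E w d \<rho> F \<and> hold Q E w d \<rho> G"
  "hold Q E w d \<rho> (F \<^bold>\<longleftrightarrow> G) \<longleftrightarrow> (hold Q E w d \<rho> F \<longleftrightarrow> hold Q E w d \<rho> G)"
  by (auto simp: hold_def imp_def neg_def disj_def conj_def iff_def)

lemma hold_all [hold]:
  "hold Q E w d \<rho> (all F) \<longleftrightarrow> (\<forall>a. hold Q E w (Suc d) (\<rho>(d := a)) (F d))"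
proof -
  have "case_nat a (\<lambda>i. if i < d then \<rho> (d - Suc i) else w (i - d)) =
      (\<lambda>i. if i < Suc d then (\<rho>(d := a)) (Suc d - Suc i) else w (i - Suc d))" for a
    by (rule ext) (auto split: nat.split)
  then show ?thesis
    by (simp add: hold_def all_def)
qed

lemma hold_ex [hold]:
  "hold Q E w d \<rho> (ex F) \<longleftrightarrow> (\<exists>a. hold Q E w (Suc d) (\<rho>(d := a)) (F d))"
  by (simp add: ex_def hold)

lemma hold_schema [hold]:
  assumes "\<forall>x \<in> set xs. x < d"
  shows "hold Q E w d \<rho> (schema p xs) \<longleftrightarrow>
    sat Q E (\<lambda>i. if i < length xs then \<rho> (xs ! i) else w (i - length xs)) p"
proof -
  have "(\<lambda>i. if i < d then \<rho> (d - Suc i) else w (i - d)) \<circ>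
      (\<lambda>i. if i < length xs then d - Suc (xs ! i) else i - length xs + d) =
      (\<lambda>i. if i < length xs then \<rho> (xs ! i) else w (i - length xs))" (is "?l = ?r")
  proof
    fix i
    show "?l i = ?r i"
    proof (cases "i < length xs")
      case True
      then have "xs ! i < d"
        using assms by simp
      then show ?thesis
        using True by simp
    next
      case False
      then obtain k where "i = length xs + k"
        using le_Suc_ex linorder_not_less by blast
      then show ?thesis
        by simp
    qed
  qed
  then show ?thesis
    by (simp only: hold_def schema_def sat_ren)
qed



text \<open>Pairing and union adjoin one element to a set, so finitely many classes could all be
  collected in a universal set \<open>u\<close>. Then \<open>u\<close> is an element of itself, and
  its singleton violates foundation.\<close>

lemma infinite_congruence_model:
  assumes cong: "congruence Q E" and ZFC: "\<And>p v. p \<in> ZFC \<Longrightarrow> sat Q E v p"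
  shows "infinite (range Q)"
proof
  assume fin: "finite (range Q)"
  have eq: "Q x y \<longleftrightarrow> Q x = Q y" for x y
    using cong by (simp add: congruence_def equivp_def)
  have mem: "E x y \<Longrightarrow> Q x x' \<Longrightarrow> Q y y' \<Longrightarrow> E x' y'" for x x' y y'
    using cong by (simp add: congruence_def)
  have H: "hold Q E w 0 (\<lambda>_. undefined) F" if "F 0 \<in> ZFC" for F w
    using ZFC[OF that] by (simp add: hold_def)
  have pair: "\<exists>u. \<forall>z. E z u \<longleftrightarrow> Q z x \<or> Q z y" for x y
    using H[of pairing] by (simp add: ZFC_def pairing_def is_upair_def hold)
  have un: "\<exists>u. \<forall>z. E z u \<longleftrightarrow> (\<exists>y. E y x \<and> E z y)" for x
    using H[of union] by (simp add: ZFC_def union_def hold)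
  have fnd: "\<exists>y. E y x \<and> \<not> (\<exists>z. E z x \<and> E z y)" if "E y x" for x y
    using H[of foundation] that by (simp add: ZFC_def foundation_def hold) blast
  \<comment> \<open>Here \<open>X\<close> is a finite set of classes, each class being given as a
    predicate \<open>Q x\<close>.\<close>
  have "\<exists>u. \<forall>x. Q x \<in> X \<longrightarrow> E x u" if "finite X" "X \<subseteq> range Q" for X
    using that
  proof (induction X)
    case (insert c X)
    then obtain u where u: "\<And>x. Q x \<in> X \<Longrightarrow> E x u"
      by auto
    obtain a where a: "c = Q a"
      using insert.prems by auto
    obtain s where s: "\<And>z. E z s \<longleftrightarrow> Q z a"
      using pair[of a a] by auto
    obtain p where p: "\<And>z. E z p \<longleftrightarrow> Q z s \<or> Q z u"
      using pair by blast
    obtain t where t: "\<And>z. E z t \<longleftrightarrow> (\<exists>y. E y p \<and> E z y)"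
      using un by blast
    have "E x t" if "Q x \<in> insert c X" for x
    proof (cases "Q x = c")
      case True
      then have "E x s"
        using s a eq[of x a] by simp
      moreover have "E s p"
        using p eq[of s s] by simp
      ultimately show ?thesis
        using t by blast
    next
      case False
      then have "E x u"
        using that u by simp
      moreover have "E u p"
        using p eq[of u u] by simp
      ultimately show ?thesis
        using t by blast
    qed
    then show ?case
      by blast
  qed simp
  from this[OF fin] obtain u where u: "\<And>x. E x u"
    by auto
  obtain s where s: "\<And>z. E z s \<longleftrightarrow> Q z u"
    using pair[of u u] by auto
  have "E u s"
    using s eq by simp
  from fnd[OF this] obtain y where "E y s" "\<not> (\<exists>z. E z s \<and> E z y)"
    by auto
  then show False
    using \<open>E u s\<close> mem[of u u u y] u[of u] s[of y] eq by metis
qed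

section \<open>Models of set theory\<close>

locale set_model =
  fixes E :: "'u \<Rightarrow> 'u \<Rightarrow> bool" (infix "\<epsilon>" 50)
  assumes extensionality: "(\<And>z. z \<epsilon> x \<longleftrightarrow> z \<epsilon> y) \<Longrightarrow> x = y"
    and pairing: "\<exists>u. \<forall>z. z \<epsilon> u \<longleftrightarrow> z = x \<or> z = y"
    and union: "\<exists>u. \<forall>z. z \<epsilon> u \<longleftrightarrow> (\<exists>y. y \<epsilon> x \<and> z \<epsilon> y)"
    and powerset: "\<exists>u. \<forall>y. y \<epsilon> u \<longleftrightarrow> (\<forall>z. z \<epsilon> y \<longrightarrow> z \<epsilon> x)"
    and infinity: "\<exists>w. (\<exists>z. (\<forall>y. \<not> y \<epsilon> z) \<and> z \<epsilon> w) \<and>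
      (\<forall>n. n \<epsilon> w \<longrightarrow> (\<exists>m. (\<forall>z. z \<epsilon> m \<longleftrightarrow> z \<epsilon> n \<or> z = n) \<and> m \<epsilon> w))"
    and separation: "\<exists>b. \<forall>x. x \<epsilon> b \<longleftrightarrow> x \<epsilon> a \<and> sat (=) (\<epsilon>) (case_nat x (case_nat a v)) p"

lemma set_model_ZFC:
  assumes "\<And>p v. p \<in> ZFC \<Longrightarrow> sat (=) E v p"
  shows "set_model E"
proof
  have H: "hold (=) E w 0 (\<lambda>_. undefined) F" if "F 0 \<in> ZFC" for F w
    using assms[OF that] by (simp add: hold_def)
  show "x = y" if "\<And>z. E z x \<longleftrightarrow> E z y" for x y
    using H[of extensionality] that by (simp add: ZFC_def extensionality_def hold)
  show "\<exists>u. \<forall>z. E z u \<longleftrightarrow> z = x \<or> z = y" for x y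
    using H[of pairing] by (simp add: ZFC_def pairing_def is_upair_def hold)
  show "\<exists>u. \<forall>z. E z u \<longleftrightarrow> (\<exists>y. E y x \<and> E z y)" for x
    using H[of union] by (simp add: ZFC_def union_def hold)
  show "\<exists>u. \<forall>y. E y u \<longleftrightarrow> (\<forall>z. E z y \<longrightarrow> E z x)" for x
    using H[of powerset] by (simp add: ZFC_def powerset_def hold)
  show "\<exists>w. (\<exists>z. (\<forall>y. \<not> E y z) \<and> E z w) \<and>
      (\<forall>n. E n w \<longrightarrow> (\<exists>m. (\<forall>z. E z m \<longleftrightarrow> E z n \<or> z = n) \<and> E m w))"
    using H[of infinity]
    by (simp add: ZFC_def infinity_def is_inductive_def is_empty_def is_succ_def hold)
  show "\<exists>b. \<forall>x. E x b \<longleftrightarrow> E x a \<and> sat (=) E (case_nat x (case_nat a v)) p" for a v p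
  proof -
    have "separation p 0 \<in> ZFC"
      by (auto simp: ZFC_def)
    \<comment> \<open>Levels 0, 1 and 2 hold \<open>a\<close>, \<open>b\<close> and
      \<open>x\<close>, so the list of \<open>x\<close> and \<open>a\<close> is
      \<open>[Suc (Suc 0), 0]\<close>. Indices 0 and 1 of \<open>p\<close> thus become
      \<open>x\<close> and \<open>a\<close>, and the rest are read as parameters from
      \<open>v\<close>.\<close>
    moreover have "hold (=) E v (Suc (Suc (Suc 0))) (\<rho>(0 := a, Suc 0 := b, Suc (Suc 0) := x))
        (schema p [Suc (Suc 0), 0]) \<longleftrightarrow> sat (=) E (case_nat x (case_nat a v)) p" for \<rho> a b x
      by (subst hold_schema, simp)
        (rule arg_cong[where f = "\<lambda>v. sat (=) E v p"], rule ext,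
          auto simp: nth_Cons' split: nat.split)
    ultimately show ?thesis
      using H[where F = "separation p" and w = v] by (simp add: separation_def hold del: hold_schema)
  qed
qed

text \<open>Even indices carry variables and odd ones parameters. Interleaving keeps both supplies
  infinite, so that quantifying over a further variable or joining two parameter sequences amounts
  to a renaming.\<close>

definition merge :: "(nat \<Rightarrow> 'u) \<Rightarrow> (nat \<Rightarrow> 'u) \<Rightarrow> nat \<Rightarrow> 'u" where
  "merge v c i = (if even i then v (i div 2) else c (i div 2))"

named_theorems dfn

context set_model
begin

subsection \<open>Definability with parameters\<close>

definition definable :: "((nat \<Rightarrow> 'u) \<Rightarrow> bool) \<Rightarrow> bool" where
  "definable R \<longleftrightarrow> (\<exists>p c. \<forall>v. R v \<longleftrightarrow> sat (=) (\<epsilon>) (merge v c) p)"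

definition definable_fun :: "((nat \<Rightarrow> 'u) \<Rightarrow> 'u) \<Rightarrow> bool" where
  "definable_fun t \<longleftrightarrow> definable (\<lambda>v. v 0 = t (\<lambda>i. v (Suc i)))"

lemma definableI: "(\<And>v. R v \<longleftrightarrow> sat (=) (\<epsilon>) (merge v c) p) \<Longrightarrow> definable R"
  by (auto simp: definable_def)

lemma definable_reindex:
  assumes "definable R"
  shows "definable (\<lambda>v. R (\<lambda>i. v (f i)))"
proof -
  obtain p c where R: "\<And>v. R v \<longleftrightarrow> sat (=) (\<epsilon>) (merge v c) p"
    using assms by (auto simp: definable_def)
  have "merge v c \<circ> (\<lambda>i. if even i then 2 * f (i div 2) else i) = merge (\<lambda>i. v (f i)) c" for v
    by (rule ext) (simp add: merge_def)
  then show ?thesis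
    by (intro definableI[where c = c and p = "ren (\<lambda>i. if even i then 2 * f (i div 2) else i) p"])
      (simp add: R sat_ren del: o_apply)
qed

lemma definable_imp [dfn]:
  assumes "definable R" "definable S"
  shows "definable (\<lambda>v. R v \<longrightarrow> S v)"
proof -
  obtain p c where R: "\<And>v. R v \<longleftrightarrow> sat (=) (\<epsilon>) (merge v c) p"
    using assms by (auto simp: definable_def)
  obtain q d where S: "\<And>v. S v \<longleftrightarrow> sat (=) (\<epsilon>) (merge v d) q"
    using assms by (auto simp: definable_def)
  have [simp]: "odd i \<Longrightarrow> (i - Suc 0) div 2 = i div 2"
    "(4 * (i div 2) + 3) div 2 = 2 * (i div 2) + 1" for i :: nat
    by presburger+
  \<comment> \<open>With \<open>k = i div 2\<close>, the value \<open>c k\<close> sits at index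
    \<open>4 * k + 1\<close> of the combined sequence and \<open>d k\<close> at index
    \<open>4 * k + 3\<close>.\<close>
  have 1: "merge v (merge c d) \<circ> (\<lambda>i. if even i then i else 4 * (i div 2) + 1) = merge v c" for v
    by (rule ext) (simp add: merge_def)
  have 2: "merge v (merge c d) \<circ> (\<lambda>i. if even i then i else 4 * (i div 2) + 3) = merge v d" for v
    by (rule ext) (simp add: merge_def)
  show ?thesis
    by (rule definableI[where c = "merge c d" and p = "FImp (ren (\<lambda>i. if even i then i else 4 * (i div 2) + 1) p)
          (ren (\<lambda>i. if even i then i else 4 * (i div 2) + 3) q)"])
      (simp add: R S sat_ren 1 2 del: o_apply)
qed

lemma definable_const [dfn]: "definable (\<lambda>v. b)"
  by (rule definableI[where p = "if b then FImp FBot FBot else FBot" and c = "\<lambda>_. undefined"]) simp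

lemma definable_not [dfn]: "definable R \<Longrightarrow> definable (\<lambda>v. \<not> R v)"
  using definable_imp[of R "\<lambda>_. False"] definable_const by simp

lemma definable_or [dfn]: "definable R \<Longrightarrow> definable S \<Longrightarrow> definable (\<lambda>v. R v \<or> S v)"
  using definable_imp[of "\<lambda>v. \<not> R v" S] definable_not by (simp add: disj_imp)

lemma definable_and [dfn]: "definable R \<Longrightarrow> definable S \<Longrightarrow> definable (\<lambda>v. R v \<and> S v)"
  using definable_not[of "\<lambda>v. R v \<longrightarrow> \<not> S v"] definable_imp definable_not by simp

lemma definable_iff [dfn]: "definable R \<Longrightarrow> definable S \<Longrightarrow> definable (\<lambda>v. R v \<longleftrightarrow> S v)"
  using definable_and[of "\<lambda>v. R v \<longrightarrow> S v" "\<lambda>v. S v \<longrightarrow> R v"] definable_imp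
  by (simp add: iff_conv_conj_imp)

lemma definable_all [dfn]:
  assumes "definable (\<lambda>v. R (v 0) (\<lambda>i. v (Suc i)))"
  shows "definable (\<lambda>v. \<forall>x. R x v)"
proof -
  obtain p c where R: "\<And>v. R (v 0) (\<lambda>i. v (Suc i)) \<longleftrightarrow> sat (=) (\<epsilon>) (merge v c) p"
    using assms by (auto simp: definable_def)
  \<comment> \<open>Passing under a quantifier moves every index up by one and so exchanges the
    parities. A variable at an even index \<open>i > 0\<close> is found at \<open>i - 1\<close>, a
    parameter at an odd index \<open>i\<close> at \<open>Suc i\<close>, and the bound variable stays
    at 0.\<close>
  let ?r = "\<lambda>i. if i = 0 then 0 else if even i then i - 1 else Suc i"
  have "case_nat x (merge v c) \<circ> ?r = merge (case_nat x v) c" for x v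
  proof
    fix i
    show "(case_nat x (merge v c) \<circ> ?r) i = merge (case_nat x v) c i"
    proof (cases "even i \<and> i \<noteq> 0")
      case True
      then obtain k where "i = Suc (Suc (2 * k))"
        by (metis evenE mult_Suc_right not0_implies_Suc add_2_eq_Suc mult_0_right)
      then show ?thesis
        by (simp add: merge_def)
    qed (auto simp: merge_def)
  qed
  then have "R x v \<longleftrightarrow> sat (=) (\<epsilon>) (case_nat x (merge v c)) (ren ?r p)" for x v
    using R[of "case_nat x v"] by (simp only: sat_ren nat.case)
  then show ?thesis
    by (intro definableI[where c = c and p = "FAll (ren ?r p)"]) simp
qed

lemma definable_ex [dfn]:
  assumes "definable (\<lambda>v. R (v 0) (\<lambda>i. v (Suc i)))"
  shows "definable (\<lambda>v. \<exists>x. R x v)"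
  using definable_not[OF definable_all[of "\<lambda>x v. \<not> R x v"]] definable_not[OF assms] by simp

lemma definable_fun_var [dfn]: "definable_fun (\<lambda>v. v i)"
  unfolding definable_fun_def
  by (rule definableI[where c = "\<lambda>_. undefined" and p = "FEq 0 (2 * Suc i)"]) (simp add: merge_def)

lemma definable_fun_const [dfn]: "definable_fun (\<lambda>v. c)"
  unfolding definable_fun_def
  by (rule definableI[where c = "\<lambda>_. c" and p = "FEq 0 1"]) (simp add: merge_def)

text \<open>Formulas have no function symbols, so a term is eliminated through its graph: some
  \<open>x\<close> equals \<open>t v\<close> and satisfies \<open>P\<close>.\<close>

lemma definable_subst:
  assumes "definable (\<lambda>v. P (v 0) (\<lambda>i. v (Suc i)))" "definable_fun t"
  shows "definable (\<lambda>v. P (t v) v)"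
  using definable_ex[of "\<lambda>x v. x = t v \<and> P x v"] definable_and assms
  by (simp add: definable_fun_def)

lemma definable_fun_reindex: "definable_fun t \<Longrightarrow> definable_fun (\<lambda>v. t (\<lambda>i. v (f i)))"
  unfolding definable_fun_def by (drule definable_reindex[where f = "case_nat 0 (\<lambda>i. Suc (f i))"]) simp

lemma definable_subst2:
  assumes "definable (\<lambda>v. P (v 0) (v (Suc 0)))" "definable_fun s" "definable_fun t"
  shows "definable (\<lambda>v. P (s v) (t v))"
proof (rule definable_subst[of "\<lambda>x v. P x (t v)", OF _ assms(2)])
  have "definable (\<lambda>v. P (v (Suc 0)) (v 0))"
    using definable_reindex[OF assms(1), of "\<lambda>i. if i = 0 then Suc 0 else 0"] by simp
  then have "definable (\<lambda>v. P ((\<lambda>i. v (Suc i)) 0) (v 0))"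
    by simp
  from definable_subst[of "\<lambda>x v. P (v 0) x", OF this definable_fun_reindex[OF assms(3), of Suc]]
  show "definable (\<lambda>v. P (v 0) (t (\<lambda>i. v (Suc i))))" .
qed

lemma definable_subst3:
  assumes "definable (\<lambda>v. P (v 0) (v (Suc 0)) (v (Suc (Suc 0))))"
    "definable_fun s" "definable_fun t" "definable_fun u"
  shows "definable (\<lambda>v. P (s v) (t v) (u v))"
proof (rule definable_subst[of "\<lambda>x v. P x (t v) (u v)", OF _ assms(2)])
  have *: "definable (\<lambda>v. P (v (Suc 0)) (v 0) (u (\<lambda>i. v (Suc (Suc i)))))"
  proof -
    have "definable (\<lambda>v. P (v (Suc (Suc 0))) (v (Suc 0)) (v 0))"
      using definable_reindex[OF assms(1), of "\<lambda>i. Suc (Suc 0) - i"] by simp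
    then have "definable (\<lambda>v. P ((\<lambda>i. v (Suc i)) (Suc 0)) ((\<lambda>i. v (Suc i)) 0) (v 0))"
      by simp
    from definable_subst[of "\<lambda>x v. P (v (Suc 0)) (v 0) x", OF this
        definable_fun_reindex[OF assms(4), of "\<lambda>i. Suc (Suc i)"]]
    show ?thesis .
  qed
  then have "definable (\<lambda>v. P ((\<lambda>i. v (Suc i)) 0) (v 0) (u (\<lambda>i. (\<lambda>i. v (Suc i)) (Suc i))))"
    by simp
  from definable_subst[of "\<lambda>x v. P (v 0) x (u (\<lambda>i. v (Suc i)))", OF this
      definable_fun_reindex[OF assms(3), of Suc]]
  show "definable (\<lambda>v. P (v 0) (t (\<lambda>i. v (Suc i))) (u (\<lambda>i. v (Suc i))))" .
qed

lemma definable_fun_subst1: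
  assumes "definable (\<lambda>v. v 0 = g (v (Suc 0)))" "definable_fun s"
  shows "definable_fun (\<lambda>v. g (s v))"
  unfolding definable_fun_def
  by (rule definable_subst2[of "\<lambda>y x. y = g x"])
    (use assms definable_fun_var definable_fun_reindex[of s Suc] in auto)

lemma definable_fun_subst2:
  assumes "definable (\<lambda>v. v 0 = g (v (Suc 0)) (v (Suc (Suc 0))))" "definable_fun s" "definable_fun t"
  shows "definable_fun (\<lambda>v. g (s v) (t v))"
  unfolding definable_fun_def
  by (rule definable_subst3[of "\<lambda>z x y. z = g x y"])
    (use assms definable_fun_var definable_fun_reindex[of _ Suc] in auto)

lemma definable_mem [dfn]: "definable_fun s \<Longrightarrow> definable_fun t \<Longrightarrow> definable (\<lambda>v. s v \<epsilon> t v)"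
  by (rule definable_subst2, rule definableI[where c = "\<lambda>_. undefined" and p = "FMem 0 2"])
    (simp_all add: merge_def)

lemma definable_eq [dfn]: "definable_fun s \<Longrightarrow> definable_fun t \<Longrightarrow> definable (\<lambda>v. s v = t v)"
  by (rule definable_subst2, rule definableI[where c = "\<lambda>_. undefined" and p = "FEq 0 2"])
    (simp_all add: merge_def)

lemma definable_ex1 [dfn]:
  assumes "definable (\<lambda>v. R (v 0) (\<lambda>i. v (Suc i)))"
  shows "definable (\<lambda>v. \<exists>!x. R x v)"
proof -
  have "definable (\<lambda>v. R (v 0) (\<lambda>i. v (Suc (Suc i))))"
    using definable_reindex[OF assms, of "\<lambda>i. if i = 0 then 0 else Suc i"] by simp
  then show ?thesis
    unfolding Ex1_def by (intro dfn assms)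
qed

text \<open>Unlike \<open>THE\<close>, this is definable even when the described object does not exist.\<close>

definition the1 :: "('u \<Rightarrow> bool) \<Rightarrow> 'u" where
  "the1 P = (if \<exists>!y. P y then THE y. P y else undefined)"

lemma the1_equality:
  assumes "P a" "\<And>y. P y \<Longrightarrow> y = a"
  shows "the1 P = a"
proof -
  have "\<exists>!y. P y" "(THE y. P y) = a"
    by (rule ex1I, fact assms, erule assms) (rule the_equality, fact assms, erule assms)
  then show ?thesis
    by (simp add: the1_def)
qed

lemma the1I: "\<exists>!y. P y \<Longrightarrow> P (the1 P)"
  unfolding the1_def by (simp add: theI')

lemma definable_fun_the1 [dfn]:
  assumes "definable (\<lambda>v. R (v 0) (\<lambda>i. v (Suc i)))"
  shows "definable_fun (\<lambda>v. the1 (\<lambda>y. R y v))"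
proof -
  have 1: "y = the1 (\<lambda>y. R y v) \<longleftrightarrow>
      (\<exists>!y. R y v) \<and> R y v \<or> \<not> (\<exists>!y. R y v) \<and> y = undefined" for y v
    using the1I[of "\<lambda>y. R y v"] by (cases "\<exists>!y. R y v") (auto simp: the1_def)
  have 2: "definable (\<lambda>v. R (v 0) (\<lambda>i. v (Suc (Suc i))))"
    using definable_reindex[OF assms, of "\<lambda>i. if i = 0 then 0 else Suc i"] by simp
  show ?thesis
    unfolding definable_fun_def 1 by (intro dfn 2 assms)
qed

lemma separation_definable:
  assumes "definable (\<lambda>v. P (v 0))"
  shows "\<exists>b. \<forall>x. x \<epsilon> b \<longleftrightarrow> x \<epsilon> a \<and> P x"
proof -
  obtain p c where P: "\<And>v. P (v 0) \<longleftrightarrow> sat (=) (\<epsilon>) (merge v c) p"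
    using assms by (auto simp: definable_def)
  \<comment> \<open>As \<open>P\<close> looks at one variable only, all even indices may be sent to
    \<open>x\<close>. Index 1 is occupied by the set \<open>a\<close>, hence the parameters start at
    index 2.\<close>
  have "case_nat x (case_nat a c) \<circ> (\<lambda>i. if even i then 0 else Suc (Suc (i div 2))) =
      merge (\<lambda>_. x) c" for x
    by (rule ext) (simp add: merge_def)
  then have "P x \<longleftrightarrow> sat (=) (\<epsilon>) (case_nat x (case_nat a c))
      (ren (\<lambda>i. if even i then 0 else Suc (Suc (i div 2))) p)" for x
    using P[of "\<lambda>_. x"] by (simp only: sat_ren)
  then show ?thesis
    using separation[of a c] by simp
qed

lemma definable_subst1: "definable (\<lambda>v. P (v 0)) \<Longrightarrow> definable_fun s \<Longrightarrow> definable (\<lambda>v. P (s v))"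
  by (rule definable_subst)

lemma definable_fun_comp:
  "definable_fun (\<lambda>v. g (v 0)) \<Longrightarrow> definable_fun s \<Longrightarrow> definable_fun (\<lambda>v. g (s v))"
  by (rule definable_fun_subst1) (simp_all add: definable_fun_def)

lemma definable_fun_comp2:
  "definable_fun (\<lambda>v. g (v 0) (v (Suc 0))) \<Longrightarrow> definable_fun s \<Longrightarrow> definable_fun t \<Longrightarrow>
    definable_fun (\<lambda>v. g (s v) (t v))"
  by (rule definable_fun_subst2) (simp_all add: definable_fun_def)

subsection \<open>Sets, pairs and functions\<close>

text \<open>Built on \<open>the1\<close>, this is a definable operation whether or not the set
  exists. Definability of the constructions below and the description of their elements can
  therefore be proved separately.\<close>

definition collect :: "('u \<Rightarrow> bool) \<Rightarrow> 'u" where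
  "collect P = the1 (\<lambda>u. \<forall>z. z \<epsilon> u \<longleftrightarrow> P z)"

lemma mem_collect:
  assumes "\<exists>u. \<forall>z. z \<epsilon> u \<longleftrightarrow> P z"
  shows "z \<epsilon> collect P \<longleftrightarrow> P z"
proof -
  obtain u where u: "\<forall>z. z \<epsilon> u \<longleftrightarrow> P z"
    using assms ..
  have "collect P = u"
    unfolding collect_def
  proof (rule the1_equality)
    show "y = u" if "\<forall>z. z \<epsilon> y \<longleftrightarrow> P z" for y
      by (rule extensionality) (simp add: u that)
  qed (fact u)
  then show ?thesis
    using u by simp
qed

lemma definable_fun_collect [dfn]:
  assumes "definable (\<lambda>v. R (v 0) (\<lambda>i. v (Suc i)))"
  shows "definable_fun (\<lambda>v. collect (\<lambda>z. R z v))"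
proof -
  have "definable (\<lambda>v. R (v 0) (\<lambda>i. v (Suc (Suc i))))"
    using definable_reindex[OF assms, of "\<lambda>i. if i = 0 then 0 else Suc i"] by simp
  then show ?thesis
    unfolding collect_def by (intro dfn)
qed

definition emp :: 'u where
  "emp = collect (\<lambda>_. False)"

definition upair :: "'u \<Rightarrow> 'u \<Rightarrow> 'u" where
  "upair a b = collect (\<lambda>z. z = a \<or> z = b)"

definition pair :: "'u \<Rightarrow> 'u \<Rightarrow> 'u" where
  "pair a b = upair (upair a a) (upair a b)"

definition pow :: "'u \<Rightarrow> 'u" where
  "pow a = collect (\<lambda>y. \<forall>z. z \<epsilon> y \<longrightarrow> z \<epsilon> a)"

definition un :: "'u \<Rightarrow> 'u \<Rightarrow> 'u" where
  "un a b = collect (\<lambda>z. z \<epsilon> a \<or> z \<epsilon> b)"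

definition sep :: "'u \<Rightarrow> ('u \<Rightarrow> bool) \<Rightarrow> 'u" where
  "sep a P = collect (\<lambda>z. z \<epsilon> a \<and> P z)"

definition prod :: "'u \<Rightarrow> 'u \<Rightarrow> 'u" where
  "prod A B = collect (\<lambda>p. \<exists>x y. x \<epsilon> A \<and> y \<epsilon> B \<and> p = pair x y)"

definition suc :: "'u \<Rightarrow> 'u" where
  "suc n = collect (\<lambda>z. z \<epsilon> n \<or> z = n)"

lemma mem_sep: "definable (\<lambda>v. P (v 0)) \<Longrightarrow> z \<epsilon> sep a P \<longleftrightarrow> z \<epsilon> a \<and> P z"
  unfolding sep_def by (rule mem_collect[OF separation_definable])

lemma mem_emp [simp]: "\<not> z \<epsilon> emp"
  using mem_collect[of "\<lambda>_. False" z] separation_definable[of "\<lambda>_. False"] definable_const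
  unfolding emp_def by auto

lemma mem_upair [simp]: "z \<epsilon> upair a b \<longleftrightarrow> z = a \<or> z = b"
  unfolding upair_def by (rule mem_collect[OF pairing])

lemma mem_pow [simp]: "y \<epsilon> pow a \<longleftrightarrow> (\<forall>z. z \<epsilon> y \<longrightarrow> z \<epsilon> a)"
  unfolding pow_def by (rule mem_collect[OF powerset])

lemma mem_un [simp]: "z \<epsilon> un a b \<longleftrightarrow> z \<epsilon> a \<or> z \<epsilon> b"
  unfolding un_def
proof (rule mem_collect)
  obtain u where "\<And>z. z \<epsilon> u \<longleftrightarrow> (\<exists>y. y \<epsilon> upair a b \<and> z \<epsilon> y)"
    using union by blast
  then show "\<exists>u. \<forall>z. z \<epsilon> u \<longleftrightarrow> z \<epsilon> a \<or> z \<epsilon> b"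
    by auto
qed

lemma mem_suc [simp]: "z \<epsilon> suc n \<longleftrightarrow> z \<epsilon> n \<or> z = n"
  unfolding suc_def by (rule mem_collect, rule exI[of _ "un n (upair n n)"]) simp

lemma pair_eq_iff [simp]: "pair a b = pair c d \<longleftrightarrow> a = c \<and> b = d"
proof
  assume "pair a b = pair c d"
  then have "z \<epsilon> pair a b \<longleftrightarrow> z \<epsilon> pair c d" for z
    by simp
  then have *: "z = upair a a \<or> z = upair a b \<longleftrightarrow> z = upair c c \<or> z = upair c d" for z
    by (simp add: pair_def)
  have up: "upair x y = upair u v \<longleftrightarrow> (\<forall>z. z = x \<or> z = y \<longleftrightarrow> z = u \<or> z = v)" for x y u v
    using extensionality[of "upair x y" "upair u v"] mem_upair by metis
  have "a = c"
    using *[of "upair a a"] *[of "upair c c"] unfolding up by metis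
  moreover from this have "b = d"
    using *[of "upair a b"] *[of "upair c d"] unfolding up by metis
  ultimately show "a = c \<and> b = d" ..
qed simp

lemma definable_fun_upair [dfn]:
  "definable_fun s \<Longrightarrow> definable_fun t \<Longrightarrow> definable_fun (\<lambda>v. upair (s v) (t v))"
  by (rule definable_fun_comp2[of upair]) (simp_all add: upair_def, intro dfn)

lemma definable_fun_pair [dfn]:
  "definable_fun s \<Longrightarrow> definable_fun t \<Longrightarrow> definable_fun (\<lambda>v. pair (s v) (t v))"
  unfolding pair_def by (intro dfn)

lemma definable_fun_suc [dfn]: "definable_fun s \<Longrightarrow> definable_fun (\<lambda>v. suc (s v))"
  by (rule definable_fun_comp[of suc]) (simp_all add: suc_def, intro dfn)

text \<open>A Kuratowski pair of elements of \<open>A\<close> and \<open>B\<close> is a set of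
  subsets of their union, so the double power set of the union bounds the separation.\<close>

lemma mem_prod: "p \<epsilon> prod A B \<longleftrightarrow> (\<exists>x y. x \<epsilon> A \<and> y \<epsilon> B \<and> p = pair x y)"
  unfolding prod_def
proof (rule mem_collect)
  have "definable (\<lambda>v. \<exists>x y. x \<epsilon> A \<and> y \<epsilon> B \<and> v 0 = pair x y)"
    by (intro dfn)
  then have "z \<epsilon> sep (pow (pow (un A B))) (\<lambda>p. \<exists>x y. x \<epsilon> A \<and> y \<epsilon> B \<and> p = pair x y) \<longleftrightarrow>
      (\<exists>x y. x \<epsilon> A \<and> y \<epsilon> B \<and> z = pair x y)" for z
    using mem_sep[of "\<lambda>p. \<exists>x y. x \<epsilon> A \<and> y \<epsilon> B \<and> p = pair x y"] by (auto simp: pair_def)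
  then show "\<exists>u. \<forall>z. z \<epsilon> u \<longleftrightarrow> (\<exists>x y. x \<epsilon> A \<and> y \<epsilon> B \<and> z = pair x y)"
    by blast
qed

lemma pair_mem_prod [simp]: "pair x y \<epsilon> prod A B \<longleftrightarrow> x \<epsilon> A \<and> y \<epsilon> B"
  by (auto simp: mem_prod)

definition isfun :: "'u \<Rightarrow> 'u \<Rightarrow> 'u \<Rightarrow> bool" where
  "isfun f A B \<longleftrightarrow> (\<forall>p. p \<epsilon> f \<longrightarrow> p \<epsilon> prod A B) \<and> (\<forall>x. x \<epsilon> A \<longrightarrow> (\<exists>!y. pair x y \<epsilon> f))"

definition ap :: "'u \<Rightarrow> 'u \<Rightarrow> 'u" where
  "ap f x = the1 (\<lambda>y. pair x y \<epsilon> f)"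

text \<open>Turns an operation of HOL into a function of the model. The codomain \<open>B\<close>
  bounds the graph as separation demands; the operation must be definable for the result to have the
  intended elements.\<close>

definition lam :: "'u \<Rightarrow> 'u \<Rightarrow> ('u \<Rightarrow> 'u) \<Rightarrow> 'u" where
  "lam A B t = sep (prod A B) (\<lambda>p. \<exists>x. p = pair x (t x))"

lemma definable_fun_ap [dfn]:
  "definable_fun s \<Longrightarrow> definable_fun t \<Longrightarrow> definable_fun (\<lambda>v. ap (s v) (t v))"
  by (rule definable_fun_comp2[of ap]) (simp_all add: ap_def, intro dfn)

lemma pair_mem_fun: "isfun f A B \<Longrightarrow> pair x y \<epsilon> f \<longleftrightarrow> x \<epsilon> A \<and> y = ap f x"
  unfolding ap_def isfun_def using the1I[of "\<lambda>y. pair x y \<epsilon> f"] pair_mem_prod by metis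

lemma ap_closed: "isfun f A B \<Longrightarrow> x \<epsilon> A \<Longrightarrow> ap f x \<epsilon> B"
  using pair_mem_fun[of f A B x "ap f x"] unfolding isfun_def by auto

lemma fun_eqI:
  assumes "isfun f A B" "isfun g A B'" "\<And>x. x \<epsilon> A \<Longrightarrow> ap f x = ap g x"
  shows "f = g"
proof (rule extensionality)
  fix p
  have "p \<epsilon> f \<longleftrightarrow> (\<exists>x y. p = pair x y \<and> pair x y \<epsilon> f)"
    using assms(1) unfolding isfun_def mem_prod by blast
  moreover have "p \<epsilon> g \<longleftrightarrow> (\<exists>x y. p = pair x y \<and> pair x y \<epsilon> g)"
    using assms(2) unfolding isfun_def mem_prod by blast
  ultimately show "p \<epsilon> f \<longleftrightarrow> p \<epsilon> g"
    using pair_mem_fun[OF assms(1)] pair_mem_fun[OF assms(2)] assms(3) by auto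
qed

lemma pair_mem_lam:
  assumes "definable_fun (\<lambda>v. t (v 0))" "\<And>x. x \<epsilon> A \<Longrightarrow> t x \<epsilon> B"
  shows "pair x y \<epsilon> lam A B t \<longleftrightarrow> x \<epsilon> A \<and> y = t x"
proof -
  have "definable (\<lambda>v. \<exists>x. v 0 = pair x (t x))"
    by (intro dfn assms)
  then have "pair x y \<epsilon> lam A B t \<longleftrightarrow> pair x y \<epsilon> prod A B \<and> (\<exists>x'. pair x y = pair x' (t x'))"
    unfolding lam_def by (rule mem_sep)
  then show ?thesis
    using assms(2) by auto
qed

lemma isfun_lam:
  assumes "definable_fun (\<lambda>v. t (v 0))" "\<And>x. x \<epsilon> A \<Longrightarrow> t x \<epsilon> B"
  shows "isfun (lam A B t) A B"
proof -
  have "definable (\<lambda>v. \<exists>x. v 0 = pair x (t x))"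
    by (intro dfn assms)
  then have "p \<epsilon> lam A B t \<Longrightarrow> p \<epsilon> prod A B" for p
    unfolding lam_def using mem_sep by simp
  then show ?thesis
    unfolding isfun_def using pair_mem_lam[OF assms] by auto
qed

lemma ap_lam:
  assumes "definable_fun (\<lambda>v. t (v 0))" "\<And>x. x \<epsilon> A \<Longrightarrow> t x \<epsilon> B" "x \<epsilon> A"
  shows "ap (lam A B t) x = t x"
  using pair_mem_fun[OF isfun_lam[of t A B]] pair_mem_lam[of t A B] assms by metis

section \<open>Meaning of the formulas for pairs, products and functions\<close>

abbreviation holds :: "(nat \<Rightarrow> 'u) \<Rightarrow> nat \<Rightarrow> (nat \<Rightarrow> 'u) \<Rightarrow> form \<Rightarrow> bool" where
  "holds \<equiv> hold (=) (\<epsilon>)"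

lemma eq_upair_iff: "u = upair a b \<longleftrightarrow> (\<forall>z. z \<epsilon> u \<longleftrightarrow> z = a \<or> z = b)"
  using extensionality[of u "upair a b"] by auto

lemma eq_prod_iff: "P = prod A B \<longleftrightarrow> (\<forall>p. p \<epsilon> P \<longleftrightarrow> (\<exists>x y. x \<epsilon> A \<and> y \<epsilon> B \<and> p = pair x y))"
  using extensionality[of P "prod A B"] by (auto simp: mem_prod)

lemma eq_emp_iff: "e = emp \<longleftrightarrow> (\<forall>z. \<not> z \<epsilon> e)"
  using extensionality[of e emp] by auto

lemma eq_suc_iff: "m = suc n \<longleftrightarrow> (\<forall>z. z \<epsilon> m \<longleftrightarrow> z \<epsilon> n \<or> z = n)"
  using extensionality[of m "suc n"] by auto

lemma hold_is_empty [hold]: "x < d \<Longrightarrow> holds w d \<rho> (is_empty x) \<longleftrightarrow> \<rho> x = emp"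
  by (simp add: is_empty_def hold eq_emp_iff)

lemma hold_is_upair [hold]:
  "a < d \<Longrightarrow> b < d \<Longrightarrow> u < d \<Longrightarrow> holds w d \<rho> (is_upair a b u) \<longleftrightarrow> \<rho> u = upair (\<rho> a) (\<rho> b)"
  by (simp add: is_upair_def hold eq_upair_iff)

lemma hold_is_succ [hold]:
  "n < d \<Longrightarrow> m < d \<Longrightarrow> holds w d \<rho> (is_succ n m) \<longleftrightarrow> \<rho> m = suc (\<rho> n)"
  by (simp add: is_succ_def hold eq_suc_iff)

lemma hold_is_pair [hold]:
  "a < d \<Longrightarrow> b < d \<Longrightarrow> p < d \<Longrightarrow> holds w d \<rho> (is_pair a b p) \<longleftrightarrow> \<rho> p = pair (\<rho> a) (\<rho> b)"
  by (simp add: is_pair_def hold pair_def)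

lemma hold_is_prod [hold]:
  "A < d \<Longrightarrow> B < d \<Longrightarrow> P < d \<Longrightarrow> holds w d \<rho> (is_prod A B P) \<longleftrightarrow> \<rho> P = prod (\<rho> A) (\<rho> B)"
  by (simp add: is_prod_def hold eq_prod_iff)

lemma hold_app [hold]:
  "f < d \<Longrightarrow> x < d \<Longrightarrow> y < d \<Longrightarrow> holds w d \<rho> (app f x y) \<longleftrightarrow> pair (\<rho> x) (\<rho> y) \<epsilon> \<rho> f"
  by (simp add: app_def hold)

lemma hold_app2 [hold]:
  "f < d \<Longrightarrow> x < d \<Longrightarrow> y < d \<Longrightarrow> z < d \<Longrightarrow>
    holds w d \<rho> (app2 f x y z) \<longleftrightarrow> pair (pair (\<rho> x) (\<rho> y)) (\<rho> z) \<epsilon> \<rho> f"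
  by (simp add: app2_def hold)

lemma hold_is_fun [hold]:
  "f < d \<Longrightarrow> A < d \<Longrightarrow> B < d \<Longrightarrow> holds w d \<rho> (is_fun f A B) \<longleftrightarrow> isfun (\<rho> f) (\<rho> A) (\<rho> B)"
  by (simp add: is_fun_def hold isfun_def mem_prod Ex1_def)

lemma hold_is_binop [hold]:
  "s < d \<Longrightarrow> C < d \<Longrightarrow> holds w d \<rho> (is_binop s C) \<longleftrightarrow> isfun (\<rho> s) (prod (\<rho> C) (\<rho> C)) (\<rho> C)"
  by (simp add: is_binop_def hold)

subsection \<open>Natural numbers\<close>

definition closed_succ :: "'u \<Rightarrow> bool" where
  "closed_succ w \<longleftrightarrow> emp \<epsilon> w \<and> (\<forall>n. n \<epsilon> w \<longrightarrow> suc n \<epsilon> w)"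

definition omega :: 'u where
  "omega = collect (\<lambda>n. \<forall>v. closed_succ v \<longrightarrow> n \<epsilon> v)"

lemma hold_is_inductive [hold]:
  "x < d \<Longrightarrow> holds w d \<rho> (is_inductive x) \<longleftrightarrow> closed_succ (\<rho> x)"
  by (simp add: is_inductive_def hold closed_succ_def)

lemma definable_closed_succ [dfn]: "definable_fun s \<Longrightarrow> definable (\<lambda>v. closed_succ (s v))"
proof (rule definable_subst1[of closed_succ])
  show "definable (\<lambda>v. closed_succ (v 0))"
    unfolding closed_succ_def by (intro dfn)
qed

lemma mem_omega: "n \<epsilon> omega \<longleftrightarrow> (\<forall>v. closed_succ v \<longrightarrow> n \<epsilon> v)"
  unfolding omega_def
proof (rule mem_collect)
  obtain w where "closed_succ w"
    using infinity unfolding closed_succ_def eq_emp_iff[symmetric] eq_suc_iff[symmetric] by auto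
  moreover have "\<exists>b. \<forall>x. x \<epsilon> b \<longleftrightarrow> x \<epsilon> w \<and> (\<forall>v. closed_succ v \<longrightarrow> x \<epsilon> v)"
    by (rule separation_definable) (intro dfn)
  ultimately show "\<exists>u. \<forall>z. z \<epsilon> u \<longleftrightarrow> (\<forall>v. closed_succ v \<longrightarrow> z \<epsilon> v)"
    by blast
qed

lemma emp_omega [simp]: "emp \<epsilon> omega"
  by (simp add: mem_omega closed_succ_def)

lemma suc_omega [simp]: "n \<epsilon> omega \<Longrightarrow> suc n \<epsilon> omega"
  by (simp add: mem_omega closed_succ_def)

lemma closed_succ_omega: "closed_succ omega"
  by (simp add: closed_succ_def)

lemma hold_is_omega [hold]: "x < d \<Longrightarrow> holds w d \<rho> (is_omega x) \<longleftrightarrow> \<rho> x = omega"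
proof -
  have "W = omega \<longleftrightarrow> closed_succ W \<and> (\<forall>v. closed_succ v \<longrightarrow> (\<forall>n. n \<epsilon> W \<longrightarrow> n \<epsilon> v))" for W
    using extensionality[of W omega] closed_succ_omega mem_omega by auto
  then show "x < d \<Longrightarrow> ?thesis"
    by (simp add: is_omega_def hold)
qed

text \<open>Since \<open>omega\<close> may contain nonstandard elements, induction is confined to
  definable properties: those are the ones for which the elements satisfying \<open>P\<close> form a
  set, and this set is inductive.\<close>

lemma omega_induct [consumes 2, case_names zero suc]:
  assumes "n \<epsilon> omega" "definable (\<lambda>v. P (v 0))"
    "P emp" "\<And>n. n \<epsilon> omega \<Longrightarrow> P n \<Longrightarrow> P (suc n)"
  shows "P n"
proof -
  have "closed_succ (sep omega P)"
    using assms(3,4) by (simp add: closed_succ_def mem_sep[OF assms(2)])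
  then show ?thesis
    using assms(1) mem_sep[OF assms(2)] unfolding mem_omega[of n] by blast
qed

lemma omega_transitive:
  assumes "n \<epsilon> omega" "x \<epsilon> n" "y \<epsilon> x"
  shows "y \<epsilon> n"
proof -
  have "\<forall>x y. x \<epsilon> n \<longrightarrow> y \<epsilon> x \<longrightarrow> y \<epsilon> n"
    using assms(1) by (rule omega_induct) (intro dfn, auto)
  then show ?thesis
    using assms by blast
qed

text \<open>If \<open>m\<close> and \<open>n\<close> differed, each would be an element of the
  other, and transitivity would give them the same elements.\<close>

lemma suc_inject:
  assumes "suc m = suc n" "m \<epsilon> omega" "n \<epsilon> omega"
  shows "m = n"
proof (rule ccontr)
  assume "m \<noteq> n"
  moreover have "m \<epsilon> suc n" "n \<epsilon> suc m"
    using mem_suc[of m m] mem_suc[of n n] assms(1) by auto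
  ultimately have "m \<epsilon> n" "n \<epsilon> m"
    by auto
  then show False
    using omega_transitive assms extensionality[of m n] \<open>m \<noteq> n\<close> by blast
qed

lemma suc_not_emp [simp]: "suc n \<noteq> emp" "emp \<noteq> suc n"
  using mem_suc[of n n] mem_emp by metis+

definition rec_closed :: "'u \<Rightarrow> ('u \<Rightarrow> 'u) \<Rightarrow> ('u \<Rightarrow> 'u \<Rightarrow> 'u) \<Rightarrow> 'u \<Rightarrow> bool" where
  "rec_closed P base step S \<longleftrightarrow> (\<forall>p. p \<epsilon> P \<longrightarrow> pair (pair p emp) (base p) \<epsilon> S) \<and>
    (\<forall>p n a. p \<epsilon> P \<longrightarrow> n \<epsilon> omega \<longrightarrow> pair (pair p n) a \<epsilon> S \<longrightarrow>
      pair (pair p (suc n)) (step p a) \<epsilon> S)"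

text \<open>The function is the least set of triples closed under \<open>base\<close> and
  \<open>step\<close>. The parameter \<open>p\<close> lets one statement serve both addition, where
  it is the first summand, and multiples, where it is the group element.\<close>

lemma recursion:
  assumes base: "definable_fun (\<lambda>v. base (v 0))" "\<And>p. p \<epsilon> P \<Longrightarrow> base p \<epsilon> A"
    and step: "definable_fun (\<lambda>v. step (v 0) (v (Suc 0)))"
      "\<And>p a. p \<epsilon> P \<Longrightarrow> a \<epsilon> A \<Longrightarrow> step p a \<epsilon> A"
  shows "\<exists>f. isfun f (prod P omega) A \<and> (\<forall>p. p \<epsilon> P \<longrightarrow> ap f (pair p emp) = base p) \<and>
    (\<forall>p n. p \<epsilon> P \<longrightarrow> n \<epsilon> omega \<longrightarrow> ap f (pair p (suc n)) = step p (ap f (pair p n)))"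
proof -
  let ?T = "prod (prod P omega) A"
  let ?cl = "rec_closed P base step"
  have cl: "definable (\<lambda>v. ?cl (v 0))"
    unfolding rec_closed_def
    by (intro dfn definable_fun_comp[OF base(1)] definable_fun_comp2[OF step(1)])
  define G where "G = sep ?T (\<lambda>z. \<forall>S. ?cl S \<longrightarrow> z \<epsilon> S)"
  have G: "z \<epsilon> G \<longleftrightarrow> z \<epsilon> ?T \<and> (\<forall>S. ?cl S \<longrightarrow> z \<epsilon> S)" for z
    unfolding G_def by (rule mem_sep) (intro dfn definable_subst1[OF cl])
  have clG: "?cl G"
    unfolding rec_closed_def
  proof (intro conjI allI impI)
    fix p assume "p \<epsilon> P"
    then show "pair (pair p emp) (base p) \<epsilon> G"
      using base(2) by (simp add: G rec_closed_def)
  next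
    fix p n a assume *: "p \<epsilon> P" "n \<epsilon> omega" "pair (pair p n) a \<epsilon> G"
    then have "pair (pair p (suc n)) (step p a) \<epsilon> S" if "?cl S" for S
      using that G unfolding rec_closed_def by blast
    then show "pair (pair p (suc n)) (step p a) \<epsilon> G"
      using * step(2) by (simp add: G)
  qed
  have least: "\<not> z \<epsilon> G" if "?cl (sep G (\<lambda>x. x \<noteq> z))" for z
  proof
    assume "z \<epsilon> G"
    then have "z \<epsilon> sep G (\<lambda>x. x \<noteq> z)"
      using that G by blast
    then show False
      by (subst (asm) mem_sep) (intro dfn, simp)
  qed
  have minus: "x \<epsilon> sep G (\<lambda>x. x \<noteq> z) \<longleftrightarrow> x \<epsilon> G \<and> x \<noteq> z" for x z
    by (rule mem_sep) (intro dfn)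
  have zero: "pair (pair p emp) a \<epsilon> G \<longleftrightarrow> a = base p" if p: "p \<epsilon> P" for p a
  proof
    assume a: "pair (pair p emp) a \<epsilon> G"
    show "a = base p"
    proof (rule ccontr)
      assume "a \<noteq> base p"
      then have "?cl (sep G (\<lambda>x. x \<noteq> pair (pair p emp) a))"
        using clG unfolding rec_closed_def minus by auto
      then show False
        using least a by blast
    qed
  next
    assume "a = base p"
    then show "pair (pair p emp) a \<epsilon> G"
      using clG p unfolding rec_closed_def by blast
  qed
  have suc: "pair (pair p (suc n)) b \<epsilon> G \<longleftrightarrow> b = step p a"
    if p: "p \<epsilon> P" and n: "n \<epsilon> omega" and a: "\<And>b. pair (pair p n) b \<epsilon> G \<longleftrightarrow> b = a" for p n a b
  proof
    assume b: "pair (pair p (suc n)) b \<epsilon> G"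
    show "b = step p a"
    proof (rule ccontr)
      assume "b \<noteq> step p a"
      \<comment> \<open>Only the triple of \<open>p\<close>, \<open>n\<close> and \<open>a\<close>
        forces a value at \<open>suc n\<close>, because \<open>suc\<close> is injective and never
        yields \<open>emp\<close>; the forced value is \<open>step p a\<close>, so \<open>b\<close>
        can be removed.\<close>
      then have "?cl (sep G (\<lambda>x. x \<noteq> pair (pair p (suc n)) b))"
        using clG a suc_inject[OF _ _ n] unfolding rec_closed_def minus pair_eq_iff
        by (metis suc_not_emp(1))
      then show False
        using least b by blast
    qed
  next
    assume "b = step p a"
    then show "pair (pair p (suc n)) b \<epsilon> G"
      using clG p n a unfolding rec_closed_def by blast
  qed
  have ex1: "\<exists>!a. pair (pair p n) a \<epsilon> G" if p: "p \<epsilon> P" and n: "n \<epsilon> omega" for p n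
    using n
  proof (rule omega_induct)
    show "definable (\<lambda>v. \<exists>!a. pair (pair p (v 0)) a \<epsilon> G)"
      by (intro dfn)
    show "\<exists>!a. pair (pair p emp) a \<epsilon> G"
      using zero[OF p] by simp
    fix n assume n: "n \<epsilon> omega" "\<exists>!a. pair (pair p n) a \<epsilon> G"
    then obtain a where "\<And>b. pair (pair p n) b \<epsilon> G \<longleftrightarrow> b = a"
      by blast
    from suc[OF p n(1) this] show "\<exists>!a. pair (pair p (suc n)) a \<epsilon> G"
      by simp
  qed
  have funG: "isfun G (prod P omega) A"
    unfolding isfun_def
  proof (intro conjI allI impI)
    show "p \<epsilon> ?T" if "p \<epsilon> G" for p
      using that G by blast
    show "\<exists>!a. pair x a \<epsilon> G" if "x \<epsilon> prod P omega" for x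
      using that ex1 unfolding mem_prod by blast
  qed
  note mem = pair_mem_fun[OF funG]
  have "ap G (pair p emp) = base p" if "p \<epsilon> P" for p
    using zero[OF that] mem that by auto
  moreover have "ap G (pair p (suc n)) = step p (ap G (pair p n))" if "p \<epsilon> P" "n \<epsilon> omega" for p n
    using suc[OF that, of "ap G (pair p n)" "ap G (pair p (suc n))"] mem that by simp
  ultimately show ?thesis
    using funG by blast
qed

section \<open>Abelian groups in a model\<close>

definition car :: "'u \<Rightarrow> 'u" where
  "car A = the1 (\<lambda>C. \<exists>s. A = pair C s)"

definition opn :: "'u \<Rightarrow> 'u" where
  "opn A = the1 (\<lambda>s. \<exists>C. A = pair C s)"

definition pl :: "'u \<Rightarrow> 'u \<Rightarrow> 'u \<Rightarrow> 'u" where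
  "pl A x y = ap (opn A) (pair x y)"

definition zer :: "'u \<Rightarrow> 'u" where
  "zer A = the1 (\<lambda>e. e \<epsilon> car A \<and> (\<forall>x. x \<epsilon> car A \<longrightarrow> pl A e x = x))"

text \<open>A view of the group as an HOL-Algebra structure, so that inverses and cancellation are
  inherited from there.\<close>

definition grp :: "'u \<Rightarrow> 'u monoid" where
  "grp A = \<lparr>carrier = {x. x \<epsilon> car A}, mult = pl A, one = zer A\<rparr>"

definition Ab :: "'u \<Rightarrow> bool" where
  "Ab A \<longleftrightarrow> A = pair (car A) (opn A) \<and> isfun (opn A) (prod (car A) (car A)) (car A) \<and>
    comm_group (grp A)"

definition ishom :: "'u \<Rightarrow> 'u \<Rightarrow> 'u \<Rightarrow> bool" where
  "ishom f A B \<longleftrightarrow> isfun f (car A) (car B) \<and>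
    (\<forall>x y. x \<epsilon> car A \<longrightarrow> y \<epsilon> car A \<longrightarrow> ap f (pl A x y) = pl B (ap f x) (ap f y))"

lemma car_pair [simp]: "car (pair C s) = C"
  unfolding car_def by (rule the1_equality) auto

lemma opn_pair [simp]: "opn (pair C s) = s"
  unfolding opn_def by (rule the1_equality) auto

lemma carrier_grp [simp]: "x \<in> carrier (grp A) \<longleftrightarrow> x \<epsilon> car A"
  by (simp add: grp_def)

lemma mult_grp [simp]: "x \<otimes>\<^bsub>grp A\<^esub> y = pl A x y"
  by (simp add: grp_def)

lemma one_grp [simp]: "\<one>\<^bsub>grp A\<^esub> = zer A"
  by (simp add: grp_def)

lemma definable_fun_pl [dfn]:
  "definable_fun s \<Longrightarrow> definable_fun t \<Longrightarrow> definable_fun (\<lambda>v. pl A (s v) (t v))"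
  unfolding pl_def by (intro dfn)

lemma Ab_comm_group: "Ab A \<Longrightarrow> comm_group (grp A)"
  by (simp add: Ab_def)

lemma mem_opn:
  "Ab A \<Longrightarrow> pair (pair x y) z \<epsilon> opn A \<longleftrightarrow> x \<epsilon> car A \<and> y \<epsilon> car A \<and> z = pl A x y"
  unfolding Ab_def pl_def by (simp add: pair_mem_fun[of _ "prod (car A) (car A)" "car A"])

lemma AbI:
  assumes fn: "isfun s (prod C C) C"
    and assoc: "\<And>x y z. x \<epsilon> C \<Longrightarrow> y \<epsilon> C \<Longrightarrow> z \<epsilon> C \<Longrightarrow>
      ap s (pair (ap s (pair x y)) z) = ap s (pair x (ap s (pair y z)))"
    and comm: "\<And>x y. x \<epsilon> C \<Longrightarrow> y \<epsilon> C \<Longrightarrow> ap s (pair x y) = ap s (pair y x)"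
    and e: "e \<epsilon> C" "\<And>x. x \<epsilon> C \<Longrightarrow> ap s (pair e x) = x"
    and inv: "\<And>x. x \<epsilon> C \<Longrightarrow> \<exists>y. y \<epsilon> C \<and> ap s (pair x y) = e"
  shows "Ab (pair C s)" "zer (pair C s) = e"
proof -
  show zer: "zer (pair C s) = e"
    unfolding zer_def pl_def car_pair opn_pair
  proof (rule the1_equality)
    show "e \<epsilon> C \<and> (\<forall>x. x \<epsilon> C \<longrightarrow> ap s (pair e x) = x)"
      using e by simp
    show "y = e" if "y \<epsilon> C \<and> (\<forall>x. x \<epsilon> C \<longrightarrow> ap s (pair y x) = x)" for y
      using that e comm[of y e] by simp
  qed
  have "comm_group (grp (pair C s))"
  proof (rule comm_groupI)
    show "\<exists>y\<in>carrier (grp (pair C s)). y \<otimes>\<^bsub>grp (pair C s)\<^esub> x = \<one>\<^bsub>grp (pair C s)\<^esub>"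
      if "x \<in> carrier (grp (pair C s))" for x
      using that inv[of x] comm by (auto simp: zer pl_def Bex_def)
  qed (use assoc comm e ap_closed[OF fn] in \<open>auto simp: zer pl_def\<close>)
  then show "Ab (pair C s)"
    using fn by (simp add: Ab_def)
qed

lemma Ab_struct:
  assumes "Ab A"
  shows "x \<epsilon> car A \<Longrightarrow> y \<epsilon> car A \<Longrightarrow> pl A x y \<epsilon> car A"
    and "x \<epsilon> car A \<Longrightarrow> y \<epsilon> car A \<Longrightarrow> z \<epsilon> car A \<Longrightarrow> pl A (pl A x y) z = pl A x (pl A y z)"
    and "x \<epsilon> car A \<Longrightarrow> y \<epsilon> car A \<Longrightarrow> pl A x y = pl A y x"
    and "zer A \<epsilon> car A"
    and "x \<epsilon> car A \<Longrightarrow> pl A (zer A) x = x"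
    and "x \<epsilon> car A \<Longrightarrow> pl A x (zer A) = x"
    and "x \<epsilon> car A \<Longrightarrow> \<exists>y. y \<epsilon> car A \<and> pl A x y = zer A"
proof -
  interpret comm_group "grp A"
    using assms by (rule Ab_comm_group)
  show "x \<epsilon> car A \<Longrightarrow> y \<epsilon> car A \<Longrightarrow> pl A x y \<epsilon> car A"
    using m_closed[of x y] by simp
  show "x \<epsilon> car A \<Longrightarrow> y \<epsilon> car A \<Longrightarrow> z \<epsilon> car A \<Longrightarrow> pl A (pl A x y) z = pl A x (pl A y z)"
    using m_assoc[of x y z] by simp
  show "x \<epsilon> car A \<Longrightarrow> y \<epsilon> car A \<Longrightarrow> pl A x y = pl A y x"
    using m_comm[of x y] by simp
  show "zer A \<epsilon> car A"
    using one_closed by simp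
  show "x \<epsilon> car A \<Longrightarrow> pl A (zer A) x = x" "x \<epsilon> car A \<Longrightarrow> pl A x (zer A) = x"
    using l_one[of x] r_one[of x] by simp_all
  show "x \<epsilon> car A \<Longrightarrow> \<exists>y. y \<epsilon> car A \<and> pl A x y = zer A"
    using r_inv_ex[of x] by auto
qed

lemma pl_cancel:
  assumes "Ab A" "x \<epsilon> car A" "y \<epsilon> car A" "z \<epsilon> car A"
  shows "pl A x y = pl A x z \<longleftrightarrow> y = z"
proof -
  interpret comm_group "grp A"
    using assms(1) by (rule Ab_comm_group)
  show ?thesis
    using Units_l_cancel[of x y z] assms by (simp add: Units_eq)
qed

lemma pl_cancel_right:
  assumes "Ab A" "x \<epsilon> car A" "y \<epsilon> car A" "z \<epsilon> car A"
  shows "pl A y x = pl A z x \<longleftrightarrow> y = z"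
  using pl_cancel[OF assms] Ab_struct(3)[OF assms(1)] assms by metis

lemma ishomD:
  assumes "ishom f A B"
  shows "x \<epsilon> car A \<Longrightarrow> ap f x \<epsilon> car B"
    and "x \<epsilon> car A \<Longrightarrow> y \<epsilon> car A \<Longrightarrow> ap f (pl A x y) = pl B (ap f x) (ap f y)"
    and "pair x y \<epsilon> f \<longleftrightarrow> x \<epsilon> car A \<and> y = ap f x"
  using assms ap_closed pair_mem_fun unfolding ishom_def by blast+

lemma ishom_zer:
  assumes "ishom f A B" "Ab A" "Ab B"
  shows "ap f (zer A) = zer B"
proof -
  note A = Ab_struct[OF \<open>Ab A\<close>] and B = Ab_struct[OF \<open>Ab B\<close>] and f = ishomD[OF assms(1)]
  have "pl B (ap f (zer A)) (ap f (zer A)) = pl B (ap f (zer A)) (zer B)"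
    using f(2)[of "zer A" "zer A"] f(1)[of "zer A"] A(4,5) B(6) by simp
  then show ?thesis
    using pl_cancel[OF \<open>Ab B\<close>] f(1) A(4) B(4) by blast
qed

lemma ishom_eqI: "ishom f A B \<Longrightarrow> ishom g A B \<Longrightarrow> (\<And>x. x \<epsilon> car A \<Longrightarrow> ap f x = ap g x) \<Longrightarrow> f = g"
  unfolding ishom_def using fun_eqI by blast

lemma ishom_lam:
  assumes "definable_fun (\<lambda>v. t (v 0))" "Ab A" "\<And>x. x \<epsilon> car A \<Longrightarrow> t x \<epsilon> car B"
    and "\<And>x y. x \<epsilon> car A \<Longrightarrow> y \<epsilon> car A \<Longrightarrow> t (pl A x y) = pl B (t x) (t y)"
  shows "ishom (lam (car A) (car B) t) A B"
  unfolding ishom_def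
  using isfun_lam[OF assms(1,3)] ap_lam[OF assms(1,3)] Ab_struct(1)[OF assms(2)] assms(4) by simp

lemma hom_exists:
  assumes "definable_fun (\<lambda>v. t (v 0))" "Ab A" "\<And>x. x \<epsilon> car A \<Longrightarrow> t x \<epsilon> car B"
    and "\<And>x y. x \<epsilon> car A \<Longrightarrow> y \<epsilon> car A \<Longrightarrow> t (pl A x y) = pl B (t x) (t y)"
  shows "\<exists>f. ishom f A B \<and> (\<forall>x. x \<epsilon> car A \<longrightarrow> ap f x = t x)"
  using ishom_lam[of t, OF assms] ap_lam[of t, OF assms(1,3)] by blast

section \<open>Identity, composite and zero homomorphisms\<close>

definition idm :: "'u \<Rightarrow> 'u" where
  "idm A = lam (car A) (car A) (\<lambda>x. x)"

text \<open>A relational composite as in \<open>is_comp\<close>. Morphisms are bare graphs from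
  which the groups at their ends cannot be read off, so the operation takes no objects; that it
  yields a homomorphism is shown for composable arguments only.\<close>

definition comp :: "'u \<Rightarrow> 'u \<Rightarrow> 'u" where
  "comp g f = collect (\<lambda>p. \<exists>x y z. pair x y \<epsilon> f \<and> pair y z \<epsilon> g \<and> p = pair x z)"

lemma ishom_idm: "Ab A \<Longrightarrow> ishom (idm A) A A"
  unfolding idm_def by (rule ishom_lam) (intro dfn, auto)

lemma ap_idm: "x \<epsilon> car A \<Longrightarrow> ap (idm A) x = x"
  unfolding idm_def by (rule ap_lam) (intro dfn, auto)

lemma comp_props:
  assumes "ishom f A B" "ishom g B C" "Ab A"
  shows "ishom (comp g f) A C" "x \<epsilon> car A \<Longrightarrow> ap (comp g f) x = ap g (ap f x)"
    and "p \<epsilon> comp g f \<longleftrightarrow> (\<exists>x y z. pair x y \<epsilon> f \<and> pair y z \<epsilon> g \<and> p = pair x z)"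
proof -
  note f = ishomD[OF assms(1)] and g = ishomD[OF assms(2)]
  have d: "definable_fun (\<lambda>v. ap g (ap f (v 0)))"
    by (intro dfn)
  let ?h = "lam (car A) (car C) (\<lambda>x. ap g (ap f x))"
  have h: "ishom ?h A C"
    by (rule ishom_lam[OF d \<open>Ab A\<close>]) (simp_all add: f g)
  have ap: "ap ?h x = ap g (ap f x)" if "x \<epsilon> car A" for x
    by (rule ap_lam[OF d _ that]) (simp add: f g)
  have mem: "p \<epsilon> ?h \<longleftrightarrow> (\<exists>x y z. pair x y \<epsilon> f \<and> pair y z \<epsilon> g \<and> p = pair x z)" for p
  proof -
    have "p \<epsilon> ?h \<longleftrightarrow> (\<exists>x z. pair x z \<epsilon> ?h \<and> p = pair x z)"
      using h unfolding ishom_def isfun_def mem_prod by blast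
    also have "\<dots> \<longleftrightarrow> (\<exists>x y z. pair x y \<epsilon> f \<and> pair y z \<epsilon> g \<and> p = pair x z)"
      unfolding ishomD(3)[OF h] f(3) g(3) using ap f(1) by auto
    finally show ?thesis .
  qed
  have cmp: "comp g f = ?h"
  proof (rule extensionality)
    show "z \<epsilon> comp g f \<longleftrightarrow> z \<epsilon> ?h" for z
      unfolding comp_def mem by (rule mem_collect) (use mem in blast)
  qed
  show "ishom (comp g f) A C" "x \<epsilon> car A \<Longrightarrow> ap (comp g f) x = ap g (ap f x)"
    "p \<epsilon> comp g f \<longleftrightarrow> (\<exists>x y z. pair x y \<epsilon> f \<and> pair y z \<epsilon> g \<and> p = pair x z)"
    unfolding cmp using h ap mem by auto
qed

lemma zero_hom:
  assumes "Ab A" "Ab B"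
  shows "\<exists>f. ishom f A B \<and> (\<forall>x. x \<epsilon> car A \<longrightarrow> ap f x = zer B)"
  by (rule hom_exists[of "\<lambda>_. zer B" A B]) (intro dfn, simp_all add: assms Ab_struct(4,5)[OF assms(2)])

section \<open>Meaning of the formulas for groups and homomorphisms\<close>

lemma hold_is_abgroup [hold]:
  assumes "A < d"
  shows "holds w d \<rho> (is_abgroup A) \<longleftrightarrow> Ab (\<rho> A)"
proof
  assume "holds w d \<rho> (is_abgroup A)"
  then have "\<exists>C s. \<rho> A = pair C s \<and> isfun s (prod C C) C \<and>
      (\<forall>x y z u v w. pair (pair x y) u \<epsilon> s \<and> pair (pair u z) w \<epsilon> s \<and> pair (pair y z) v \<epsilon> s \<longrightarrow>
        pair (pair x v) w \<epsilon> s) \<and>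
      (\<forall>x y u. pair (pair x y) u \<epsilon> s \<longrightarrow> pair (pair y x) u \<epsilon> s) \<and>
      (\<exists>e. e \<epsilon> C \<and> (\<forall>x. x \<epsilon> C \<longrightarrow> pair (pair e x) x \<epsilon> s \<and> (\<exists>y. y \<epsilon> C \<and> pair (pair x y) e \<epsilon> s)))"
    using assms by (simp add: is_abgroup_def hold)
  then obtain C s e where A: "\<rho> A = pair C s" and fn: "isfun s (prod C C) C"
    and *: "\<forall>x y z u v w. pair (pair x y) u \<epsilon> s \<and> pair (pair u z) w \<epsilon> s \<and> pair (pair y z) v \<epsilon> s \<longrightarrow>
        pair (pair x v) w \<epsilon> s"
      "\<forall>x y u. pair (pair x y) u \<epsilon> s \<longrightarrow> pair (pair y x) u \<epsilon> s"
      "e \<epsilon> C" "\<forall>x. x \<epsilon> C \<longrightarrow> pair (pair e x) x \<epsilon> s \<and> (\<exists>y. y \<epsilon> C \<and> pair (pair x y) e \<epsilon> s)"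
    by (elim exE conjE) (rule that)
  note mem = pair_mem_fun[OF fn]
  show "Ab (\<rho> A)"
    unfolding A
  proof (rule AbI(1)[OF fn _ _ \<open>e \<epsilon> C\<close>])
    show "ap s (pair (ap s (pair x y)) z) = ap s (pair x (ap s (pair y z)))"
      if "x \<epsilon> C" "y \<epsilon> C" "z \<epsilon> C" for x y z
      using *(1)[rule_format, of x y "ap s (pair x y)" z "ap s (pair (ap s (pair x y)) z)"
          "ap s (pair y z)"] that ap_closed[OF fn] by (simp add: mem)
    show "ap s (pair x y) = ap s (pair y x)" if "x \<epsilon> C" "y \<epsilon> C" for x y
      using *(2)[rule_format, of x y] that by (simp add: mem)
    show "ap s (pair e x) = x" "\<exists>y. y \<epsilon> C \<and> ap s (pair x y) = e" if "x \<epsilon> C" for x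
      using *(4)[rule_format, OF that] by (auto simp: mem)
  qed
next
  assume "Ab (\<rho> A)"
  note mem = mem_opn[OF this] and A = Ab_struct[OF this]
  have "\<rho> A = pair (car (\<rho> A)) (opn (\<rho> A))" "isfun (opn (\<rho> A)) (prod (car (\<rho> A)) (car (\<rho> A))) (car (\<rho> A))"
    using \<open>Ab (\<rho> A)\<close> by (simp_all add: Ab_def)
  moreover have "\<exists>e. e \<epsilon> car (\<rho> A) \<and> (\<forall>x. x \<epsilon> car (\<rho> A) \<longrightarrow>
      pair (pair e x) x \<epsilon> opn (\<rho> A) \<and> (\<exists>y. y \<epsilon> car (\<rho> A) \<and> pair (pair x y) e \<epsilon> opn (\<rho> A)))"
    using A(4-7) by (intro exI[of _ "zer (\<rho> A)"]) (auto simp: mem, metis)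
  moreover have "\<forall>x y z u v w. pair (pair x y) u \<epsilon> opn (\<rho> A) \<and> pair (pair u z) w \<epsilon> opn (\<rho> A) \<and>
      pair (pair y z) v \<epsilon> opn (\<rho> A) \<longrightarrow> pair (pair x v) w \<epsilon> opn (\<rho> A)"
    using A(1,2) by (simp add: mem)
  moreover have "\<forall>x y u. pair (pair x y) u \<epsilon> opn (\<rho> A) \<longrightarrow> pair (pair y x) u \<epsilon> opn (\<rho> A)"
    using A(3) by (auto simp: mem)
  ultimately have "\<exists>C s. \<rho> A = pair C s \<and> isfun s (prod C C) C \<and>
      (\<forall>x y z u v w. pair (pair x y) u \<epsilon> s \<and> pair (pair u z) w \<epsilon> s \<and> pair (pair y z) v \<epsilon> s \<longrightarrow>
        pair (pair x v) w \<epsilon> s) \<and>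
      (\<forall>x y u. pair (pair x y) u \<epsilon> s \<longrightarrow> pair (pair y x) u \<epsilon> s) \<and>
      (\<exists>e. e \<epsilon> C \<and> (\<forall>x. x \<epsilon> C \<longrightarrow> pair (pair e x) x \<epsilon> s \<and> (\<exists>y. y \<epsilon> C \<and> pair (pair x y) e \<epsilon> s)))"
    by - (rule exI[of _ "car (\<rho> A)"], rule exI[of _ "opn (\<rho> A)"], intro conjI)
  then show "holds w d \<rho> (is_abgroup A)"
    using assms by (simp add: is_abgroup_def hold)
qed

lemma hold_is_hom [hold]:
  assumes "f < d" "A < d" "B < d" "Ab (\<rho> A)" "Ab (\<rho> B)"
  shows "holds w d \<rho> (is_hom f A B) \<longleftrightarrow> ishom (\<rho> f) (\<rho> A) (\<rho> B)"
proof -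
  define A' B' f' where "A' = \<rho> A" "B' = \<rho> B" "f' = \<rho> f"
  have A: "A' = pair C s \<longleftrightarrow> C = car A' \<and> s = opn A'" for C s
    using assms(4) unfolding A'_B'_f'_def Ab_def by (metis car_pair opn_pair)
  have B: "B' = pair C s \<longleftrightarrow> C = car B' \<and> s = opn B'" for C s
    using assms(5) unfolding A'_B'_f'_def Ab_def by (metis car_pair opn_pair)
  note A1 = Ab_struct(1)[OF assms(4), folded A'_B'_f'_def]
  have "isfun f' (car A') (car B') \<and> (\<forall>x y z x' y' z'. x \<epsilon> car A' \<and> y \<epsilon> car A' \<and> z = pl A' x y \<and>
        pair x x' \<epsilon> f' \<and> pair y y' \<epsilon> f' \<and> x' \<epsilon> car B' \<and> y' \<epsilon> car B' \<and> z' = pl B' x' y' \<longrightarrow>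
        pair z z' \<epsilon> f') \<longleftrightarrow> ishom f' A' B'"
    unfolding ishom_def
    by (rule conj_cong[OF refl]) (auto simp: pair_mem_fun[of f' "car A'" "car B'"] ap_closed[of f' "car A'" "car B'"] A1)
  then show ?thesis
    using assms(1-3)
    by (simp add: is_hom_def hold A'_B'_f'_def[symmetric] A B
        mem_opn[OF assms(4), folded A'_B'_f'_def] mem_opn[OF assms(5), folded A'_B'_f'_def])
qed

lemma hold_is_id [hold]:
  assumes "A < d" "f < d" "Ab (\<rho> A)"
  shows "holds w d \<rho> (is_id A f) \<longleftrightarrow> \<rho> f = idm (\<rho> A)"
proof -
  have A: "\<rho> A = pair C s \<longleftrightarrow> C = car (\<rho> A) \<and> s = opn (\<rho> A)" for C s
    using assms(3) unfolding Ab_def by (metis car_pair opn_pair)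
  have "p \<epsilon> idm (\<rho> A) \<longleftrightarrow> (\<exists>x. x \<epsilon> car (\<rho> A) \<and> p = pair x x)" for p
  proof -
    have "p \<epsilon> idm (\<rho> A) \<longleftrightarrow> (\<exists>x y. p = pair x y \<and> pair x y \<epsilon> idm (\<rho> A))"
      using ishom_idm[OF assms(3)] unfolding ishom_def isfun_def mem_prod by blast
    then show ?thesis
      using ishomD(3)[OF ishom_idm[OF assms(3)]] ap_idm by auto
  qed
  then have "f' = idm (\<rho> A) \<longleftrightarrow> (\<forall>p. p \<epsilon> f' \<longleftrightarrow> (\<exists>x. x \<epsilon> car (\<rho> A) \<and> p = pair x x))" for f'
    using extensionality[of f' "idm (\<rho> A)"] by auto
  then show ?thesis
    using assms(1,2) by (simp add: is_id_def hold A)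
qed

lemma hold_is_comp:
  assumes "g < d" "f < d" "h < d" "ishom (\<rho> f) A B" "ishom (\<rho> g) B C" "Ab A"
  shows "holds w d \<rho> (is_comp g f h) \<longleftrightarrow> \<rho> h = comp (\<rho> g) (\<rho> f)"
proof -
  have "h' = comp (\<rho> g) (\<rho> f) \<longleftrightarrow>
      (\<forall>p. p \<epsilon> h' \<longleftrightarrow> (\<exists>x y z. pair x y \<epsilon> \<rho> f \<and> pair y z \<epsilon> \<rho> g \<and> p = pair x z))" for h'
    using extensionality[of h' "comp (\<rho> g) (\<rho> f)"] comp_props(3)[OF assms(4-6)] by auto
  then show ?thesis
    using assms(1-3) by (simp add: is_comp_def hold)
qed

lemma hold_is_zero [hold]:
  assumes "A < d" "e < d" "Ab (\<rho> A)"
  shows "holds w d \<rho> (is_zero A e) \<longleftrightarrow> \<rho> e = zer (\<rho> A)"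
proof -
  have A: "\<rho> A = pair C s \<longleftrightarrow> C = car (\<rho> A) \<and> s = opn (\<rho> A)" for C s
    using assms(3) unfolding Ab_def by (metis car_pair opn_pair)
  have "e' = zer (\<rho> A) \<longleftrightarrow> e' \<epsilon> car (\<rho> A) \<and> (\<forall>x. x \<epsilon> car (\<rho> A) \<longrightarrow> pl (\<rho> A) e' x = x)" for e'
    using Ab_struct[OF assms(3)] by metis
  then show ?thesis
    using assms(1,2) by (auto simp: is_zero_def hold A mem_opn[OF assms(3)])
qed

definition short_exact :: "'u \<Rightarrow> 'u \<Rightarrow> 'u \<Rightarrow> 'u \<Rightarrow> 'u \<Rightarrow> bool" where
  "short_exact Z f B g A \<longleftrightarrow> ishom f Z B \<and> ishom g B A \<and>
    (\<forall>x y. x \<epsilon> car Z \<longrightarrow> y \<epsilon> car Z \<longrightarrow> ap f x = ap f y \<longrightarrow> x = y) \<and>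
    (\<forall>a. a \<epsilon> car A \<longrightarrow> (\<exists>b. b \<epsilon> car B \<and> ap g b = a)) \<and>
    (\<forall>b. b \<epsilon> car B \<longrightarrow> ap g b = zer A \<longleftrightarrow> (\<exists>x. x \<epsilon> car Z \<and> ap f x = b))"

lemma hold_is_short_exact [hold]:
  assumes "Z < d" "f < d" "B < d" "g < d" "A < d" "Ab (\<rho> Z)" "Ab (\<rho> B)" "Ab (\<rho> A)"
  shows "holds w d \<rho> (is_short_exact Z f B g A) \<longleftrightarrow> short_exact (\<rho> Z) (\<rho> f) (\<rho> B) (\<rho> g) (\<rho> A)"
proof -
  have A: "\<rho> A = pair C s \<longleftrightarrow> C = car (\<rho> A) \<and> s = opn (\<rho> A)" for C s
    using assms(8) unfolding Ab_def by (metis car_pair opn_pair)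
  show ?thesis
  proof (cases "ishom (\<rho> f) (\<rho> Z) (\<rho> B) \<and> ishom (\<rho> g) (\<rho> B) (\<rho> A)")
    case True
    note f = ishomD[OF conjunct1[OF True]] and g = ishomD[OF conjunct2[OF True]]
    have "holds w d \<rho> (is_inj f) \<longleftrightarrow>
        (\<forall>x y. x \<epsilon> car (\<rho> Z) \<longrightarrow> y \<epsilon> car (\<rho> Z) \<longrightarrow> ap (\<rho> f) x = ap (\<rho> f) y \<longrightarrow> x = y)"
      using assms(2) by (auto simp: is_inj_def hold f(3))
    moreover have "holds w d \<rho> (is_surj g A) \<longleftrightarrow>
        (\<forall>a. a \<epsilon> car (\<rho> A) \<longrightarrow> (\<exists>b. b \<epsilon> car (\<rho> B) \<and> ap (\<rho> g) b = a))"
      using assms(4,5) by (auto simp: is_surj_def hold A g(3))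
    moreover have "(\<forall>y. (\<exists>x. pair x y \<epsilon> \<rho> f) \<longleftrightarrow> pair y (zer (\<rho> A)) \<epsilon> \<rho> g) \<longleftrightarrow>
        (\<forall>b. b \<epsilon> car (\<rho> B) \<longrightarrow> ap (\<rho> g) b = zer (\<rho> A) \<longleftrightarrow> (\<exists>x. x \<epsilon> car (\<rho> Z) \<and> ap (\<rho> f) x = b))"
      using f(1) unfolding f(3) g(3) by metis
    ultimately show ?thesis
      using assms True by (simp add: is_short_exact_def hold short_exact_def)
  next
    case False
    then show ?thesis
      using assms by (auto simp: is_short_exact_def hold short_exact_def)
  qed
qed

section \<open>The group of integers in a model\<close>

definition nat_add :: "'u \<Rightarrow> bool" where
  "nat_add s \<longleftrightarrow> isfun s (prod omega omega) omega \<and>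
    (\<forall>m. m \<epsilon> omega \<longrightarrow> ap s (pair m emp) = m) \<and>
    (\<forall>m n. m \<epsilon> omega \<longrightarrow> n \<epsilon> omega \<longrightarrow> ap s (pair m (suc n)) = suc (ap s (pair m n)))"

definition nadd :: 'u where
  "nadd = the1 nat_add"

definition add :: "'u \<Rightarrow> 'u \<Rightarrow> 'u" (infixl "\<uplus>" 65) where
  "m \<uplus> n = ap nadd (pair m n)"

lemma nat_add_unique:
  assumes "nat_add s" "nat_add t"
  shows "s = t"
proof (rule fun_eqI[of _ "prod omega omega" omega _ omega])
  have "\<forall>m. m \<epsilon> omega \<longrightarrow> ap s (pair m n) = ap t (pair m n)" if "n \<epsilon> omega" for n
    using that by (rule omega_induct) (intro dfn, use assms in \<open>simp_all add: nat_add_def\<close>)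
  then show "ap s x = ap t x" if "x \<epsilon> prod omega omega" for x
    using that by (auto simp: mem_prod)
qed (use assms in \<open>simp_all add: nat_add_def\<close>)

lemma nat_add_nadd: "nat_add nadd"
proof -
  have "definable_fun (\<lambda>v. v 0)" "definable_fun (\<lambda>v. suc (v (Suc 0)))"
    by (intro dfn)+
  from recursion[of "\<lambda>p. p" omega omega "\<lambda>p a. suc a", OF this(1) _ this(2)]
  have "\<exists>s. nat_add s"
    unfolding nat_add_def by simp
  then have "\<exists>!s. nat_add s"
    using nat_add_unique by blast
  then show ?thesis
    unfolding nadd_def by (rule the1I)
qed

lemma hold_is_nat_add [hold]:
  assumes "w < d" "s < d" "\<rho> w = omega"
  shows "holds ww d \<rho> (is_nat_add w s) \<longleftrightarrow> \<rho> s = nadd"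
proof -
  have "holds ww d \<rho> (is_nat_add w s) \<longleftrightarrow> nat_add (\<rho> s)"
  proof (cases "isfun (\<rho> s) (prod omega omega) omega")
    case True
    then show ?thesis
      using assms by (auto simp: is_nat_add_def hold nat_add_def pair_mem_fun[OF True])
  next
    case False
    then show ?thesis
      using assms by (simp add: is_nat_add_def hold nat_add_def)
  qed
  then show ?thesis
    using nat_add_nadd nat_add_unique by metis
qed

lemma add_closed [simp]: "m \<epsilon> omega \<Longrightarrow> n \<epsilon> omega \<Longrightarrow> m \<uplus> n \<epsilon> omega"
  using nat_add_nadd ap_closed unfolding nat_add_def add_def by (metis pair_mem_prod)

lemma add_emp [simp]: "m \<epsilon> omega \<Longrightarrow> m \<uplus> emp = m"
  using nat_add_nadd unfolding nat_add_def add_def by simp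

lemma add_suc [simp]: "m \<epsilon> omega \<Longrightarrow> n \<epsilon> omega \<Longrightarrow> m \<uplus> suc n = suc (m \<uplus> n)"
  using nat_add_nadd unfolding nat_add_def add_def by simp

lemma definable_fun_add [dfn]:
  "definable_fun s \<Longrightarrow> definable_fun t \<Longrightarrow> definable_fun (\<lambda>v. s v \<uplus> t v)"
  unfolding add_def by (intro dfn)

lemma emp_add [simp]:
  assumes "m \<epsilon> omega"
  shows "emp \<uplus> m = m"
  using assms by (rule omega_induct) (intro dfn, simp_all)

lemma suc_add [simp]:
  assumes "m \<epsilon> omega" "n \<epsilon> omega"
  shows "suc m \<uplus> n = suc (m \<uplus> n)"
  using assms(2) by (rule omega_induct) (intro dfn, simp_all add: assms(1))

lemma add_assoc:
  assumes "k \<epsilon> omega" "m \<epsilon> omega" "n \<epsilon> omega"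
  shows "k \<uplus> m \<uplus> n = k \<uplus> (m \<uplus> n)"
  using assms(3) by (rule omega_induct) (intro dfn, simp_all add: assms)

lemma add_commute:
  assumes "m \<epsilon> omega" "n \<epsilon> omega"
  shows "m \<uplus> n = n \<uplus> m"
  using assms(2) by (rule omega_induct) (intro dfn, simp_all add: assms)

lemma add_left_commute:
  "k \<epsilon> omega \<Longrightarrow> m \<epsilon> omega \<Longrightarrow> n \<epsilon> omega \<Longrightarrow> m \<uplus> (k \<uplus> n) = k \<uplus> (m \<uplus> n)"
  using add_assoc add_commute by metis

lemmas add_ac = add_assoc add_commute add_left_commute

lemma add_cancel:
  assumes "m \<epsilon> omega" "n \<epsilon> omega" "k \<epsilon> omega"
  shows "m \<uplus> k = n \<uplus> k \<longleftrightarrow> m = n"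
proof
  have "m \<uplus> k = n \<uplus> k \<longrightarrow> m = n"
    using assms(3) by (rule omega_induct) (intro dfn, use assms suc_inject in auto)
  then show "m \<uplus> k = n \<uplus> k \<Longrightarrow> m = n" ..
qed simp

lemma omega_cases:
  assumes "n \<epsilon> omega"
  shows "n = emp \<or> (\<exists>k. k \<epsilon> omega \<and> n = suc k)"
  using assms by (rule omega_induct) (intro dfn, auto)

text \<open>The order is expressed through differences throughout. In the induction on
  \<open>n\<close>, one unit is moved between the difference and the smaller side, and the roles
  change when the difference is exhausted.\<close>

lemma omega_linear:
  assumes "m \<epsilon> omega" "n \<epsilon> omega"
  shows "\<exists>k. k \<epsilon> omega \<and> (m = n \<uplus> k \<or> n = m \<uplus> k)"
  using assms(2)
proof (rule omega_induct)
  show "definable (\<lambda>v. \<exists>k. k \<epsilon> omega \<and> (m = v 0 \<uplus> k \<or> v 0 = m \<uplus> k))"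
    by (intro dfn)
  show "\<exists>k. k \<epsilon> omega \<and> (m = emp \<uplus> k \<or> emp = m \<uplus> k)"
    using assms(1) by (intro exI[of _ m]) simp
  fix n assume n: "n \<epsilon> omega" "\<exists>k. k \<epsilon> omega \<and> (m = n \<uplus> k \<or> n = m \<uplus> k)"
  then obtain k where k: "k \<epsilon> omega" "m = n \<uplus> k \<or> n = m \<uplus> k"
    by blast
  show "\<exists>k. k \<epsilon> omega \<and> (m = suc n \<uplus> k \<or> suc n = m \<uplus> k)"
  proof (cases "n = m \<uplus> k")
    case True
    then show ?thesis
      using k assms by (intro exI[of _ "suc k"]) simp
  next
    case False
    then have "m = n \<uplus> k"
      using k by simp
    moreover have "k \<noteq> emp"
      using False k n(1) calculation by auto
    then obtain j where "j \<epsilon> omega" "k = suc j"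
      using omega_cases k by blast
    ultimately show ?thesis
      using n(1) by (intro exI[of _ j]) simp
  qed
qed

text \<open>Without a least element, induction on \<open>n\<close> shows that every element
  satisfying \<open>P\<close> is at least \<open>n\<close>: equality with \<open>n\<close> would
  make \<open>n\<close> least. For \<open>n = suc k\<close> this is absurd.\<close>

lemma omega_least:
  assumes "definable (\<lambda>v. P (v 0))" "P k" "k \<epsilon> omega"
  shows "\<exists>n. n \<epsilon> omega \<and> P n \<and> (\<forall>k. k \<epsilon> omega \<longrightarrow> P k \<longrightarrow> (\<exists>d. d \<epsilon> omega \<and> k = n \<uplus> d))"
proof (rule ccontr)
  assume no: "\<not> ?thesis"
  have all: "\<forall>k. k \<epsilon> omega \<longrightarrow> P k \<longrightarrow> (\<exists>d. d \<epsilon> omega \<and> k = n \<uplus> d)" if "n \<epsilon> omega" for n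
    using that
  proof (rule omega_induct)
    show "definable (\<lambda>v. \<forall>k. k \<epsilon> omega \<longrightarrow> P k \<longrightarrow> (\<exists>d. d \<epsilon> omega \<and> k = v 0 \<uplus> d))"
      by (intro dfn definable_subst1[OF assms(1)])
    show "\<forall>k. k \<epsilon> omega \<longrightarrow> P k \<longrightarrow> (\<exists>d. d \<epsilon> omega \<and> k = emp \<uplus> d)"
      by auto
    fix n assume n: "n \<epsilon> omega" "\<forall>k. k \<epsilon> omega \<longrightarrow> P k \<longrightarrow> (\<exists>d. d \<epsilon> omega \<and> k = n \<uplus> d)"
    show "\<forall>k. k \<epsilon> omega \<longrightarrow> P k \<longrightarrow> (\<exists>d. d \<epsilon> omega \<and> k = suc n \<uplus> d)"
    proof (intro allI impI)
      fix k assume k: "k \<epsilon> omega" "P k"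
      then obtain d where d: "d \<epsilon> omega" "k = n \<uplus> d"
        using n by blast
      have "d \<noteq> emp"
      proof
        assume "d = emp"
        then have "k = n"
          using d n(1) by simp
        then show False
          using no n k by blast
      qed
      then obtain j where "j \<epsilon> omega" "d = suc j"
        using omega_cases d by blast
      then show "\<exists>d. d \<epsilon> omega \<and> k = suc n \<uplus> d"
        using d n(1) by (intro exI[of _ j]) simp
    qed
  qed
  obtain d where d: "d \<epsilon> omega" "k = suc k \<uplus> d"
    using all[of "suc k"] assms(2,3) by auto
  then have "emp \<uplus> k = suc d \<uplus> k"
    using assms(3) by (simp add: add_commute)
  then show False
    using d(1) assms(3) add_cancel[of emp "suc d" k] by simp
qed

section \<open>The integers as classes of pairs\<close>

definition cls :: "'u \<Rightarrow> 'u \<Rightarrow> 'u" where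
  "cls a b = collect (\<lambda>p. \<exists>c d. p = pair c d \<and> a \<epsilon> omega \<and> b \<epsilon> omega \<and> c \<epsilon> omega \<and> d \<epsilon> omega \<and>
    a \<uplus> d = c \<uplus> b)"

lemma mem_cls: "p \<epsilon> cls a b \<longleftrightarrow> (\<exists>c d. p = pair c d \<and> a \<epsilon> omega \<and> b \<epsilon> omega \<and> c \<epsilon> omega \<and> d \<epsilon> omega \<and>
    a \<uplus> d = c \<uplus> b)"
  unfolding cls_def
proof (rule mem_collect)
  have "\<exists>u. \<forall>z. z \<epsilon> u \<longleftrightarrow> z \<epsilon> prod omega omega \<and> (\<exists>c d. z = pair c d \<and> a \<epsilon> omega \<and> b \<epsilon> omega \<and>
      c \<epsilon> omega \<and> d \<epsilon> omega \<and> a \<uplus> d = c \<uplus> b)"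
    by (rule separation_definable) (intro dfn)
  then obtain u where "\<forall>z. z \<epsilon> u \<longleftrightarrow> z \<epsilon> prod omega omega \<and> (\<exists>c d. z = pair c d \<and> a \<epsilon> omega \<and>
      b \<epsilon> omega \<and> c \<epsilon> omega \<and> d \<epsilon> omega \<and> a \<uplus> d = c \<uplus> b)"
    by blast
  then show "\<exists>u. \<forall>z. z \<epsilon> u \<longleftrightarrow> (\<exists>c d. z = pair c d \<and> a \<epsilon> omega \<and> b \<epsilon> omega \<and>
      c \<epsilon> omega \<and> d \<epsilon> omega \<and> a \<uplus> d = c \<uplus> b)"
    by (intro exI[of _ u]) auto
qed

lemma definable_fun_cls [dfn]:
  "definable_fun s \<Longrightarrow> definable_fun t \<Longrightarrow> definable_fun (\<lambda>v. cls (s v) (t v))"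
  by (rule definable_fun_comp2[of cls]) (simp_all add: cls_def, intro dfn)

lemma cls_eq_iff:
  assumes "a \<epsilon> omega" "b \<epsilon> omega" "c \<epsilon> omega" "d \<epsilon> omega"
  shows "cls a b = cls c d \<longleftrightarrow> a \<uplus> d = c \<uplus> b"
proof
  assume "cls a b = cls c d"
  moreover have "pair a b \<epsilon> cls a b"
    using assms by (auto simp: mem_cls)
  ultimately have "pair a b \<epsilon> cls c d"
    by simp
  then show "a \<uplus> d = c \<uplus> b"
    by (auto simp: mem_cls)
next
  assume eq: "a \<uplus> d = c \<uplus> b"
  \<comment> \<open>Transitivity of having equal differences, by adding \<open>b'\<close> on both
    sides and cancelling it. Either inclusion between the classes is an instance.\<close>
  have *: "c' \<uplus> f = e \<uplus> d'" if "a' \<uplus> f = e \<uplus> b'" "a' \<uplus> d' = c' \<uplus> b'"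
    "a' \<epsilon> omega" "b' \<epsilon> omega" "c' \<epsilon> omega" "d' \<epsilon> omega" "e \<epsilon> omega" "f \<epsilon> omega" for a' b' c' d' e f
  proof -
    have "c' \<uplus> f \<uplus> b' = (c' \<uplus> b') \<uplus> f"
      using that(3-) by (simp add: add_ac)
    also have "\<dots> = (a' \<uplus> f) \<uplus> d'"
      unfolding that(2)[symmetric] using that(3-) by (simp add: add_ac)
    also have "\<dots> = e \<uplus> d' \<uplus> b'"
      unfolding that(1) using that(3-) by (simp add: add_ac)
    finally show ?thesis
      using add_cancel[of "c' \<uplus> f" "e \<uplus> d'" b'] that by simp
  qed
  show "cls a b = cls c d"
  proof (rule extensionality)
    fix p
    show "p \<epsilon> cls a b \<longleftrightarrow> p \<epsilon> cls c d"
      unfolding mem_cls using assms eq *[of a _ _ b d c] *[of c _ _ d b a] by metis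
  qed
qed

text \<open>Membership in the graph \<open>nadd\<close> forces all arguments into
  \<open>omega\<close>, which is why \<open>cls\<close> carries the corresponding conditions and the
  equivalence holds for arbitrary \<open>a\<close> and \<open>b\<close>.\<close>

lemma hold_is_int_class [hold]:
  assumes "s < d" "a < d" "b < d" "q < d" "\<rho> s = nadd"
  shows "holds w d \<rho> (is_int_class s a b q) \<longleftrightarrow> \<rho> q = cls (\<rho> a) (\<rho> b)"
proof -
  have nadd: "isfun nadd (prod omega omega) omega"
    using nat_add_nadd by (simp add: nat_add_def)
  have "\<rho> q = cls (\<rho> a) (\<rho> b) \<longleftrightarrow> (\<forall>p. p \<epsilon> \<rho> q \<longleftrightarrow> p \<epsilon> cls (\<rho> a) (\<rho> b))"
    using extensionality[of "\<rho> q" "cls (\<rho> a) (\<rho> b)"] by auto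
  moreover have "p \<epsilon> cls (\<rho> a) (\<rho> b) \<longleftrightarrow> (\<exists>c d. p = pair c d \<and>
      (\<exists>k. pair (pair (\<rho> a) d) k \<epsilon> nadd \<and> pair (pair c (\<rho> b)) k \<epsilon> nadd))" for p
    unfolding mem_cls pair_mem_fun[OF nadd] add_def by auto
  ultimately show ?thesis
    using assms by (simp add: is_int_class_def hold)
qed

definition ZC :: 'u where
  "ZC = collect (\<lambda>q. \<exists>a b. a \<epsilon> omega \<and> b \<epsilon> omega \<and> q = cls a b)"

definition ZT :: 'u where
  "ZT = lam (prod ZC ZC) ZC (\<lambda>p. the1 (\<lambda>x. \<exists>a b c d. a \<epsilon> omega \<and> b \<epsilon> omega \<and> c \<epsilon> omega \<and> d \<epsilon> omega \<and>
    p = pair (cls a b) (cls c d) \<and> x = cls (a \<uplus> c) (b \<uplus> d)))"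

definition ZZ :: 'u where
  "ZZ = pair ZC ZT"

lemma mem_ZC: "q \<epsilon> ZC \<longleftrightarrow> (\<exists>a b. a \<epsilon> omega \<and> b \<epsilon> omega \<and> q = cls a b)"
  unfolding ZC_def
proof (rule mem_collect)
  have "\<exists>u. \<forall>z. z \<epsilon> u \<longleftrightarrow> z \<epsilon> pow (prod omega omega) \<and> (\<exists>a b. a \<epsilon> omega \<and> b \<epsilon> omega \<and> z = cls a b)"
    by (rule separation_definable) (intro dfn)
  then obtain u where "\<forall>z. z \<epsilon> u \<longleftrightarrow> z \<epsilon> pow (prod omega omega) \<and>
      (\<exists>a b. a \<epsilon> omega \<and> b \<epsilon> omega \<and> z = cls a b)"
    by blast
  then show "\<exists>u. \<forall>z. z \<epsilon> u \<longleftrightarrow> (\<exists>a b. a \<epsilon> omega \<and> b \<epsilon> omega \<and> z = cls a b)"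
    by (intro exI[of _ u]) (auto simp: mem_cls)
qed

lemma cls_ZC [simp]: "a \<epsilon> omega \<Longrightarrow> b \<epsilon> omega \<Longrightarrow> cls a b \<epsilon> ZC"
  unfolding mem_ZC by blast

text \<open>Sums of two pairs of representatives have equal cross sums, so the description singles
  out one class.\<close>

lemma ZT_value:
  assumes "a \<epsilon> omega" "b \<epsilon> omega" "c \<epsilon> omega" "d \<epsilon> omega"
  shows "the1 (\<lambda>x. \<exists>a' b' c' d'. a' \<epsilon> omega \<and> b' \<epsilon> omega \<and> c' \<epsilon> omega \<and> d' \<epsilon> omega \<and>
    pair (cls a b) (cls c d) = pair (cls a' b') (cls c' d') \<and> x = cls (a' \<uplus> c') (b' \<uplus> d')) =
    cls (a \<uplus> c) (b \<uplus> d)"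
proof (rule the1_equality)
  show "\<exists>a' b' c' d'. a' \<epsilon> omega \<and> b' \<epsilon> omega \<and> c' \<epsilon> omega \<and> d' \<epsilon> omega \<and>
      pair (cls a b) (cls c d) = pair (cls a' b') (cls c' d') \<and>
      cls (a \<uplus> c) (b \<uplus> d) = cls (a' \<uplus> c') (b' \<uplus> d')"
    using assms by blast
next
  fix x
  assume "\<exists>a' b' c' d'. a' \<epsilon> omega \<and> b' \<epsilon> omega \<and> c' \<epsilon> omega \<and> d' \<epsilon> omega \<and>
      pair (cls a b) (cls c d) = pair (cls a' b') (cls c' d') \<and> x = cls (a' \<uplus> c') (b' \<uplus> d')"
  then obtain a' b' c' d' where *: "a' \<epsilon> omega" "b' \<epsilon> omega" "c' \<epsilon> omega" "d' \<epsilon> omega"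
    "a \<uplus> b' = a' \<uplus> b" "c \<uplus> d' = c' \<uplus> d" and x: "x = cls (a' \<uplus> c') (b' \<uplus> d')"
    using assms by (auto simp: cls_eq_iff)
  have "(a' \<uplus> c') \<uplus> (b \<uplus> d) = (a' \<uplus> b) \<uplus> (c' \<uplus> d)"
    using *(1-4) assms by (simp add: add_ac)
  also have "\<dots> = (a \<uplus> c) \<uplus> (b' \<uplus> d')"
    unfolding *(5,6)[symmetric] using *(1-4) assms by (simp add: add_ac)
  finally show "x = cls (a \<uplus> c) (b \<uplus> d)"
    unfolding x using * assms by (simp add: cls_eq_iff)
qed

lemma definable_ZT: "definable_fun (\<lambda>v. the1 (\<lambda>x. \<exists>a b c d. a \<epsilon> omega \<and> b \<epsilon> omega \<and> c \<epsilon> omega \<and>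
    d \<epsilon> omega \<and> v 0 = pair (cls a b) (cls c d) \<and> x = cls (a \<uplus> c) (b \<uplus> d)))"
  by (intro dfn)

lemma ZT_closed:
  assumes "p \<epsilon> prod ZC ZC"
  shows "the1 (\<lambda>x. \<exists>a b c d. a \<epsilon> omega \<and> b \<epsilon> omega \<and> c \<epsilon> omega \<and>
    d \<epsilon> omega \<and> p = pair (cls a b) (cls c d) \<and> x = cls (a \<uplus> c) (b \<uplus> d)) \<epsilon> ZC"
proof -
  obtain a b c d where "a \<epsilon> omega" "b \<epsilon> omega" "c \<epsilon> omega" "d \<epsilon> omega" "p = pair (cls a b) (cls c d)"
    using assms unfolding mem_prod mem_ZC by blast
  then show ?thesis
    using ZT_value[of a b c d] by simp
qed

lemma isfun_ZT: "isfun ZT (prod ZC ZC) ZC"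
  unfolding ZT_def by (rule isfun_lam[OF definable_ZT ZT_closed])

lemma ap_ZT:
  assumes "a \<epsilon> omega" "b \<epsilon> omega" "c \<epsilon> omega" "d \<epsilon> omega"
  shows "ap ZT (pair (cls a b) (cls c d)) = cls (a \<uplus> c) (b \<uplus> d)"
proof -
  have "pair (cls a b) (cls c d) \<epsilon> prod ZC ZC"
    using assms by simp
  then show ?thesis
    unfolding ZT_def using ap_lam[OF definable_ZT ZT_closed] ZT_value[OF assms] by simp
qed

lemma car_ZZ [simp]: "car ZZ = ZC"
  by (simp add: ZZ_def)

lemma pl_ZZ:
  "a \<epsilon> omega \<Longrightarrow> b \<epsilon> omega \<Longrightarrow> c \<epsilon> omega \<Longrightarrow> d \<epsilon> omega \<Longrightarrow>
    pl ZZ (cls a b) (cls c d) = cls (a \<uplus> c) (b \<uplus> d)"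
  by (simp add: pl_def ZZ_def ap_ZT)

lemma Ab_ZZ: "Ab ZZ" and zer_ZZ: "zer ZZ = cls emp emp"
proof -
  have 1: "ap ZT (pair (ap ZT (pair x y)) z) = ap ZT (pair x (ap ZT (pair y z)))"
    if "x \<epsilon> ZC" "y \<epsilon> ZC" "z \<epsilon> ZC" for x y z
    using that unfolding mem_ZC by (auto simp: ap_ZT add_assoc)
  have 2: "ap ZT (pair x y) = ap ZT (pair y x)" if "x \<epsilon> ZC" "y \<epsilon> ZC" for x y
    using that unfolding mem_ZC by (auto simp: ap_ZT add_commute)
  have 3: "ap ZT (pair (cls emp emp) x) = x" if "x \<epsilon> ZC" for x
    using that unfolding mem_ZC by (auto simp: ap_ZT)
  have 4: "\<exists>y. y \<epsilon> ZC \<and> ap ZT (pair x y) = cls emp emp" if x: "x \<epsilon> ZC" for x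
  proof -
    obtain a b where "a \<epsilon> omega" "b \<epsilon> omega" "x = cls a b"
      using x unfolding mem_ZC by blast
    then show ?thesis
      by (intro exI[of _ "cls b a"]) (simp add: ap_ZT cls_eq_iff add_commute)
  qed
  note I = AbI[OF isfun_ZT 1 2 _ 3 4]
  show "Ab ZZ" "zer ZZ = cls emp emp"
    unfolding ZZ_def by (rule I; simp)+
qed

text \<open>Each ingredient of \<open>is_int\<close> is unique: \<open>omega\<close>, its addition,
  the set of classes, and the operation, whose values on representatives are prescribed. Quantifying
  over all such \<open>Z\<close> therefore means speaking about one set.\<close>

lemma hold_is_int [hold]:
  assumes "Z < d"
  shows "holds w d \<rho> (is_int Z) \<longleftrightarrow> \<rho> Z = ZZ"
proof -
  have nadd: "isfun nadd (prod omega omega) omega"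
    using nat_add_nadd by (simp add: nat_add_def)
  have C: "(\<forall>q. q \<epsilon> C \<longleftrightarrow> (\<exists>a. a \<epsilon> omega \<and> (\<exists>b. b \<epsilon> omega \<and> q = cls a b))) \<longleftrightarrow> C = ZC" for C
    using extensionality[of C ZC] mem_ZC by auto
  have t: "isfun t (prod ZC ZC) ZC \<and> (\<forall>a b c d i j. pair (pair a c) i \<epsilon> nadd \<and> pair (pair b d) j \<epsilon> nadd \<longrightarrow>
      pair (pair (cls a b) (cls c d)) (cls i j) \<epsilon> t) \<longleftrightarrow> t = ZT" (is "?l t \<longleftrightarrow> _") for t
  proof
    assume l: "?l t"
    then have fn: "isfun t (prod ZC ZC) ZC" ..
    show "t = ZT"
    proof (rule fun_eqI[OF fn isfun_ZT])
      fix p assume "p \<epsilon> prod ZC ZC"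
      then obtain a b c d where *: "a \<epsilon> omega" "b \<epsilon> omega" "c \<epsilon> omega" "d \<epsilon> omega"
        and p: "p = pair (cls a b) (cls c d)"
        unfolding mem_prod mem_ZC by blast
      have "pair (pair (cls a b) (cls c d)) (cls (a \<uplus> c) (b \<uplus> d)) \<epsilon> t"
        using conjunct2[OF l, rule_format, of a c "a \<uplus> c" b d "b \<uplus> d"] *
        by (simp add: pair_mem_fun[OF nadd] add_def)
      then show "ap t p = ap ZT p"
        unfolding p using * by (simp add: pair_mem_fun[OF fn] ap_ZT)
    qed
  next
    assume "t = ZT"
    then show "?l t"
      using isfun_ZT by (auto simp: pair_mem_fun[OF nadd] pair_mem_fun[OF isfun_ZT] ap_ZT add_def[symmetric])
  qed
  have "holds w d \<rho> (is_int Z) \<longleftrightarrow> (\<exists>C t. \<rho> Z = pair C t \<and> C = ZC \<and> isfun t (prod C C) C \<and>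
      (\<forall>a b c d i j. pair (pair a c) i \<epsilon> nadd \<and> pair (pair b d) j \<epsilon> nadd \<longrightarrow>
        pair (pair (cls a b) (cls c d)) (cls i j) \<epsilon> t))"
    using assms by (simp add: is_int_def hold C)
  also have "\<dots> \<longleftrightarrow> (\<exists>C t. \<rho> Z = pair C t \<and> C = ZC \<and> t = ZT)"
    using t by metis
  also have "\<dots> \<longleftrightarrow> \<rho> Z = ZZ"
    by (simp add: ZZ_def)
  finally show ?thesis .
qed

section \<open>Free objects on one generator\<close>

text \<open>The universal property of the integers with generator \<open>x\<close>. It makes
  evaluation at \<open>x\<close> a bijection between homomorphisms out of \<open>X\<close> and
  elements, by which elements become accessible to diagrams.\<close>

definition free_on :: "'u \<Rightarrow> 'u \<Rightarrow> bool" where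
  "free_on X x \<longleftrightarrow> Ab X \<and> x \<epsilon> car X \<and>
    (\<forall>Y y. Ab Y \<longrightarrow> y \<epsilon> car Y \<longrightarrow> (\<exists>f. ishom f X Y \<and> ap f x = y)) \<and>
    (\<forall>Y f g. Ab Y \<longrightarrow> ishom f X Y \<longrightarrow> ishom g X Y \<longrightarrow> ap f x = ap g x \<longrightarrow> f = g)"

definition iota :: "'u \<Rightarrow> 'u" where
  "iota n = cls n emp"

definition unit :: 'u where
  "unit = iota (suc emp)"

lemma iota_ZC [simp]: "n \<epsilon> omega \<Longrightarrow> iota n \<epsilon> ZC"
  by (simp add: iota_def)

lemma unit_ZC [simp]: "unit \<epsilon> ZC"
  by (simp add: unit_def)

lemma iota_emp: "iota emp = zer ZZ"
  by (simp add: iota_def zer_ZZ)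

lemma iota_add: "m \<epsilon> omega \<Longrightarrow> n \<epsilon> omega \<Longrightarrow> iota (m \<uplus> n) = pl ZZ (iota m) (iota n)"
  by (simp add: iota_def pl_ZZ)

lemma iota_suc: "n \<epsilon> omega \<Longrightarrow> iota (suc n) = pl ZZ (iota n) unit"
  using iota_add[of n "suc emp"] by (simp add: unit_def)

lemma iota_eq_iff: "m \<epsilon> omega \<Longrightarrow> n \<epsilon> omega \<Longrightarrow> iota m = iota n \<longleftrightarrow> m = n"
  by (simp add: iota_def cls_eq_iff)

lemma definable_fun_iota [dfn]: "definable_fun s \<Longrightarrow> definable_fun (\<lambda>v. iota (s v))"
  unfolding iota_def by (intro dfn)

lemma cls_iota: "a \<epsilon> omega \<Longrightarrow> b \<epsilon> omega \<Longrightarrow> pl ZZ (cls a b) (iota b) = iota a"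
  by (simp add: iota_def pl_ZZ cls_eq_iff)

text \<open>No negation is introduced for integers: a negative one is described by the natural
  number that cancels it. The two cases overlap at zero.\<close>

lemma ZC_cases:
  assumes "z \<epsilon> ZC"
  obtains k where "k \<epsilon> omega" "z = iota k" | k where "k \<epsilon> omega" "pl ZZ z (iota k) = zer ZZ"
proof -
  obtain a b where ab: "a \<epsilon> omega" "b \<epsilon> omega" and z: "z = cls a b"
    using assms unfolding mem_ZC by blast
  obtain k where k: "k \<epsilon> omega" "a = b \<uplus> k \<or> b = a \<uplus> k"
    using omega_linear[OF ab] by blast
  from k(2) show thesis
  proof
    assume "a = b \<uplus> k"
    then have "z = iota k"
      unfolding z iota_def using ab k(1) by (simp add: cls_eq_iff add_commute)
    then show thesis
      using that(1) k(1) by blast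
  next
    assume "b = a \<uplus> k"
    then have "pl ZZ z (iota k) = zer ZZ"
      unfolding z iota_def zer_ZZ using ab k(1) by (simp add: pl_ZZ cls_eq_iff)
    then show thesis
      using that(2) k(1) by blast
  qed
qed

text \<open>Adding \<open>y\<close> to itself along a possibly nonstandard \<open>omega\<close> must
  happen inside the model, so the multiples come from \<open>recursion\<close> over all elements of
  \<open>Y\<close> as parameters, specialised to \<open>y\<close> afterwards.\<close>

lemma multiples_exist:
  assumes "Ab Y" "y \<epsilon> car Y"
  shows "\<exists>m. (\<forall>n. n \<epsilon> omega \<longrightarrow> ap m n \<epsilon> car Y) \<and> ap m emp = zer Y \<and>
    (\<forall>n. n \<epsilon> omega \<longrightarrow> ap m (suc n) = pl Y y (ap m n))"
proof -
  note Y = Ab_struct[OF assms(1)]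
  have "definable_fun (\<lambda>v. zer Y)" "definable_fun (\<lambda>v. pl Y (v 0) (v (Suc 0)))"
    by (intro dfn)+
  from recursion[of "\<lambda>_. zer Y" "car Y" "car Y" "pl Y", OF this(1) _ this(2)]
  obtain f where f: "isfun f (prod (car Y) omega) (car Y)"
    "\<And>p. p \<epsilon> car Y \<Longrightarrow> ap f (pair p emp) = zer Y"
    "\<And>p n. p \<epsilon> car Y \<Longrightarrow> n \<epsilon> omega \<Longrightarrow> ap f (pair p (suc n)) = pl Y p (ap f (pair p n))"
    using Y(1,4) by auto
  have d: "definable_fun (\<lambda>v. ap f (pair y (v 0)))"
    by (intro dfn)
  have c: "ap f (pair y n) \<epsilon> car Y" if "n \<epsilon> omega" for n
    using ap_closed[OF f(1)] assms(2) that by simp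
  have "ap (lam omega (car Y) (\<lambda>n. ap f (pair y n))) n = ap f (pair y n)" if "n \<epsilon> omega" for n
    by (rule ap_lam[OF d c that])
  then show ?thesis
    using f(2,3)[OF assms(2)] c by (intro exI[of _ "lam omega (car Y) (\<lambda>n. ap f (pair y n))"]) simp
qed

lemma pl_left_commute:
  assumes "Ab Y" "a \<epsilon> car Y" "b \<epsilon> car Y" "c \<epsilon> car Y"
  shows "pl Y a (pl Y b c) = pl Y b (pl Y a c)"
  using Ab_struct(2,3)[OF assms(1)] assms by metis

lemmas pl_ac = Ab_struct(2,3) pl_left_commute

text \<open>The class of \<open>(a, b)\<close> has to go to the solution \<open>v\<close> of
  \<open>v + b y = a y\<close>. The relation \<open>rel\<close> records this equation for some
  representative, \<open>rel_cls\<close> shows that any representative gives the same condition, and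
  cancellation makes the solution unique.\<close>

lemma ZZ_hom_exists:
  assumes "Ab Y" "y \<epsilon> car Y"
  shows "\<exists>f. ishom f ZZ Y \<and> ap f unit = y"
proof -
  note Y = Ab_struct[OF assms(1)] and ac = pl_ac[OF assms(1)]
  obtain m where mc: "\<And>n. n \<epsilon> omega \<Longrightarrow> ap m n \<epsilon> car Y" and m0: "ap m emp = zer Y"
    and ms: "\<And>n. n \<epsilon> omega \<Longrightarrow> ap m (suc n) = pl Y y (ap m n)"
    using multiples_exist[OF assms] by blast
  have ma: "ap m (a \<uplus> b) = pl Y (ap m a) (ap m b)" if "a \<epsilon> omega" "b \<epsilon> omega" for a b
    using that(2)
  proof (rule omega_induct)
    show "definable (\<lambda>v. ap m (a \<uplus> v 0) = pl Y (ap m a) (ap m (v 0)))"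
      by (intro dfn)
    show "ap m (a \<uplus> emp) = pl Y (ap m a) (ap m emp)"
      using that(1) by (simp add: m0 Y(6) mc)
    show "ap m (a \<uplus> suc n) = pl Y (ap m a) (ap m (suc n))"
      if "n \<epsilon> omega" "ap m (a \<uplus> n) = pl Y (ap m a) (ap m n)" for n
      using that \<open>a \<epsilon> omega\<close> assms(2) by (simp add: ms mc ac)
  qed
  define rel where "rel z v \<longleftrightarrow> v \<epsilon> car Y \<and>
    (\<exists>a b. a \<epsilon> omega \<and> b \<epsilon> omega \<and> z = cls a b \<and> pl Y v (ap m b) = ap m a)" for z v
  have rel_cls: "rel (cls a b) v \<longleftrightarrow> v \<epsilon> car Y \<and> pl Y v (ap m b) = ap m a"
    if ab: "a \<epsilon> omega" "b \<epsilon> omega" for a b v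
  proof
    assume "rel (cls a b) v"
    then obtain c d where v: "v \<epsilon> car Y" and cd: "c \<epsilon> omega" "d \<epsilon> omega" "a \<uplus> d = c \<uplus> b"
      and eq: "pl Y v (ap m d) = ap m c"
      using ab unfolding rel_def by (auto simp: cls_eq_iff)
    have "pl Y (pl Y v (ap m b)) (ap m d) = pl Y (pl Y v (ap m d)) (ap m b)"
      using v mc ab cd by (simp add: ac)
    also have "\<dots> = pl Y (ap m a) (ap m d)"
      unfolding eq using ma[of c b] ma[of a d] ab cd by simp
    finally show "v \<epsilon> car Y \<and> pl Y v (ap m b) = ap m a"
      using pl_cancel_right[OF assms(1)] v mc ab cd Y(1) by simp
  qed (use ab in \<open>auto simp: rel_def\<close>)
  have ex: "\<exists>v. rel (cls a b) v" if ab: "a \<epsilon> omega" "b \<epsilon> omega" for a b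
  proof -
    obtain u where "u \<epsilon> car Y" "pl Y (ap m b) u = zer Y"
      using Y(7)[OF mc[OF ab(2)]] by blast
    then have "pl Y (pl Y (ap m a) u) (ap m b) = ap m a"
      using Y mc ab by metis
    then show ?thesis
      unfolding rel_cls[OF ab] using Y(1) mc[OF ab(1)] \<open>u \<epsilon> car Y\<close> by blast
  qed
  have unique: "v = w" if v: "rel z v" and w: "rel z w" for z v w
  proof -
    obtain a b where ab: "a \<epsilon> omega" "b \<epsilon> omega" "z = cls a b"
      using v unfolding rel_def by blast
    then have "v \<epsilon> car Y" "w \<epsilon> car Y" "pl Y v (ap m b) = pl Y w (ap m b)"
      using v w rel_cls by simp_all
    then show ?thesis
      using pl_cancel_right[OF assms(1)] mc ab by blast
  qed
  \<comment> \<open>Choosing the value with \<open>the1\<close> keeps the operation definable, as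
    \<open>hom_exists\<close> requires.\<close>
  define t where "t z = the1 (rel z)" for z
  have t: "t z = v" if "rel z v" for z v
    unfolding t_def using that by (rule the1_equality) (rule unique[OF _ that])
  have t_rel: "rel z (t z)" if "z \<epsilon> ZC" for z
    using that ex t unfolding mem_ZC by metis
  have "definable_fun (\<lambda>v. t (v 0))"
    unfolding t_def rel_def by (intro dfn)
  then have "\<exists>f. ishom f ZZ Y \<and> (\<forall>x. x \<epsilon> car ZZ \<longrightarrow> ap f x = t x)"
  proof (rule hom_exists[OF _ Ab_ZZ])
    show "t x \<epsilon> car Y" if "x \<epsilon> car ZZ" for x
      using t_rel[of x] that unfolding rel_def by simp
    fix x x' assume x: "x \<epsilon> car ZZ" "x' \<epsilon> car ZZ"
    then obtain a b a' b' where ab: "a \<epsilon> omega" "b \<epsilon> omega" "a' \<epsilon> omega" "b' \<epsilon> omega"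
      and x: "x = cls a b" "x' = cls a' b'"
      using mem_ZC by auto
    have v: "t x \<epsilon> car Y" "t x' \<epsilon> car Y" "pl Y (t x) (ap m b) = ap m a" "pl Y (t x') (ap m b') = ap m a'"
      using t_rel[of x] t_rel[of x'] ab unfolding x by (simp_all add: rel_cls)
    have "pl Y (pl Y (t x) (t x')) (ap m (b \<uplus> b')) =
        pl Y (pl Y (t x) (ap m b)) (pl Y (t x') (ap m b'))"
      using v(1,2) ab mc Y(1) by (simp add: ma ac)
    also have "\<dots> = ap m (a \<uplus> a')"
      unfolding v(3,4) using ab by (simp add: ma)
    finally have "rel (pl ZZ x x') (pl Y (t x) (t x'))"
      unfolding x using ab v(1,2) Y(1) by (simp add: pl_ZZ rel_cls x)
    then show "t (pl ZZ x x') = pl Y (t x) (t x')"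
      by (rule t)
  qed
  then obtain f where f: "ishom f ZZ Y" "\<And>x. x \<epsilon> car ZZ \<Longrightarrow> ap f x = t x"
    by blast
  have "rel unit y"
    unfolding unit_def iota_def using assms(2) by (simp add: rel_cls m0 ms)
  then have "ap f unit = y"
    using f(2) t by simp
  then show ?thesis
    using f(1) by blast
qed

text \<open>Agreement at \<open>unit\<close> spreads to the natural numbers by induction, and to the
  class of \<open>(a, b)\<close> because adding \<open>b\<close> to it gives
  \<open>a\<close>.\<close>

lemma ZZ_hom_unique:
  assumes "Ab Y" "ishom f ZZ Y" "ishom g ZZ Y" "ap f unit = ap g unit"
  shows "f = g"
proof (rule ishom_eqI[OF assms(2,3)])
  note f = ishomD[OF assms(2)] and g = ishomD[OF assms(3)]
  have *: "ap f (iota n) = ap g (iota n)" if "n \<epsilon> omega" for n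
    using that
  proof (rule omega_induct)
    show "definable (\<lambda>v. ap f (iota (v 0)) = ap g (iota (v 0)))"
      by (intro dfn)
    show "ap f (iota emp) = ap g (iota emp)"
      using ishom_zer Ab_ZZ assms by (simp add: iota_emp)
    show "ap f (iota (suc n)) = ap g (iota (suc n))" if "n \<epsilon> omega" "ap f (iota n) = ap g (iota n)" for n
      using that assms(4) f(2) g(2) by (simp add: iota_suc)
  qed
  fix x assume "x \<epsilon> car ZZ"
  then obtain a b where ab: "a \<epsilon> omega" "b \<epsilon> omega" "x = cls a b"
    using mem_ZC by auto
  have "pl Y (ap f x) (ap f (iota b)) = ap f (iota a)"
    using f(2)[of x "iota b"] ab by (simp add: cls_iota)
  moreover have "pl Y (ap g x) (ap g (iota b)) = ap g (iota a)"
    using g(2)[of x "iota b"] ab by (simp add: cls_iota)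
  ultimately show "ap f x = ap g x"
    using * ab pl_cancel_right[OF assms(1)] f(1) g(1) by (metis car_ZZ cls_ZC iota_ZC)
qed

lemma free_on_ZZ: "free_on ZZ unit"
  unfolding free_on_def using Ab_ZZ ZZ_hom_exists ZZ_hom_unique by simp

section \<open>Generators, retracts and endomorphisms of the integers\<close>

definition generator :: "'u \<Rightarrow> bool" where
  "generator G \<longleftrightarrow> (\<forall>Y W f g. Ab Y \<longrightarrow> Ab W \<longrightarrow> ishom f Y W \<longrightarrow> ishom g Y W \<longrightarrow> f \<noteq> g \<longrightarrow>
    (\<exists>h. ishom h G Y \<and> (\<exists>x. x \<epsilon> car G \<and> ap f (ap h x) \<noteq> ap g (ap h x))))"

definition retract :: "'u \<Rightarrow> 'u \<Rightarrow> bool" where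
  "retract X G \<longleftrightarrow> (\<exists>i r. ishom i X G \<and> ishom r G X \<and> (\<forall>x. x \<epsilon> car X \<longrightarrow> ap r (ap i x) = x))"

text \<open>Two different homomorphisms differ at some element, and that element is the value at
  \<open>x\<close> of a homomorphism from \<open>X\<close>.\<close>

lemma free_on_generator:
  assumes "free_on X x"
  shows "generator X"
  unfolding generator_def
proof (intro allI impI)
  fix Y W f g assume Y: "Ab Y" "Ab W" and fg: "ishom f Y W" "ishom g Y W" "f \<noteq> g"
  then obtain y where y: "y \<epsilon> car Y" "ap f y \<noteq> ap g y"
    using ishom_eqI by blast
  then obtain h where "ishom h X Y" "ap h x = y"
    using assms Y unfolding free_on_def by blast
  then show "\<exists>h. ishom h X Y \<and> (\<exists>x. x \<epsilon> car X \<and> ap f (ap h x) \<noteq> ap g (ap h x))"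
    using y assms unfolding free_on_def by blast
qed

text \<open>An integer in the kernel is a natural number or is cancelled by one, and the latter then
  lies in the kernel as well.\<close>

lemma ZZ_kernel_trivial:
  assumes "ishom m ZZ ZZ" "\<And>k. k \<epsilon> omega \<Longrightarrow> ap m (iota k) = zer ZZ \<Longrightarrow> k = emp"
    and "z \<epsilon> ZC" "ap m z = zer ZZ"
  shows "z = zer ZZ"
  using assms(3)
proof (cases rule: ZC_cases)
  case (1 k)
  then show ?thesis
    using assms(2,4) iota_emp by auto
next
  case (2 k)
  note Z = Ab_struct[OF Ab_ZZ] and m = ishomD[OF assms(1)]
  have "pl ZZ (ap m z) (ap m (iota k)) = zer ZZ"
    using m(2)[of z "iota k"] 2 assms(3) ishom_zer[OF assms(1) Ab_ZZ Ab_ZZ] by simp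
  then have "ap m (iota k) = zer ZZ"
    using assms(4) Z(5) m(1) 2(1) by simp
  then have "iota k = zer ZZ"
    using assms(2) 2(1) iota_emp by blast
  then show ?thesis
    using 2(2) Z(6) assms(3) by simp
qed

text \<open>Multiplication by a positive \<open>n\<close> takes natural numbers to natural numbers
  and does not annihilate the nonzero ones.\<close>

lemma multiple_of_iota:
  assumes "ishom m ZZ ZZ" "n \<epsilon> omega" "n \<noteq> emp" "ap m unit = iota n" "k \<epsilon> omega"
    and "ap m (iota k) = zer ZZ"
  shows "k = emp"
proof -
  note m = ishomD[OF assms(1)]
  \<comment> \<open>The induction also records that the image is a natural number \<open>j\<close>:
    adding a positive number to a natural number gives a nonzero one, which would fail for
    integers.\<close>
  have "\<exists>j. j \<epsilon> omega \<and> ap m (iota k) = iota j \<and> (k = emp \<or> j \<noteq> emp)"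
    using assms(5)
  proof (rule omega_induct)
    show "definable (\<lambda>v. \<exists>j. j \<epsilon> omega \<and> ap m (iota (v 0)) = iota j \<and> (v 0 = emp \<or> j \<noteq> emp))"
      by (intro dfn)
    show "\<exists>j. j \<epsilon> omega \<and> ap m (iota emp) = iota j \<and> (emp = emp \<or> j \<noteq> emp)"
      using ishom_zer[OF assms(1) Ab_ZZ Ab_ZZ] by (intro exI[of _ emp]) (simp add: iota_emp)
    fix k assume k: "k \<epsilon> omega" "\<exists>j. j \<epsilon> omega \<and> ap m (iota k) = iota j \<and> (k = emp \<or> j \<noteq> emp)"
    then obtain j where j: "j \<epsilon> omega" "ap m (iota k) = iota j"
      by blast
    obtain n' where n': "n' \<epsilon> omega" "n = suc n'"
      using omega_cases assms(2,3) by blast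
    have "ap m (iota (suc k)) = iota (j \<uplus> n)"
      using k(1) j assms(2,4) by (simp add: iota_suc m(2) iota_add)
    then show "\<exists>j. j \<epsilon> omega \<and> ap m (iota (suc k)) = iota j \<and> (suc k = emp \<or> j \<noteq> emp)"
      using j(1) n' by (intro exI[of _ "j \<uplus> n"]) simp
  qed
  then show ?thesis
    using assms(6) iota_eq_iff[of _ emp] emp_omega iota_emp by metis
qed

lemma ishom_injI:
  assumes "ishom f A B" "Ab A" "Ab B" "\<And>x. x \<epsilon> car A \<Longrightarrow> ap f x = zer B \<Longrightarrow> x = zer A"
    and "x \<epsilon> car A" "y \<epsilon> car A" "ap f x = ap f y"
  shows "x = y"
proof -
  note A = Ab_struct[OF assms(2)] and f = ishomD[OF assms(1)]
  obtain w where w: "w \<epsilon> car A" "pl A y w = zer A"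
    using A(7)[OF assms(6)] by blast
  have "ap f (pl A x w) = ap f (pl A y w)"
    using f(2) assms(5-7) w(1) by simp
  then have "ap f (pl A x w) = zer B"
    using w ishom_zer[OF assms(1-3)] by simp
  then have "pl A x w = pl A y w"
    using assms(4)[of "pl A x w"] A(1) w assms(5) by simp
  then show ?thesis
    using pl_cancel_right[OF assms(2)] w assms(5,6) by blast
qed

text \<open>For a positive value at \<open>unit\<close> this is \<open>multiple_of_iota\<close>. For
  a negative one, the endomorphism is compared with multiplication by the natural number
  \<open>n\<close> that cancels the value.\<close>

lemma ZZ_endo_inj:
  assumes m: "ishom m ZZ ZZ" and nz: "ap m unit \<noteq> zer ZZ"
    and x: "x \<epsilon> ZC" "y \<epsilon> ZC" "ap m x = ap m y"
  shows "x = y"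
proof (rule ishom_injI[OF m Ab_ZZ Ab_ZZ])
  note Z = Ab_struct[OF Ab_ZZ]
  fix z assume z: "z \<epsilon> car ZZ" "ap m z = zer ZZ"
  have c: "ap m unit \<epsilon> ZC"
    using ishomD(1)[OF m, of unit] by simp
  then show "z = zer ZZ"
  proof (cases rule: ZC_cases)
    case (1 n)
    then have "n \<noteq> emp"
      using nz iota_emp by auto
    show ?thesis
      by (rule ZZ_kernel_trivial[OF m multiple_of_iota[OF m 1(1) \<open>n \<noteq> emp\<close> 1(2)]]) (use z in simp_all)
  next
    case (2 n)
    have "n \<noteq> emp"
    proof
      assume "n = emp"
      then show False
        using 2(2) nz c Z(6) by (simp add: iota_emp)
    qed
    obtain k where k: "ishom k ZZ ZZ" "ap k unit = iota n"
      using ZZ_hom_exists[OF Ab_ZZ, of "iota n"] 2(1) by auto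
    note m' = ishomD[OF m] and k' = ishomD[OF k(1)]
    \<comment> \<open>The pointwise sum of \<open>m\<close> and \<open>k\<close> vanishes at
      \<open>unit\<close>, hence everywhere by uniqueness; therefore anything annihilated by
      \<open>m\<close> is annihilated by \<open>k\<close>.\<close>
    have "definable_fun (\<lambda>v. pl ZZ (ap m (v 0)) (ap k (v 0)))"
      by (intro dfn)
    then have "\<exists>s. ishom s ZZ ZZ \<and> (\<forall>x. x \<epsilon> car ZZ \<longrightarrow> ap s x = pl ZZ (ap m x) (ap k x))"
    proof (rule hom_exists[OF _ Ab_ZZ])
      show "pl ZZ (ap m x) (ap k x) \<epsilon> car ZZ" if "x \<epsilon> car ZZ" for x
        using Z(1) m'(1) k'(1) that by blast
      show "pl ZZ (ap m (pl ZZ x y)) (ap k (pl ZZ x y)) =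
          pl ZZ (pl ZZ (ap m x) (ap k x)) (pl ZZ (ap m y) (ap k y))" if "x \<epsilon> car ZZ" "y \<epsilon> car ZZ" for x y
        using that m'(1)[OF that(1)] m'(1)[OF that(2)] k'(1)[OF that(1)] k'(1)[OF that(2)] Z(1)
        by (simp add: m'(2) k'(2) pl_ac[OF Ab_ZZ])
    qed
    then obtain s where s: "ishom s ZZ ZZ" "\<And>x. x \<epsilon> car ZZ \<Longrightarrow> ap s x = pl ZZ (ap m x) (ap k x)"
      by blast
    obtain o' where o: "ishom o' ZZ ZZ" "\<And>x. x \<epsilon> car ZZ \<Longrightarrow> ap o' x = zer ZZ"
      using zero_hom[OF Ab_ZZ Ab_ZZ] by blast
    have "s = o'"
      by (rule ZZ_hom_unique[OF Ab_ZZ s(1) o(1)]) (use s(2) o(2) k(2) 2(2) in simp)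
    then have "pl ZZ (ap m z) (ap k z) = zer ZZ"
      using s(2) o(2) z by metis
    then have kz: "ap k z = zer ZZ"
      using z Z(5) k'(1) by simp
    show ?thesis
      by (rule ZZ_kernel_trivial[OF k(1) multiple_of_iota[OF k(1) 2(1) \<open>n \<noteq> emp\<close> k(2)]])
        (use z kz in simp_all)
  qed
qed (use x in simp_all)

text \<open>A homomorphism to the integers with nonzero image can be divided by the least positive element
  of its image.\<close>

lemma retract_ZZ:
  assumes G: "Ab G" and h: "ishom h G ZZ" and "g \<epsilon> car G" "ap h g \<noteq> zer ZZ"
  shows "retract ZZ G"
proof -
  note Z = Ab_struct[OF Ab_ZZ] and GG = Ab_struct[OF G] and h' = ishomD[OF h]
  \<comment> \<open>The positive values of \<open>h\<close>; the divisor will be the least of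
    them.\<close>
  define P where "P n \<longleftrightarrow> n \<noteq> emp \<and> (\<exists>g. g \<epsilon> car G \<and> ap h g = iota n)" for n
  have P: "definable (\<lambda>v. P (v 0))"
    unfolding P_def by (intro dfn)
  \<comment> \<open>Sign change inside the image. It produces a positive value from a negative one
    here and reduces negative values to positive ones later.\<close>
  have neg: "\<exists>g'. g' \<epsilon> car G \<and> pl G g g' = zer G \<and> ap h g' = iota k"
    if g: "g \<epsilon> car G" and k: "k \<epsilon> omega" "pl ZZ (ap h g) (iota k) = zer ZZ" for g k
  proof -
    obtain g' where g': "g' \<epsilon> car G" "pl G g g' = zer G"
      using GG(7) g by blast
    then have "pl ZZ (ap h g) (ap h g') = pl ZZ (ap h g) (iota k)"
      using h'(2)[OF g g'(1)] ishom_zer[OF h G Ab_ZZ] k(2) by simp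
    then have "ap h g' = iota k"
      using pl_cancel[OF Ab_ZZ, of "ap h g" "ap h g'" "iota k"] h'(1) g k(1) g'(1) by simp
    then show ?thesis
      using g' by blast
  qed
  have "\<exists>k. k \<epsilon> omega \<and> P k"
  proof -
    have "ap h g \<epsilon> ZC"
      using h'(1)[OF assms(3)] by simp
    then show ?thesis
    proof (cases rule: ZC_cases)
      case (1 k)
      then show ?thesis
        using assms(3,4) iota_emp unfolding P_def by metis
    next
      case (2 k)
      moreover have "k \<noteq> emp"
      proof
        assume "k = emp"
        then show False
          using 2(2) Z(6) h'(1)[OF assms(3)] assms(4) by (simp add: iota_emp)
      qed
      ultimately show ?thesis
        using neg[OF assms(3)] unfolding P_def by blast
    qed
  qed
  then obtain n where n: "n \<epsilon> omega" "P n"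
    and least: "\<And>k. k \<epsilon> omega \<Longrightarrow> P k \<Longrightarrow> \<exists>d. d \<epsilon> omega \<and> k = n \<uplus> d"
    using omega_least[OF P] by blast
  obtain g0 where g0: "g0 \<epsilon> car G" "ap h g0 = iota n"
    using n(2) unfolding P_def by blast
  obtain u where u: "ishom u ZZ G" "ap u unit = g0"
    using ZZ_hom_exists[OF G g0(1)] by blast
  note u' = ishomD[OF u(1)]
  \<comment> \<open>Since \<open>u\<close> takes \<open>unit\<close> to \<open>g0\<close> and
    \<open>h\<close> takes \<open>g0\<close> to \<open>n\<close>, this endomorphism is
    multiplication by \<open>n\<close>.\<close>
  define m where "m = comp h u"
  have m: "ishom m ZZ ZZ" and mv: "\<And>z. z \<epsilon> ZC \<Longrightarrow> ap m z = ap h (ap u z)"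
    unfolding m_def using comp_props(1,2)[OF u(1) h Ab_ZZ] by simp_all
  note m' = ishomD[OF m]
  have m1: "ap m unit = iota n"
    using mv u(2) g0(2) by simp
  have n0: "n \<noteq> emp"
    using n(2) by (simp add: P_def)
  have inj: "x = y" if "x \<epsilon> ZC" "y \<epsilon> ZC" "ap m x = ap m y" for x y
    by (rule ZZ_endo_inj[OF m _ that]) (use m1 n0 n(1) iota_eq_iff[of n emp] in \<open>simp add: iota_emp[symmetric]\<close>)
  \<comment> \<open>Division with remainder by \<open>n\<close>, with quotient \<open>z\<close> and
    remainder \<open>r\<close>. That \<open>r\<close> is below \<open>n\<close> is expressed by
    saying that \<open>r\<close> is not \<open>n\<close> plus something.\<close>
  have division: "\<exists>z r. z \<epsilon> ZC \<and> r \<epsilon> omega \<and> iota k = pl ZZ (ap m z) (iota r) \<and>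
      \<not> (\<exists>d. d \<epsilon> omega \<and> r = n \<uplus> d)" if "k \<epsilon> omega" for k
    using that
  proof (rule omega_induct)
    show "definable (\<lambda>v. \<exists>z r. z \<epsilon> ZC \<and> r \<epsilon> omega \<and> iota (v 0) = pl ZZ (ap m z) (iota r) \<and>
      \<not> (\<exists>d. d \<epsilon> omega \<and> r = n \<uplus> d))"
      by (intro dfn)
    obtain n' where n': "n' \<epsilon> omega" "n = suc n'"
      using omega_cases n(1) n0 by blast
    have zero: "\<not> (\<exists>d. d \<epsilon> omega \<and> emp = n \<uplus> d)"
      using n' by auto
    then show "\<exists>z r. z \<epsilon> ZC \<and> r \<epsilon> omega \<and> iota emp = pl ZZ (ap m z) (iota r) \<and>
        \<not> (\<exists>d. d \<epsilon> omega \<and> r = n \<uplus> d)"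
      using ishom_zer[OF m Ab_ZZ Ab_ZZ] Z(4,5)
      by (intro exI[of _ "zer ZZ"] exI[of _ emp]) (simp add: iota_emp)
    fix k assume k: "k \<epsilon> omega"
    assume "\<exists>z r. z \<epsilon> ZC \<and> r \<epsilon> omega \<and> iota k = pl ZZ (ap m z) (iota r) \<and>
        \<not> (\<exists>d. d \<epsilon> omega \<and> r = n \<uplus> d)"
    then obtain z r where z: "z \<epsilon> ZC" "r \<epsilon> omega" "iota k = pl ZZ (ap m z) (iota r)"
      and r: "\<not> (\<exists>d. d \<epsilon> omega \<and> r = n \<uplus> d)"
      by blast
    have mz: "ap m z \<epsilon> car ZZ"
      using m'(1) z(1) by simp
    have eq: "iota (suc k) = pl ZZ (ap m z) (iota (suc r))"
      using k z mz Z(2) by (simp add: iota_suc)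
    show "\<exists>z r. z \<epsilon> ZC \<and> r \<epsilon> omega \<and> iota (suc k) = pl ZZ (ap m z) (iota r) \<and>
        \<not> (\<exists>d. d \<epsilon> omega \<and> r = n \<uplus> d)"
    proof (cases "\<exists>d. d \<epsilon> omega \<and> suc r = n \<uplus> d")
      case True
      then obtain d where d: "d \<epsilon> omega" "suc r = n \<uplus> d"
        by blast
      \<comment> \<open>As \<open>r\<close> is below \<open>n\<close>, its successor can reach
        \<open>n\<close> but not pass it. It then equals \<open>n\<close>, the quotient grows by one
        and the remainder becomes zero.\<close>
      have "d = emp"
      proof (rule ccontr)
        assume "d \<noteq> emp"
        then obtain e where e: "e \<epsilon> omega" "d = suc e"
          using omega_cases d(1) by blast
        then have "suc r = suc (n \<uplus> e)"
          using d n(1) by simp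
        then have "r = n \<uplus> e"
          using suc_inject z(2) e(1) n(1) by simp
        then show False
          using r e(1) by blast
      qed
      then have "suc r = n"
        using d n(1) by simp
      then have "iota (suc k) = ap m (pl ZZ z unit)"
        using eq m1 m'(2) z(1) by simp
      moreover have "pl ZZ z unit \<epsilon> ZC"
        using Z(1)[of z unit] z(1) by simp
      ultimately show ?thesis
        using zero m'(1) Z(6)
        by (intro exI[of _ "pl ZZ z unit"] exI[of _ emp]) (simp add: iota_emp)
    next
      case False
      then show ?thesis
        using z(1,2) eq by (intro exI[of _ z] exI[of _ "suc r"]) simp
    qed
  qed
  have pos: "\<exists>z. z \<epsilon> ZC \<and> ap m z = iota k"
    if k: "k \<epsilon> omega" and g: "g \<epsilon> car G" "ap h g = iota k" for k g
  proof -
    obtain z r where z: "z \<epsilon> ZC" "r \<epsilon> omega" "iota k = pl ZZ (ap m z) (iota r)"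
      and r: "\<not> (\<exists>d. d \<epsilon> omega \<and> r = n \<uplus> d)"
      using division[OF k] by blast
    have mz: "ap m z \<epsilon> car ZZ"
      using m'(1) z(1) by simp
    have uz: "ap u z \<epsilon> car G"
      using u'(1) z(1) by simp
    obtain w where w: "w \<epsilon> car G" "pl G (ap u z) w = zer G"
      using GG(7) uz by blast
    have "pl ZZ (ap m z) (ap h w) = zer ZZ"
      using h'(2)[OF uz w(1)] w(2) ishom_zer[OF h G Ab_ZZ] mv z(1) by simp
    \<comment> \<open>The remainder is itself a value of \<open>h\<close>, namely at
      \<open>g\<close> minus \<open>ap u z\<close>. Were it positive, minimality would make it at
      least \<open>n\<close>.\<close>
    then have "ap h (pl G g w) = iota r"
      using h'(1,2) g w(1) z mz Z by (metis car_ZZ iota_ZC)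
    moreover have "pl G g w \<epsilon> car G"
      using GG(1) g(1) w(1) by blast
    ultimately have "r = emp"
      using least[OF z(2)] r unfolding P_def by blast
    then show ?thesis
      using z mz Z(6) by (intro exI[of _ z]) (simp add: iota_emp)
  qed
  have image: "\<exists>z. z \<epsilon> ZC \<and> ap m z = ap h g" if g: "g \<epsilon> car G" for g
  proof -
    have "ap h g \<epsilon> ZC"
      using h'(1)[OF g] by simp
    then show ?thesis
    proof (cases rule: ZC_cases)
      case (1 k)
      then show ?thesis
        using pos g by metis
    next
      case (2 k)
      then obtain g' where g': "g' \<epsilon> car G" "ap h g' = iota k"
        using neg[OF g] by blast
      then obtain z where z: "z \<epsilon> ZC" "ap m z = iota k"
        using pos 2(1) by blast
      obtain w where w: "w \<epsilon> ZC" "pl ZZ z w = zer ZZ"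
        using Z(7)[of z] z(1) by auto
      have "pl ZZ (iota k) (ap m w) = zer ZZ"
        using m'(2)[of z w] w z ishom_zer[OF m Ab_ZZ Ab_ZZ] by simp
      moreover have "pl ZZ (iota k) (ap h g) = zer ZZ"
        using 2 Z(3)[of "ap h g" "iota k"] h'(1)[OF g] by simp
      ultimately have "ap m w = ap h g"
        using pl_cancel[OF Ab_ZZ, of "iota k" "ap m w" "ap h g"] 2(1) m'(1)[of w] w(1) h'(1)[OF g] by simp
      then show ?thesis
        using w(1) by blast
    qed
  qed
  \<comment> \<open>This is \<open>ap h g\<close> divided by \<open>n\<close>: a quotient exists by
    \<open>image\<close> and is unique because \<open>m\<close> is injective.\<close>
  define t where "t g = the1 (\<lambda>z. z \<epsilon> ZC \<and> ap m z = ap h g)" for g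
  have t: "t g = z" if "z \<epsilon> ZC" "ap m z = ap h g" for g z
    unfolding t_def
  proof (rule the1_equality)
    show "z \<epsilon> ZC \<and> ap m z = ap h g"
      using that ..
    show "y = z" if "y \<epsilon> ZC \<and> ap m y = ap h g" for y
      using inj that \<open>z \<epsilon> ZC\<close> \<open>ap m z = ap h g\<close> by simp
  qed
  have t': "t g \<epsilon> ZC" "ap m (t g) = ap h g" if "g \<epsilon> car G" for g
    using image[OF that] t by metis+
  have "definable_fun (\<lambda>v. t (v 0))"
    unfolding t_def by (intro dfn)
  then have "\<exists>r. ishom r G ZZ \<and> (\<forall>x. x \<epsilon> car G \<longrightarrow> ap r x = t x)"
  proof (rule hom_exists[OF _ G])
    show "t x \<epsilon> car ZZ" if "x \<epsilon> car G" for x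
      using t'(1) that by simp
    show "t (pl G x y) = pl ZZ (t x) (t y)" if "x \<epsilon> car G" "y \<epsilon> car G" for x y
      using that t' Z(1)[of "t x" "t y"] by (intro t) (simp_all add: m'(2) h'(2))
  qed
  then obtain r where r: "ishom r G ZZ" "\<And>x. x \<epsilon> car G \<Longrightarrow> ap r x = t x"
    by blast
  \<comment> \<open>The value \<open>ap h (ap u z)\<close> is \<open>ap m z\<close>, whose quotient
    by \<open>n\<close> is \<open>z\<close>.\<close>
  have "ap r (ap u z) = z" if "z \<epsilon> car ZZ" for z
    using r(2) u'(1)[OF that] t[of z "ap u z"] mv that by simp
  then show ?thesis
    unfolding retract_def using u(1) r(1) by blast
qed

text \<open>The identity and the zero endomorphism of the integers differ, so a generator separates
  them; the separating homomorphism has a nonzero value and can be divided as above.\<close>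

lemma retract_generator_ZZ:
  assumes "Ab G" "generator G"
  shows "retract ZZ G"
proof -
  obtain o' where o: "ishom o' ZZ ZZ" "\<And>x. x \<epsilon> car ZZ \<Longrightarrow> ap o' x = zer ZZ"
    using zero_hom[OF Ab_ZZ Ab_ZZ] by blast
  have "unit \<noteq> zer ZZ"
    using iota_eq_iff[of "suc emp" emp] by (simp add: unit_def iota_emp)
  then have "idm ZZ \<noteq> o'"
    using o(2)[of unit] ap_idm[of unit ZZ] by auto
  then obtain h x where hx: "ishom h G ZZ" "x \<epsilon> car G" "ap (idm ZZ) (ap h x) \<noteq> ap o' (ap h x)"
    using assms(2) Ab_ZZ ishom_idm[OF Ab_ZZ] o(1) unfolding generator_def by blast
  then have "ap h x \<noteq> zer ZZ"
    using ap_idm o(2) ishomD(1)[OF hx(1)] by simp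
  then show ?thesis
    using retract_ZZ[OF assms(1) hx(1,2)] by blast
qed

text \<open>The idempotent of the integers given by the retraction is the identity, since a nonzero
  endomorphism is injective.\<close>

lemma retract_of_ZZ_free:
  assumes X: "Ab X" and "retract X ZZ" and x: "x \<epsilon> car X" "x \<noteq> zer X"
  shows "\<exists>e. free_on X e"
proof -
  obtain i r where i: "ishom i X ZZ" and r: "ishom r ZZ X" and ri: "\<And>x. x \<epsilon> car X \<Longrightarrow> ap r (ap i x) = x"
    using assms(2) unfolding retract_def by blast
  note i' = ishomD[OF i] and r' = ishomD[OF r]
  have e: "ishom (comp i r) ZZ ZZ" "\<And>z. z \<epsilon> ZC \<Longrightarrow> ap (comp i r) z = ap i (ap r z)"
    using comp_props(1,2)[OF r i Ab_ZZ] by simp_all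
  have r1: "ap r unit \<epsilon> car X"
    using r'(1) by simp
  have c: "ap i (ap r unit) \<epsilon> ZC"
    using i'(1)[OF r1] by simp
  \<comment> \<open>Otherwise \<open>r\<close> would vanish at \<open>unit\<close> and hence
    everywhere, and the identity of \<open>X\<close>, which factors through \<open>r\<close>, would
    be zero in spite of \<open>x\<close>.\<close>
  have "ap i (ap r unit) \<noteq> zer ZZ"
  proof
    assume "ap i (ap r unit) = zer ZZ"
    then have 0: "ap r unit = zer X"
      using ri[OF r1] ishom_zer[OF r Ab_ZZ X] by simp
    obtain o' where o: "ishom o' ZZ X" "\<And>x. x \<epsilon> car ZZ \<Longrightarrow> ap o' x = zer X"
      using zero_hom[OF Ab_ZZ X] by blast
    have "r = o'"
      by (rule ZZ_hom_unique[OF X r o(1)]) (simp add: 0 o(2))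
    then show False
      using ri[OF x(1)] o(2) i'(1)[OF x(1)] x(2) by simp
  qed
  \<comment> \<open>By idempotency the endomorphism takes the same value at
    \<open>ap i (ap r unit)\<close> and at \<open>unit\<close>, and it is injective.\<close>
  then have one: "ap i (ap r unit) = unit"
    using ZZ_endo_inj[OF e(1) _ c, of unit] e(2) c ri[OF r1] by simp
  have "\<exists>f. ishom f X Y \<and> ap f (ap r unit) = y" if Y: "Ab Y" "y \<epsilon> car Y" for Y y
  proof -
    obtain u where u: "ishom u ZZ Y" "ap u unit = y"
      using ZZ_hom_exists[OF Y] by blast
    show ?thesis
      using comp_props(1,2)[OF i u(1) X] r1 one u(2) by auto
  qed
  moreover have "f = g"
    if "Ab Y" and f: "ishom f X Y" and g: "ishom g X Y" and "ap f (ap r unit) = ap g (ap r unit)" for Y f g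
  proof (rule ishom_eqI[OF f g])
    have "comp f r = comp g r"
      by (rule ZZ_hom_unique[OF \<open>Ab Y\<close>])
        (use comp_props(1,2)[OF r f Ab_ZZ] comp_props(1,2)[OF r g Ab_ZZ] that(4) in simp_all)
    then show "ap f x = ap g x" if "x \<epsilon> car X" for x
      using comp_props(2)[OF r f Ab_ZZ i'(1)[OF that]] comp_props(2)[OF r g Ab_ZZ i'(1)[OF that]]
        ri[OF that] by simp
  qed
  ultimately show ?thesis
    unfolding free_on_def using X r1 by blast
qed

text \<open>The universal property provides homomorphisms between \<open>X\<close> and
  \<open>ZZ\<close> whose composite on \<open>X\<close> is the identity, and the retraction is
  carried along them.\<close>

lemma retract_free:
  assumes "free_on X x" "retract ZZ G" "Ab G"
  shows "retract X G"
proof -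
  obtain i r where ir: "ishom i ZZ G" "ishom r G ZZ" "\<And>x. x \<epsilon> car ZZ \<Longrightarrow> ap r (ap i x) = x"
    using assms(2) unfolding retract_def by blast
  have X: "Ab X" "x \<epsilon> car X"
    using assms(1) by (simp_all add: free_on_def)
  obtain j where j: "ishom j X ZZ" "ap j x = unit"
    using assms(1) Ab_ZZ unit_ZC unfolding free_on_def by (metis car_ZZ)
  obtain k where k: "ishom k ZZ X" "ap k unit = x"
    using ZZ_hom_exists[OF X] by blast
  have "comp k j = idm X"
    using assms(1) X(1) comp_props(1,2)[OF j(1) k(1) X(1)] ishom_idm[OF X(1)] ap_idm j(2) k(2) X(2)
    unfolding free_on_def by metis
  then have kj: "ap k (ap j y) = y" if "y \<epsilon> car X" for y
    using comp_props(2)[OF j(1) k(1) X(1) that] ap_idm that by simp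
  have "ap (comp k r) (ap (comp i j) y) = y" if "y \<epsilon> car X" for y
    using comp_props(2)[OF j(1) ir(1) X(1) that] kj[OF that] ishomD(1)[OF j(1) that] ir(3)
      comp_props(2)[OF ir(2) k(1) assms(3)] ishomD(1)[OF ir(1)] by simp
  then show ?thesis
    unfolding retract_def
    using comp_props(1)[OF j(1) ir(1) X(1)] comp_props(1)[OF ir(2) k(1) assms(3)] by blast
qed

text \<open>From right to left the condition is applied to the integers, which are themselves a
  generator, and the nonzero element rules out the zero retract.\<close>

lemma free_iff_minimal_generator:
  assumes "Ab X"
  shows "(\<exists>x. free_on X x) \<longleftrightarrow>
    (\<exists>x. x \<epsilon> car X \<and> x \<noteq> zer X) \<and> (\<forall>G. Ab G \<longrightarrow> generator G \<longrightarrow> retract X G)"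
proof
  assume "\<exists>x. free_on X x"
  then obtain x where x: "free_on X x" ..
  have "x \<noteq> zer X"
  proof
    assume "x = zer X"
    obtain j where j: "ishom j X ZZ" "ap j x = unit"
      using x Ab_ZZ unit_ZC unfolding free_on_def by (metis car_ZZ)
    then have "unit = zer ZZ"
      using ishom_zer[OF j(1) assms Ab_ZZ] \<open>x = zer X\<close> by simp
    then show False
      using iota_eq_iff[of "suc emp" emp] by (simp add: unit_def iota_emp)
  qed
  then show "(\<exists>x. x \<epsilon> car X \<and> x \<noteq> zer X) \<and> (\<forall>G. Ab G \<longrightarrow> generator G \<longrightarrow> retract X G)"
    using x retract_free[OF x retract_generator_ZZ] unfolding free_on_def by blast
next
  assume "(\<exists>x. x \<epsilon> car X \<and> x \<noteq> zer X) \<and> (\<forall>G. Ab G \<longrightarrow> generator G \<longrightarrow> retract X G)"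
  then show "\<exists>x. free_on X x"
    using retract_of_ZZ_free[OF assms] free_on_generator[OF free_on_ZZ] Ab_ZZ by blast
qed

section \<open>Truth of diagrammatic formulas\<close>

text \<open>In the model composition is an operation, so terms have values, where
  \<open>denotes\<close> can only describe them by a relation.\<close>

primrec val :: "(nat \<Rightarrow> 'u) \<Rightarrow> (nat \<Rightarrow> 'u) \<Rightarrow> mterm \<Rightarrow> 'u" where
  "val ob mor (MVar k) = mor k"
| "val ob mor (MId i) = idm (ob i)"
| "val ob mor (MComp t u) = comp (val ob mor t) (val ob mor u)"

primrec dsat :: "(nat \<Rightarrow> 'u) \<Rightarrow> (nat \<Rightarrow> 'u) \<Rightarrow> dform \<Rightarrow> bool" where
  "dsat ob mor (DEq t u) \<longleftrightarrow> val ob mor t = val ob mor u"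
| "dsat ob mor (DNeg \<phi>) \<longleftrightarrow> \<not> dsat ob mor \<phi>"
| "dsat ob mor (DConj \<phi> \<psi>) \<longleftrightarrow> dsat ob mor \<phi> \<and> dsat ob mor \<psi>"
| "dsat ob mor (DDisj \<phi> \<psi>) \<longleftrightarrow> dsat ob mor \<phi> \<or> dsat ob mor \<psi>"
| "dsat ob mor (DAllOb i \<phi>) \<longleftrightarrow> (\<forall>X. Ab X \<longrightarrow> dsat (ob(i := X)) mor \<phi>)"
| "dsat ob mor (DExOb i \<phi>) \<longleftrightarrow> (\<exists>X. Ab X \<and> dsat (ob(i := X)) mor \<phi>)"
| "dsat ob mor (DAllMor k i j \<phi>) \<longleftrightarrow> (\<forall>f. ishom f (ob i) (ob j) \<longrightarrow> dsat ob (mor(k := f)) \<phi>)"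
| "dsat ob mor (DExMor k i j \<phi>) \<longleftrightarrow> (\<exists>f. ishom f (ob i) (ob j) \<and> dsat ob (mor(k := f)) \<phi>)"

definition typed :: "nat set \<Rightarrow> (nat \<rightharpoonup> nat \<times> nat) \<Rightarrow> (nat \<Rightarrow> 'u) \<Rightarrow> (nat \<Rightarrow> 'u) \<Rightarrow> bool" where
  "typed V D ob mor \<longleftrightarrow> (\<forall>i\<in>V. Ab (ob i)) \<and>
    (\<forall>k i j. D k = Some (i, j) \<longrightarrow> i \<in> V \<and> j \<in> V \<and> ishom (mor k) (ob i) (ob j))"

lemma typed_ob: "typed V D ob mor \<Longrightarrow> Ab X \<Longrightarrow> i \<notin> V \<Longrightarrow> typed (insert i V) D (ob(i := X)) mor"
  unfolding typed_def by auto

lemma typed_mor: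
  "typed V D ob mor \<Longrightarrow> ishom f (ob i) (ob j) \<Longrightarrow> i \<in> V \<Longrightarrow> j \<in> V \<Longrightarrow>
    typed V (D(k \<mapsto> (i, j))) ob (mor(k := f))"
  unfolding typed_def by auto

lemma val_ishom:
  assumes "arrow V D t i j" "typed V D ob mor"
  shows "i \<in> V \<and> j \<in> V \<and> ishom (val ob mor t) (ob i) (ob j)"
  using assms(1)
proof induction
  case (3 u i j t k)
  then show ?case
    using comp_props(1)[of "val ob mor u" "ob i" "ob j" "val ob mor t" "ob k"] assms(2)
    unfolding typed_def by simp
qed (use assms(2) ishom_idm in \<open>auto simp: typed_def\<close>)

text \<open>Well-typedness guarantees that the subterms denote composable homomorphisms, for which
  \<open>is_comp\<close> describes exactly \<open>comp\<close>.\<close>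

lemma hold_denotes:
  assumes "arrow V D t i j" "typed V D (\<lambda>i. \<rho> (ob i)) (\<lambda>k. \<rho> (mor k))"
    and "\<And>i. ob i < d" "\<And>k. mor k < d" "h < d"
  shows "holds w d \<rho> (denotes ob mor t h) \<longleftrightarrow> \<rho> h = val (\<lambda>i. \<rho> (ob i)) (\<lambda>k. \<rho> (mor k)) t"
  using assms
proof (induction arbitrary: d h \<rho>)
  case (1 k i j)
  then show ?case
    by (simp add: hold)
next
  case (2 i)
  then show ?case
    by (simp add: hold typed_def)
next
  case (3 u i j t k)
  have upd: "(\<rho>(d := a, Suc d := b)) (ob i) = \<rho> (ob i)" "(\<rho>(d := a, Suc d := b)) (mor i) = \<rho> (mor i)"
    for a b i
    using "3.prems"(2)[of i] "3.prems"(3)[of i] by auto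
  have less: "ob i < Suc (Suc d)" "mor i < Suc (Suc d)" for i
    using "3.prems"(2)[of i] "3.prems"(3)[of i] by simp_all
  let ?val = "val (\<lambda>i. \<rho> (ob i)) (\<lambda>k. \<rho> (mor k))"
  note u = val_ishom[OF "3.hyps"(1) "3.prems"(1)] and t = val_ishom[OF "3.hyps"(2) "3.prems"(1)]
  have IH: "holds w (Suc (Suc d)) (\<rho>(d := a, Suc d := b)) (denotes ob mor t d) \<longleftrightarrow> a = ?val t"
    "holds w (Suc (Suc d)) (\<rho>(d := a, Suc d := b)) (denotes ob mor u (Suc d)) \<longleftrightarrow> b = ?val u" for a b
  proof -
    have "typed V D (\<lambda>i. (\<rho>(d := a, Suc d := b)) (ob i)) (\<lambda>k. (\<rho>(d := a, Suc d := b)) (mor k))"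
      unfolding upd by (rule "3.prems"(1))
    note IH = "3.IH"[OF this less, unfolded upd]
    show "holds w (Suc (Suc d)) (\<rho>(d := a, Suc d := b)) (denotes ob mor t d) \<longleftrightarrow> a = ?val t"
      by (subst IH(2)) simp_all
    show "holds w (Suc (Suc d)) (\<rho>(d := a, Suc d := b)) (denotes ob mor u (Suc d)) \<longleftrightarrow> b = ?val u"
      by (subst IH(1)) simp_all
  qed
  have "holds w (Suc (Suc d)) (\<rho>(d := ?val t, Suc d := ?val u)) (is_comp d (Suc d) h) \<longleftrightarrow>
      \<rho> h = comp (?val t) (?val u)"
    using hold_is_comp[of d "Suc (Suc d)" "Suc d" h "\<rho>(d := ?val t, Suc d := ?val u)" "\<rho> (ob i)" "\<rho> (ob j)"
        "\<rho> (ob k)" w] u t "3.prems"(1,4)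
    by (simp add: typed_def)
  then show ?case
    by (simp add: hold IH)
qed

text \<open>Every variable is assigned a level below \<open>d\<close>, so a quantifier at depth
  \<open>d\<close> writes its value to a level used by no other variable. Typing is maintained along
  the way, as \<open>is_hom\<close> is understood only between groups.\<close>

lemma hold_holds_in_Ab:
  assumes "diagrammatic V D \<phi>" "typed V D (\<lambda>i. \<rho> (ob i)) (\<lambda>k. \<rho> (mor k))"
    and "\<And>i. ob i < d" "\<And>k. mor k < d"
  shows "holds w d \<rho> (holds_in_Ab ob mor \<phi>) \<longleftrightarrow> dsat (\<lambda>i. \<rho> (ob i)) (\<lambda>k. \<rho> (mor k)) \<phi>"
  using assms
proof (induction \<phi> arbitrary: V D d \<rho> ob mor)
  case (DEq t u)
  have upd: "(\<rho>(d := a)) (ob i) = \<rho> (ob i)" "(\<rho>(d := a)) (mor i) = \<rho> (mor i)" for a i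
    using DEq.prems(3)[of i] DEq.prems(4)[of i] by auto
  have less: "ob i < Suc d" "mor i < Suc d" for i
    using DEq.prems(3)[of i] DEq.prems(4)[of i] by simp_all
  obtain i j where t: "arrow V D t i j" and u: "arrow V D u i j"
    using DEq.prems(1) by auto
  have "holds w (Suc d) (\<rho>(d := a)) (denotes ob mor t d) \<longleftrightarrow> a = val (\<lambda>i. \<rho> (ob i)) (\<lambda>k. \<rho> (mor k)) t" for a
    using hold_denotes[OF t, of "\<rho>(d := a)" ob mor "Suc d" d w] less DEq.prems(2) unfolding upd by simp
  moreover have "holds w (Suc d) (\<rho>(d := a)) (denotes ob mor u d) \<longleftrightarrow>
      a = val (\<lambda>i. \<rho> (ob i)) (\<lambda>k. \<rho> (mor k)) u" for a
    using hold_denotes[OF u, of "\<rho>(d := a)" ob mor "Suc d" d w] less DEq.prems(2) unfolding upd by simp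
  ultimately show ?case
    by (simp add: hold)
next
  case (DConj \<phi> \<psi>)
  show ?case
    using DConj.prems(1) DConj.IH[OF _ DConj.prems(2-4)] by (simp add: hold)
next
  case (DDisj \<phi> \<psi>)
  show ?case
    using DDisj.prems(1) DDisj.IH[OF _ DDisj.prems(2-4)] by (simp add: hold)
next
  case (DNeg \<phi>)
  show ?case
    using DNeg.prems(1) DNeg.IH[OF _ DNeg.prems(2-4)] by (simp add: hold)
next
  case (DAllOb i \<phi>)
  have "holds w (Suc d) (\<rho>(d := X)) (holds_in_Ab (ob(i := d)) mor \<phi>) \<longleftrightarrow>
      dsat ((\<lambda>i. \<rho> (ob i))(i := X)) (\<lambda>k. \<rho> (mor k)) \<phi>" if "Ab X" for X
  proof -
    have upd: "(\<lambda>j. (\<rho>(d := X)) ((ob(i := d)) j)) = (\<lambda>i. \<rho> (ob i))(i := X)"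
      "(\<lambda>k. (\<rho>(d := X)) (mor k)) = (\<lambda>k. \<rho> (mor k))"
      using less_imp_neq[OF DAllOb.prems(3)] less_imp_neq[OF DAllOb.prems(4)] by auto
    have diag: "diagrammatic (insert i V) D \<phi>" "i \<notin> V"
      using DAllOb.prems(1) by simp_all
    have typed: "typed (insert i V) D (\<lambda>j. (\<rho>(d := X)) ((ob(i := d)) j)) (\<lambda>k. (\<rho>(d := X)) (mor k))"
      unfolding upd by (rule typed_ob[OF DAllOb.prems(2) that diag(2)])
    show ?thesis
      by (rule DAllOb.IH[OF diag(1) typed, unfolded upd]) (simp_all add: DAllOb.prems(3,4) less_SucI)
  qed
  then show ?case
    by (simp add: hold)
next
  case (DExOb i \<phi>)
  have "holds w (Suc d) (\<rho>(d := X)) (holds_in_Ab (ob(i := d)) mor \<phi>) \<longleftrightarrow>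
      dsat ((\<lambda>i. \<rho> (ob i))(i := X)) (\<lambda>k. \<rho> (mor k)) \<phi>" if "Ab X" for X
  proof -
    have upd: "(\<lambda>j. (\<rho>(d := X)) ((ob(i := d)) j)) = (\<lambda>i. \<rho> (ob i))(i := X)"
      "(\<lambda>k. (\<rho>(d := X)) (mor k)) = (\<lambda>k. \<rho> (mor k))"
      using less_imp_neq[OF DExOb.prems(3)] less_imp_neq[OF DExOb.prems(4)] by auto
    have diag: "diagrammatic (insert i V) D \<phi>" "i \<notin> V"
      using DExOb.prems(1) by simp_all
    have typed: "typed (insert i V) D (\<lambda>j. (\<rho>(d := X)) ((ob(i := d)) j)) (\<lambda>k. (\<rho>(d := X)) (mor k))"
      unfolding upd by (rule typed_ob[OF DExOb.prems(2) that diag(2)])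
    show ?thesis
      by (rule DExOb.IH[OF diag(1) typed, unfolded upd]) (simp_all add: DExOb.prems(3,4) less_SucI)
  qed
  then show ?case
    by (simp add: hold cong: conj_cong)
next
  case (DAllMor k i j \<phi>)
  have upd: "(\<lambda>i. (\<rho>(d := f)) (ob i)) = (\<lambda>i. \<rho> (ob i))"
    "(\<lambda>l. (\<rho>(d := f)) ((mor(k := d)) l)) = (\<lambda>k. \<rho> (mor k))(k := f)" for f
    using less_imp_neq[OF DAllMor.prems(3)] less_imp_neq[OF DAllMor.prems(4)] by auto
  have Ab: "Ab (\<rho> (ob i))" "Ab (\<rho> (ob j))"
    using DAllMor.prems(1,2) by (simp_all add: typed_def)
  have "holds w (Suc d) (\<rho>(d := f)) (holds_in_Ab ob (mor(k := d)) \<phi>) \<longleftrightarrow>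
      dsat (\<lambda>i. \<rho> (ob i)) ((\<lambda>k. \<rho> (mor k))(k := f)) \<phi>" if "ishom f (\<rho> (ob i)) (\<rho> (ob j))" for f
  proof -
    have diag: "i \<in> V" "j \<in> V" "diagrammatic V (D(k \<mapsto> (i, j))) \<phi>"
      using DAllMor.prems(1) by simp_all
    have typed: "typed V (D(k \<mapsto> (i, j))) (\<lambda>i. (\<rho>(d := f)) (ob i))
        (\<lambda>l. (\<rho>(d := f)) ((mor(k := d)) l))"
      unfolding upd by (rule typed_mor[OF DAllMor.prems(2) that diag(1,2)])
    show ?thesis
      by (rule DAllMor.IH[OF diag(3) typed, unfolded upd]) (simp_all add: DAllMor.prems(3,4) less_SucI)
  qed
  moreover have "holds w (Suc d) (\<rho>(d := f)) (is_hom d (ob i) (ob j)) \<longleftrightarrow>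
      ishom f (\<rho> (ob i)) (\<rho> (ob j))" for f
    using hold_is_hom[of d "Suc d" "ob i" "ob j" "\<rho>(d := f)" w] DAllMor.prems(3)[of i] DAllMor.prems(3)[of j] Ab
    by simp
  ultimately show ?case
    by (simp add: hold)
next
  case (DExMor k i j \<phi>)
  have upd: "(\<lambda>i. (\<rho>(d := f)) (ob i)) = (\<lambda>i. \<rho> (ob i))"
    "(\<lambda>l. (\<rho>(d := f)) ((mor(k := d)) l)) = (\<lambda>k. \<rho> (mor k))(k := f)" for f
    using less_imp_neq[OF DExMor.prems(3)] less_imp_neq[OF DExMor.prems(4)] by auto
  have Ab: "Ab (\<rho> (ob i))" "Ab (\<rho> (ob j))"
    using DExMor.prems(1,2) by (simp_all add: typed_def)
  have "holds w (Suc d) (\<rho>(d := f)) (holds_in_Ab ob (mor(k := d)) \<phi>) \<longleftrightarrow>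
      dsat (\<lambda>i. \<rho> (ob i)) ((\<lambda>k. \<rho> (mor k))(k := f)) \<phi>" if "ishom f (\<rho> (ob i)) (\<rho> (ob j))" for f
  proof -
    have diag: "i \<in> V" "j \<in> V" "diagrammatic V (D(k \<mapsto> (i, j))) \<phi>"
      using DExMor.prems(1) by simp_all
    have typed: "typed V (D(k \<mapsto> (i, j))) (\<lambda>i. (\<rho>(d := f)) (ob i))
        (\<lambda>l. (\<rho>(d := f)) ((mor(k := d)) l))"
      unfolding upd by (rule typed_mor[OF DExMor.prems(2) that diag(1,2)])
    show ?thesis
      by (rule DExMor.IH[OF diag(3) typed, unfolded upd]) (simp_all add: DExMor.prems(3,4) less_SucI)
  qed
  moreover have "holds w (Suc d) (\<rho>(d := f)) (is_hom d (ob i) (ob j)) \<longleftrightarrow>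
      ishom f (\<rho> (ob i)) (\<rho> (ob j))" for f
    using hold_is_hom[of d "Suc d" "ob i" "ob j" "\<rho>(d := f)" w] DExMor.prems(3)[of i] DExMor.prems(3)[of j] Ab
    by simp
  ultimately show ?case
    by (simp add: hold cong: conj_cong)
qed

definition splits :: "'u \<Rightarrow> 'u \<Rightarrow> 'u \<Rightarrow> bool" where
  "splits B g A \<longleftrightarrow> (\<exists>s. ishom s A B \<and> comp g s = idm A)"

text \<open>Only \<open>ZZ\<close> satisfies \<open>is_int\<close>, so the quantifier over
  \<open>Z\<close> disappears. The section condition turns into an equation of composites, since
  \<open>is_comp\<close> is applied there to homomorphisms.\<close>

lemma hold_is_whitehead:
  assumes "A < d"
  shows "holds w d \<rho> (is_whitehead A) \<longleftrightarrow>
    Ab (\<rho> A) \<and> (\<forall>B f g. Ab B \<longrightarrow> short_exact ZZ f B g (\<rho> A) \<longrightarrow> splits B g (\<rho> A))"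
proof (cases "Ab (\<rho> A)")
  case True
  let ?\<rho> = "\<lambda>Z B f g. \<rho>(d := Z, Suc d := B, Suc (Suc d) := f, Suc (Suc (Suc d)) := g)"
  let ?d = "Suc (Suc (Suc (Suc d)))"
  have "holds w ?d (?\<rho> Z B f g)
      (\<^bold>\<exists>h. is_hom h A (Suc d) \<^bold>\<and> (\<^bold>\<exists>i. is_id A i \<^bold>\<and> is_comp (Suc (Suc (Suc d))) h i)) \<longleftrightarrow> splits B g (\<rho> A)"
    if "Ab B" "short_exact Z f B g (\<rho> A)" for Z B f g
  proof -
    have "ishom g B (\<rho> A)"
      using that by (simp add: short_exact_def)
    have "holds w (Suc (Suc ?d)) ((?\<rho> Z B f g)(?d := h, Suc ?d := i))
        (is_comp (Suc (Suc (Suc d))) ?d (Suc ?d)) \<longleftrightarrow> i = comp g h" if "ishom h (\<rho> A) B" for h i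
      using hold_is_comp[of "Suc (Suc (Suc d))" "Suc (Suc ?d)" ?d "Suc ?d"
          "(?\<rho> Z B f g)(?d := h, Suc ?d := i)" "\<rho> A" B "\<rho> A" w] that \<open>ishom g B (\<rho> A)\<close> True by simp
    then show ?thesis
      using assms True \<open>Ab B\<close> by (auto simp: hold splits_def)
  qed
  then show ?thesis
    using assms True Ab_ZZ
    by (simp add: is_whitehead_def hold del: hold_ex cong: conj_cong imp_cong) blast
next
  case False
  then show ?thesis
    using assms by (simp add: is_whitehead_def hold)
qed

section \<open>The defining formula\<close>

lemma comp_eq_iff:
  assumes "ishom f A B" "ishom g B C" "ishom f' A B'" "ishom g' B' C" "Ab A"
  shows "comp g f = comp g' f' \<longleftrightarrow> (\<forall>x. x \<epsilon> car A \<longrightarrow> ap g (ap f x) = ap g' (ap f' x))"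
  using comp_props(1,2)[OF assms(1,2,5)] comp_props(1,2)[OF assms(3,4,5)] ishom_eqI by metis

lemma comp_eq_idm_iff:
  assumes "ishom f A B" "ishom g B A" "Ab A"
  shows "comp g f = idm A \<longleftrightarrow> (\<forall>x. x \<epsilon> car A \<longrightarrow> ap g (ap f x) = x)"
  using comp_props(1,2)[OF assms] ishom_idm[OF assms(3)] ap_idm ishom_eqI by metis

end

text \<open>The formulas below use the object variables \<open>0\<close> for \<open>A\<close>, \<open>1\<close> for the free object \<open>X\<close>,
  \<open>2\<close> for the generator, and \<open>5\<close> for the middle term \<open>B\<close> of an extension. In the last four
  formulas the morphism variables \<open>0\<close> and \<open>1\<close> stand for \<open>X \<rightarrow> B\<close> and \<open>B \<rightarrow> A\<close>.\<close>

definition DImp :: "dform \<Rightarrow> dform \<Rightarrow> dform" where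
  "DImp \<phi> \<psi> = DDisj (DNeg \<phi>) \<psi>"

definition generator_formula :: dform where
  "generator_formula = DAllOb 3 (DAllOb 4 (DAllMor 0 3 4 (DAllMor 1 3 4
    (DImp (DNeg (DEq (MVar 0) (MVar 1)))
      (DExMor 2 2 3 (DNeg (DEq (MComp (MVar 0) (MVar 2)) (MComp (MVar 1) (MVar 2)))))))))"

text \<open>Being nonzero is expressed without elements: a group is nonzero if and only if it has an
  endomorphism other than the identity, zero being an example.\<close>

definition free_formula :: dform where
  "free_formula = DConj (DExMor 0 1 1 (DNeg (DEq (MVar 0) (MId 1))))
    (DAllOb 2 (DImp generator_formula
      (DExMor 0 1 2 (DExMor 1 2 1 (DEq (MComp (MVar 1) (MVar 0)) (MId 1))))))"

text \<open>Endomorphisms of the free object \<open>X\<close> stand for its elements, so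
  cancellation against them is injectivity.\<close>

definition inj_formula :: dform where
  "inj_formula = DAllMor 2 1 1 (DAllMor 3 1 1
    (DImp (DEq (MComp (MVar 0) (MVar 2)) (MComp (MVar 0) (MVar 3))) (DEq (MVar 2) (MVar 3))))"

text \<open>Homomorphisms from \<open>X\<close> to \<open>A\<close> and to \<open>B\<close> stand
  for elements, so lifting the former along \<open>B \<rightarrow> A\<close> is
  surjectivity.\<close>

definition surj_formula :: dform where
  "surj_formula = DAllMor 2 1 0 (DExMor 3 1 5 (DEq (MComp (MVar 1) (MVar 3)) (MVar 2)))"

text \<open>A homomorphism is zero if and only if precomposition with endomorphisms does not change it.\<close>

definition exact_formula :: dform where
  "exact_formula = (let
      zero = DAllMor 3 1 1 (DEq (MComp (MVar 1) (MComp (MVar 2) (MVar 3))) (MComp (MVar 1) (MVar 2)));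
      lifts = DExMor 3 1 1 (DEq (MComp (MVar 0) (MVar 3)) (MVar 2))
    in DAllMor 2 1 5 (DConj (DImp zero lifts) (DImp lifts zero)))"

text \<open>The universal quantifier over \<open>X\<close> is adequate because the integers are one
  such \<open>X\<close> and any other can be exchanged for them in an extension.\<close>

definition whitehead_formula :: dform where
  "whitehead_formula = DAllOb 1 (DImp free_formula (DAllOb 5 (DAllMor 0 1 5 (DAllMor 1 5 0
    (DImp (DConj inj_formula (DConj surj_formula exact_formula))
      (DExMor 2 0 5 (DEq (MComp (MVar 1) (MVar 2)) (MId 0))))))))"

lemmas formula_defs = whitehead_formula_def free_formula_def generator_formula_def inj_formula_def
  surj_formula_def exact_formula_def DImp_def Let_def

lemma diagrammatic_whitehead_formula: "diagrammatic {0} Map.empty whitehead_formula"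
proof -
  have eq: "\<exists>i j. arrow V D t i j \<and> arrow V D u i j" if "arrow V D t i j" "arrow V D u i j" for V D t u i j
    using that by blast
  show ?thesis
    unfolding formula_defs by (simp, intro conjI; rule eq; (rule arrow.intros; simp?)+)
qed

context set_model
begin

section \<open>Reading the formula through elements\<close>

lemma free_hom_eq_iff:
  assumes "free_on X x" "Ab Y" "ishom f X Y" "ishom g X Y"
  shows "f = g \<longleftrightarrow> ap f x = ap g x"
  using assms unfolding free_on_def by blast

text \<open>Evaluation at \<open>x\<close> reaches every element of \<open>Y\<close>, so quantifiers
  over morphisms out of \<open>X\<close> become quantifiers over elements.\<close>

lemma free_all_hom:
  assumes "free_on X x" "Ab Y"
  shows "(\<forall>f. ishom f X Y \<longrightarrow> P (ap f x)) \<longleftrightarrow> (\<forall>y. y \<epsilon> car Y \<longrightarrow> P y)"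
  using assms ishomD(1) unfolding free_on_def by metis

lemma free_ex_hom:
  assumes "free_on X x" "Ab Y"
  shows "(\<exists>f. ishom f X Y \<and> P (ap f x)) \<longleftrightarrow> (\<exists>y. y \<epsilon> car Y \<and> P y)"
  using free_all_hom[OF assms, of "\<lambda>y. \<not> P y"] by blast

lemma dsat_DImp [simp]: "dsat ob mor (DImp \<phi> \<psi>) \<longleftrightarrow> (dsat ob mor \<phi> \<longrightarrow> dsat ob mor \<psi>)"
  by (simp add: DImp_def)

lemma dsat_generator_formula:
  assumes "Ab (ob 2)"
  shows "dsat ob mor generator_formula \<longleftrightarrow> generator (ob 2)"
proof -
  have "dsat ob mor generator_formula \<longleftrightarrow> (\<forall>Y. Ab Y \<longrightarrow> (\<forall>W. Ab W \<longrightarrow> (\<forall>f. ishom f Y W \<longrightarrow>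
      (\<forall>g. ishom g Y W \<longrightarrow> f \<noteq> g \<longrightarrow> (\<exists>h. ishom h (ob 2) Y \<and> comp f h \<noteq> comp g h)))))"
    unfolding generator_formula_def by simp
  also have "\<dots> \<longleftrightarrow> (\<forall>Y. Ab Y \<longrightarrow> (\<forall>W. Ab W \<longrightarrow> (\<forall>f. ishom f Y W \<longrightarrow> (\<forall>g. ishom g Y W \<longrightarrow>
      f \<noteq> g \<longrightarrow> (\<exists>h. ishom h (ob 2) Y \<and> (\<exists>x. x \<epsilon> car (ob 2) \<and> ap f (ap h x) \<noteq> ap g (ap h x)))))))"
  proof -
    have "comp f h \<noteq> comp g h \<longleftrightarrow> (\<exists>x. x \<epsilon> car (ob 2) \<and> ap f (ap h x) \<noteq> ap g (ap h x))"
      if "ishom h (ob 2) Y" "ishom f Y W" "ishom g Y W" for f g h Y W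
      using comp_eq_iff[OF that(1,2) that(1,3) assms] by simp
    then show ?thesis
      by (simp cong: conj_cong imp_cong)
  qed
  also have "\<dots> \<longleftrightarrow> generator (ob 2)"
    unfolding generator_def by blast
  finally show ?thesis .
qed

lemma dsat_free_formula:
  assumes "Ab (ob 1)"
  shows "dsat ob mor free_formula \<longleftrightarrow> (\<exists>x. free_on (ob 1) x)"
proof -
  let ?X = "ob 1"
  have "dsat ob mor free_formula \<longleftrightarrow> (\<exists>u. ishom u ?X ?X \<and> u \<noteq> idm ?X) \<and>
      (\<forall>G. Ab G \<longrightarrow> generator G \<longrightarrow> (\<exists>i. ishom i ?X G \<and> (\<exists>r. ishom r G ?X \<and> comp r i = idm ?X)))"
    unfolding free_formula_def by (simp add: dsat_generator_formula)
  \<comment> \<open>An endomorphism fixes zero, so it can differ from the identity only at a nonzero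
    element; conversely the zero endomorphism moves such an element.\<close>
  also have "(\<exists>u. ishom u ?X ?X \<and> u \<noteq> idm ?X) \<longleftrightarrow> (\<exists>x. x \<epsilon> car ?X \<and> x \<noteq> zer ?X)"
  proof
    assume "\<exists>u. ishom u ?X ?X \<and> u \<noteq> idm ?X"
    then obtain u x where "ishom u ?X ?X" "x \<epsilon> car ?X" "ap u x \<noteq> ap (idm ?X) x"
      using ishom_eqI ishom_idm[OF assms] by metis
    then show "\<exists>x. x \<epsilon> car ?X \<and> x \<noteq> zer ?X"
      using ap_idm ishom_zer[OF _ assms assms] by metis
  next
    assume "\<exists>x. x \<epsilon> car ?X \<and> x \<noteq> zer ?X"
    then show "\<exists>u. ishom u ?X ?X \<and> u \<noteq> idm ?X"
      using zero_hom[OF assms assms] ap_idm by metis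
  qed
  also have "(\<forall>G. Ab G \<longrightarrow> generator G \<longrightarrow> (\<exists>i. ishom i ?X G \<and> (\<exists>r. ishom r G ?X \<and> comp r i = idm ?X))) \<longleftrightarrow>
      (\<forall>G. Ab G \<longrightarrow> generator G \<longrightarrow> retract ?X G)"
    unfolding retract_def using comp_eq_idm_iff[OF _ _ assms] by metis
  finally show ?thesis
    using free_iff_minimal_generator[OF assms] by simp
qed

lemma dsat_short_exact:
  assumes X: "free_on (ob 1) x" and Ab: "Ab (ob 0)" "Ab (ob 5)"
    and f: "ishom (mor 0) (ob 1) (ob 5)" and g: "ishom (mor 1) (ob 5) (ob 0)"
  shows "dsat ob mor (DConj inj_formula (DConj surj_formula exact_formula)) \<longleftrightarrow>
    short_exact (ob 1) (mor 0) (ob 5) (mor 1) (ob 0)"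
proof -
  define X' A B f' g' where defs: "X' = ob 1" "A = ob 0" "B = ob 5" "f' = mor 0" "g' = mor 1"
  note X = X[folded defs] and Ab = Ab[folded defs] and f = f[folded defs] and g = g[folded defs]
  have X': "Ab X'" "x \<epsilon> car X'"
    using X by (simp_all add: free_on_def)
  note comp_f = comp_props(1,2)[OF _ f X'(1)] and comp_g = comp_props(1,2)[OF _ g X'(1)]
  have "dsat ob mor inj_formula \<longleftrightarrow>
      (\<forall>u. ishom u X' X' \<longrightarrow> (\<forall>v. ishom v X' X' \<longrightarrow> comp f' u = comp f' v \<longrightarrow> u = v))"
    unfolding inj_formula_def by (simp add: defs)
  also have "\<dots> \<longleftrightarrow> (\<forall>u. ishom u X' X' \<longrightarrow> (\<forall>v. ishom v X' X' \<longrightarrow>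
      ap f' (ap u x) = ap f' (ap v x) \<longrightarrow> ap u x = ap v x))"
    using free_hom_eq_iff[OF X Ab(2)] free_hom_eq_iff[OF X X'(1)] comp_f X'(2) by (simp cong: imp_cong)
  also have "\<dots> \<longleftrightarrow> (\<forall>a. a \<epsilon> car X' \<longrightarrow> (\<forall>b. b \<epsilon> car X' \<longrightarrow> ap f' a = ap f' b \<longrightarrow> a = b))"
    unfolding free_all_hom[OF X X'(1), of "\<lambda>b. ap f' _ = ap f' b \<longrightarrow> _ = b"]
    by (rule free_all_hom[OF X X'(1)])
  finally have inj: "dsat ob mor inj_formula \<longleftrightarrow>
      (\<forall>a b. a \<epsilon> car X' \<longrightarrow> b \<epsilon> car X' \<longrightarrow> ap f' a = ap f' b \<longrightarrow> a = b)"
    by blast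
  have "dsat ob mor surj_formula \<longleftrightarrow>
      (\<forall>a. ishom a X' A \<longrightarrow> (\<exists>e. ishom e X' B \<and> comp g' e = a))"
    unfolding surj_formula_def by (simp add: defs)
  also have "\<dots> \<longleftrightarrow> (\<forall>a. ishom a X' A \<longrightarrow> (\<exists>e. ishom e X' B \<and> ap g' (ap e x) = ap a x))"
    using free_hom_eq_iff[OF X Ab(1)] comp_g X'(2) by (simp cong: imp_cong conj_cong)
  also have "\<dots> \<longleftrightarrow> (\<forall>a. a \<epsilon> car A \<longrightarrow> (\<exists>b. b \<epsilon> car B \<and> ap g' b = a))"
    unfolding free_ex_hom[OF X Ab(2), of "\<lambda>b. ap g' b = _"] by (rule free_all_hom[OF X Ab(1)])
  finally have surj: "dsat ob mor surj_formula \<longleftrightarrow>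
      (\<forall>a. a \<epsilon> car A \<longrightarrow> (\<exists>b. b \<epsilon> car B \<and> ap g' b = a))" .
  have "dsat ob mor exact_formula \<longleftrightarrow> (\<forall>e. ishom e X' B \<longrightarrow>
      ((\<forall>u. ishom u X' X' \<longrightarrow> comp g' (comp e u) = comp g' e) \<longleftrightarrow>
       (\<exists>n. ishom n X' X' \<and> comp f' n = e)))"
    unfolding exact_formula_def Let_def by (auto simp: defs)
  also have "\<dots> \<longleftrightarrow> (\<forall>e. ishom e X' B \<longrightarrow>
      (ap g' (ap e x) = zer A \<longleftrightarrow> (\<exists>y. y \<epsilon> car X' \<and> ap f' y = ap e x)))"
  proof -
    have "((\<forall>u. ishom u X' X' \<longrightarrow> comp g' (comp e u) = comp g' e) \<longleftrightarrow> ap g' (ap e x) = zer A) \<and>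
        ((\<exists>n. ishom n X' X' \<and> comp f' n = e) \<longleftrightarrow> (\<exists>y. y \<epsilon> car X' \<and> ap f' y = ap e x))"
      if e: "ishom e X' B" for e
    proof
      note ge = comp_g[OF e]
      have "(\<forall>u. ishom u X' X' \<longrightarrow> comp g' (comp e u) = comp g' e) \<longleftrightarrow>
          (\<forall>u. ishom u X' X' \<longrightarrow> ap g' (ap e (ap u x)) = ap g' (ap e x))"
        using free_hom_eq_iff[OF X Ab(1)] comp_g comp_props(1,2)[OF _ e X'(1)] ge X'(2)
        by (simp cong: imp_cong)
      also have "\<dots> \<longleftrightarrow> (\<forall>y. y \<epsilon> car X' \<longrightarrow> ap g' (ap e y) = ap g' (ap e x))"
        by (rule free_all_hom[OF X X'(1)])
      also have "\<dots> \<longleftrightarrow> ap g' (ap e x) = zer A"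
      proof
        \<comment> \<open>The common value is also the value at \<open>zer X'\<close>, which is
          zero.\<close>
        assume "\<forall>y. y \<epsilon> car X' \<longrightarrow> ap g' (ap e y) = ap g' (ap e x)"
        then have "ap g' (ap e (zer X')) = ap g' (ap e x)"
          using Ab_struct(4)[OF X'(1)] by blast
        then show "ap g' (ap e x) = zer A"
          using ishom_zer[OF e X'(1) Ab(2)] ishom_zer[OF g Ab(2,1)] by simp
      next
        assume 0: "ap g' (ap e x) = zer A"
        obtain o' where o: "ishom o' X' A" "\<And>y. y \<epsilon> car X' \<Longrightarrow> ap o' y = zer A"
          using zero_hom[OF X'(1) Ab(1)] by blast
        have "comp g' e = o'"
          using free_hom_eq_iff[OF X Ab(1) ge(1) o(1)] ge(2) o(2) X'(2) 0 by simp
        then show "\<forall>y. y \<epsilon> car X' \<longrightarrow> ap g' (ap e y) = ap g' (ap e x)"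
          using ge(2) o(2) 0 by metis
      qed
      finally show "(\<forall>u. ishom u X' X' \<longrightarrow> comp g' (comp e u) = comp g' e) \<longleftrightarrow> ap g' (ap e x) = zer A" .
      have "(\<exists>n. ishom n X' X' \<and> comp f' n = e) \<longleftrightarrow> (\<exists>n. ishom n X' X' \<and> ap f' (ap n x) = ap e x)"
        using free_hom_eq_iff[OF X Ab(2)] comp_f e X'(2) by (simp cong: conj_cong)
      also have "\<dots> \<longleftrightarrow> (\<exists>y. y \<epsilon> car X' \<and> ap f' y = ap e x)"
        by (rule free_ex_hom[OF X X'(1)])
      finally show "(\<exists>n. ishom n X' X' \<and> comp f' n = e) \<longleftrightarrow> (\<exists>y. y \<epsilon> car X' \<and> ap f' y = ap e x)" .
    qed
    then show ?thesis
      by (simp cong: imp_cong)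
  qed
  also have "\<dots> \<longleftrightarrow> (\<forall>b. b \<epsilon> car B \<longrightarrow> (ap g' b = zer A \<longleftrightarrow> (\<exists>y. y \<epsilon> car X' \<and> ap f' y = b)))"
    by (rule free_all_hom[OF X Ab(2)])
  finally show ?thesis
    using inj surj f g unfolding dsat.simps short_exact_def defs by blast
qed

lemma dsat_whitehead_formula:
  assumes A: "Ab (ob 0)"
  shows "dsat ob mor whitehead_formula \<longleftrightarrow> (\<forall>X x B f g. free_on X x \<longrightarrow> Ab B \<longrightarrow>
    short_exact X f B g (ob 0) \<longrightarrow> splits B g (ob 0))"
proof -
  have se: "dsat (ob(1 := X, 5 := B)) (mor(0 := f, 1 := g))
      (DConj inj_formula (DConj surj_formula exact_formula)) \<longleftrightarrow> short_exact X f B g (ob 0)"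
    if "free_on X x" "Ab B" "ishom f X B" "ishom g B (ob 0)" for X x B f g
    using dsat_short_exact[of "ob(1 := X, 5 := B)" x "mor(0 := f, 1 := g)"] that A by simp
  have "dsat ob mor whitehead_formula \<longleftrightarrow> (\<forall>X. Ab X \<longrightarrow> (\<exists>x. free_on X x) \<longrightarrow> (\<forall>B. Ab B \<longrightarrow>
      (\<forall>f. ishom f X B \<longrightarrow> (\<forall>g. ishom g B (ob 0) \<longrightarrow>
        dsat (ob(1 := X, 5 := B)) (mor(0 := f, 1 := g))
          (DConj inj_formula (DConj surj_formula exact_formula)) \<longrightarrow> splits B g (ob 0)))))"
    unfolding whitehead_formula_def splits_def
    by (simp add: dsat_free_formula del: dsat.simps(3))
  also have "\<dots> \<longleftrightarrow> (\<forall>X x B f g. free_on X x \<longrightarrow> Ab B \<longrightarrow>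
      short_exact X f B g (ob 0) \<longrightarrow> splits B g (ob 0))"
  proof (intro iffI allI impI)
    fix X x B f g
    assume L: "\<forall>X. Ab X \<longrightarrow> (\<exists>x. free_on X x) \<longrightarrow> (\<forall>B. Ab B \<longrightarrow> (\<forall>f. ishom f X B \<longrightarrow>
        (\<forall>g. ishom g B (ob 0) \<longrightarrow> dsat (ob(1 := X, 5 := B)) (mor(0 := f, 1 := g))
          (DConj inj_formula (DConj surj_formula exact_formula)) \<longrightarrow> splits B g (ob 0))))"
      and X: "free_on X x" and B: "Ab B" and ex: "short_exact X f B g (ob 0)"
    have fg: "ishom f X B" "ishom g B (ob 0)"
      using ex by (simp_all add: short_exact_def)
    have "Ab X"
      using X by (simp add: free_on_def)
    with L X B fg ex[folded se[OF X B fg]] show "splits B g (ob 0)"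
      by blast
  next
    fix X B f g
    assume R: "\<forall>X x B f g. free_on X x \<longrightarrow> Ab B \<longrightarrow> short_exact X f B g (ob 0) \<longrightarrow> splits B g (ob 0)"
      and "\<exists>x. free_on X x" and B: "Ab B" and fg: "ishom f X B" "ishom g B (ob 0)"
      and d: "dsat (ob(1 := X, 5 := B)) (mor(0 := f, 1 := g))
        (DConj inj_formula (DConj surj_formula exact_formula))"
    then obtain x where X: "free_on X x"
      by blast
    show "splits B g (ob 0)"
      using R X B d[unfolded se[OF X B fg]] by blast
  qed
  finally show ?thesis .
qed

text \<open>Precomposing \<open>f\<close> with the isomorphism from \<open>ZZ\<close> to
  \<open>X\<close> changes neither its image nor its injectivity. As \<open>B\<close> and
  \<open>g\<close> are kept, a section of one sequence is a section of the other.\<close>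

lemma short_exact_ZZ_free:
  assumes X: "free_on X x" and se: "short_exact X f B g A" and "Ab A" "Ab B"
  shows "\<exists>f'. short_exact ZZ f' B g A"
proof -
  have f: "ishom f X B" and X': "Ab X" "x \<epsilon> car X"
    using se X by (simp_all add: short_exact_def free_on_def)
  obtain j where j: "ishom j ZZ X" "ap j unit = x"
    using ZZ_hom_exists[OF X'] by blast
  obtain k where k: "ishom k X ZZ" "ap k x = unit"
    using X Ab_ZZ unit_ZC unfolding free_on_def by (metis car_ZZ)
  have "comp k j = idm ZZ"
    using free_hom_eq_iff[OF free_on_ZZ Ab_ZZ comp_props(1)[OF j(1) k(1) Ab_ZZ] ishom_idm[OF Ab_ZZ]]
      comp_props(2)[OF j(1) k(1) Ab_ZZ, of unit] ap_idm[of unit ZZ] j(2) k(2) by simp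
  then have kj: "ap k (ap j z) = z" if "z \<epsilon> ZC" for z
    using comp_eq_idm_iff[OF j(1) k(1) Ab_ZZ] that by simp
  have "comp j k = idm X"
    using free_hom_eq_iff[OF X X'(1) comp_props(1)[OF k(1) j(1) X'(1)] ishom_idm[OF X'(1)]]
      comp_props(2)[OF k(1) j(1) X'(1) X'(2)] ap_idm[OF X'(2)] j(2) k(2) by simp
  then have jk: "ap j (ap k z) = z" if "z \<epsilon> car X" for z
    using comp_eq_idm_iff[OF k(1) j(1) X'(1)] that by simp
  note fj = comp_props(1,2)[OF j(1) f Ab_ZZ] and j' = ishomD(1)[OF j(1)] and k' = ishomD(1)[OF k(1)]
  have "short_exact ZZ (comp f j) B g A"
    unfolding short_exact_def
  proof (intro conjI allI impI)
    show "ishom (comp f j) ZZ B" "ishom g B A"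
      using fj se by (simp_all add: short_exact_def)
    show "y = z" if "y \<epsilon> car ZZ" "z \<epsilon> car ZZ" "ap (comp f j) y = ap (comp f j) z" for y z
    proof -
      have "ap j y = ap j z"
        using se that fj(2) j' unfolding short_exact_def by simp
      then show ?thesis
        using kj that by (metis car_ZZ)
    qed
    show "\<exists>b. b \<epsilon> car B \<and> ap g b = a" if "a \<epsilon> car A" for a
      using se that by (simp add: short_exact_def)
    show "ap g b = zer A \<longleftrightarrow> (\<exists>z. z \<epsilon> car ZZ \<and> ap (comp f j) z = b)" if "b \<epsilon> car B" for b
    proof -
      have "ap g b = zer A \<longleftrightarrow> (\<exists>y. y \<epsilon> car X \<and> ap f y = b)"
        using se that by (simp add: short_exact_def)
      also have "\<dots> \<longleftrightarrow> (\<exists>z. z \<epsilon> car ZZ \<and> ap (comp f j) z = b)"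
        using fj(2) j' k' jk by metis
      finally show ?thesis .
    qed
  qed
  then show ?thesis ..
qed

lemma hold_whitehead_formula_iff:
  assumes "a < d" "Ab (\<rho> a)"
  shows "holds w d \<rho> (Ab_satisfies whitehead_formula a) \<longleftrightarrow> holds w d \<rho> (is_whitehead a)"
proof -
  have "holds w d \<rho> (Ab_satisfies whitehead_formula a) \<longleftrightarrow> dsat (\<lambda>_. \<rho> a) (\<lambda>_. \<rho> a) whitehead_formula"
    unfolding Ab_satisfies_def
    by (rule hold_holds_in_Ab[OF diagrammatic_whitehead_formula]) (use assms in \<open>simp_all add: typed_def\<close>)
  also have "\<dots> \<longleftrightarrow> (\<forall>X x B f g. free_on X x \<longrightarrow> Ab B \<longrightarrow>
      short_exact X f B g (\<rho> a) \<longrightarrow> splits B g (\<rho> a))"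
    using dsat_whitehead_formula[of "\<lambda>_. \<rho> a"] assms(2) by simp
  \<comment> \<open>From left to right \<open>X\<close> is taken to be \<open>ZZ\<close>; from right
    to left \<open>X\<close> is exchanged for \<open>ZZ\<close> with the same \<open>B\<close> and
    \<open>g\<close>.\<close>
  also have "\<dots> \<longleftrightarrow> (\<forall>B f g. Ab B \<longrightarrow> short_exact ZZ f B g (\<rho> a) \<longrightarrow> splits B g (\<rho> a))"
    using free_on_ZZ short_exact_ZZ_free[OF _ _ assms(2)] by blast
  also have "\<dots> \<longleftrightarrow> holds w d \<rho> (is_whitehead a)"
    using hold_is_whitehead[OF assms(1)] assms(2) by simp
  finally show ?thesis .
qed

end

theorem proposition10p3:
  "\<exists>\<phi>. diagrammatic {0} Map.empty \<phi> \<and>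
    ZFC_proves (\<^bold>\<forall>A. is_abgroup A \<^bold>\<longrightarrow> (Ab_satisfies \<phi> A \<^bold>\<longleftrightarrow> is_whitehead A))"
proof (intro exI conjI)
  show "diagrammatic {0} Map.empty whitehead_formula"
    by (rule diagrammatic_whitehead_formula)
  let ?F = "\<^bold>\<forall>A. is_abgroup A \<^bold>\<longrightarrow> (Ab_satisfies whitehead_formula A \<^bold>\<longleftrightarrow> is_whitehead A)"
  show "ZFC_proves ?F"
    unfolding ZFC_proves_def
  proof (rule completeness_infinite)
    show "infinite (range Q)" if "congruence Q E" "\<And>p v. p \<in> ZFC \<Longrightarrow> sat Q E v p"
      for Q E :: "nat \<Rightarrow> nat \<Rightarrow> bool"
      using that by (rule infinite_congruence_model)
    fix E :: "nat \<Rightarrow> nat \<Rightarrow> bool" and v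
    assume "\<And>p v. p \<in> ZFC \<Longrightarrow> sat (=) E v p"
    then interpret set_model E
      by (rule set_model_ZFC)
    \<comment> \<open>At depth 0 no level is in use, so the assignment \<open>\<rho>\<close> is
      arbitrary.\<close>
    have "holds v 0 \<rho> ?F" for \<rho>
      by (simp add: hold hold_whitehead_formula_iff)
    then show "sat (=) E v (?F 0)"
      by (simp add: hold_def)
  qed
qed

end
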